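(* Let $T_*>0$, $\beta\in[0,1]$, and let $\mathcal{L}$ be a Lévy operator with triplet $(A,0,\mu)$ and heat kernel $p_t$. Assume: (1) $p_t\in C_b^\infty(\mathbb{R}^d)$ and there exist $\alpha\in(1,2]$ and $c_0>0$ such that $\int_{\mathbb{R}^d}|Dp_t(y)|\,dy\le c_0t^{-1/\alpha}$ for all $t\in(0,T_*]$; moreover $\alpha+\beta\notin\mathbb{N}$; (2) $u_0\colon\mathbb{R}^d\to\mathbb{R}$ is bounded and Lipschitz; (3) $H=H(t,x,p,q)\colon[0,T_*]\times\mathbb{R}^d\times\mathbb{R}^d\times\mathbb{R}\to\mathbb{R}$ is continuous, there is $C>0$ with $|H(t,x,0,0)|\le C$ for all $t,x$, and for each $R>0$ there is $C_R>0$ such that for all $t\in[0,T_*]$, $x,x'\in\mathbb{R}^d$ and $p,p',q,q'\in B(0,R)$, $$|H(t,x',p',q')-H(t,x,p,q)|\le C_R\big(|x-x'|^\beta\wedge1+|p-p'|+|q-q'|\big);$$ (4) $Q$ is a linear operator (acting on functions on $\mathbb{R}^d$), and there is $C>0$ such that $\|Q\phi\|_\infty\le C\|\phi\|_{C_b^1(\mathbb{R}^d)}$ and $[Q\phi]_\sigma\le C\|\phi\|_{C_b^{1+\sigma}}$ for all $\sigma\in(0,\beta]$. Then, for sufficiently small $T\in(0,T_*]$, the problem $$\partial_tu-\mathcal{L}u-H(t,x,Du,Qu)=0\ \text{ in }(0,T]\times\mathbb{R}^d,\qquad u(0,x)=u_0(x),$$ has a unique mild solution $u\in C_b((0,T];C_b^1(\mathbb{R}^d))$,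 and $u(t)\in C_b^{\alpha+\beta}(\mathbb{R}^d)$ for all $t\in(0,T]$.
   Context: Lévy operator: $A$ is a nonnegative definite real symmetric $d\times d$ matrix, $\mu\ge 0$ is a Borel measure on $\mathbb{R}^d\setminus\{0\}$ with $\int(1\wedge|z|^2)\,d\mu(z)<\infty$, and $$\mathcal{L}\varphi(x)=\operatorname{div}(AD\varphi(x))+\int_{\mathbb{R}^d}\big[\varphi(x+z)-\varphi(x)-\mathbf{1}_{|z|<1}D\varphi(x)\cdot z\big]\,d\mu(z).$$ Heat kernel: $p_t$, $t>0$, are the probability measures with $\int e^{-i\xi\cdot x}p_t(dx)=e^{-t\psi(\xi)}$, where $\psi(\xi)=\xi\cdot A\xi+\int(1-e^{i\xi\cdot z}+i\xi\cdot z\mathbf{1}_{|z|<1})\,d\mu(z)$; they are assumed absolutely continuous with density again denoted $p_t$. Semigroup: $P_t\varphi=p_t*\varphi$. Hölder spaces: $C_b^n(\mathbb{R}^d)$ has norm $\sum_{j\le n}\max_{|\kappa|=j}\|\partial^\kappa\varphi\|_\infty$; for $\gamma=n+\beta'$ with $\beta'\in(0,1)$, $\|\varphi\|_{C_b^\gamma}=\|\varphi\|_{C_b^n}+\max_{|\kappa|=n}[\partial^\kappa\varphi]_{\beta'}$, where $[\varphi]_{\beta'}=\sup_{x,\,h\ne0}|\varphi(x+h)-\varphi(x)|/|h|^{\beta'}$ for $\beta'\in(0,1]$. $C_b((0,T];X)$ denotes bounded continuous functions from $(0,T]$ to $X$; $D$ is the spatial gradient; $Q$ is defined on $C_b^1(\mathbb{R}^d)$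 with values in bounded (measurable) real-valued functions on $\mathbb{R}^d$. Mild solution: $u\in C((0,T];C_b^1(\mathbb{R}^d))$ such that for all $t\in(0,T]$, $x\in\mathbb{R}^d$, $$u(t,x)=P_t[u_0](x)+\int_0^tP_{t-s}\big[H(s,\cdot,Du(s,\cdot),Qu(s,\cdot))\big](x)\,ds.$$
   Formalization: For β = 0 the term |x−x'|^β∧1 in (3) is read as 0 when x = x', so H is locally Lipschitz in (p,q); with 0^0 = 1 uniqueness fails, e.g. Qφ = φ, H = min(√|q|,1), u_0 = 0, which has the solutions 0 and t²/4. *)

theory Defs
  imports "HOL-Probability.Probability"
begin

section \<open>Derivatives and the spaces of bounded Hoelder functions\<close>

definition partial_deriv :: "'d \<Rightarrow> (real^'d \<Rightarrow> real) \<Rightarrow> real^'d \<Rightarrow> real" where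
  "partial_deriv i f x = frechet_derivative f (at x) (axis i 1)"

definition grad :: "(real^'d \<Rightarrow> real) \<Rightarrow> real^'d \<Rightarrow> real^'d" where
  "grad f x = (\<chi> i. partial_deriv i f x)"

text \<open>Multi-indices of order \<open>j\<close> are represented by words of length \<open>j\<close> over the index type, i.e. by
  all orders of differentiation. On functions that are \<open>j\<close> times continuously differentiable the
  order is irrelevant, so maxima over multi-indices and over words agree.\<close>

primrec iter_deriv :: "'d list \<Rightarrow> (real^'d \<Rightarrow> real) \<Rightarrow> real^'d \<Rightarrow> real" where
  "iter_deriv [] f = f"
| "iter_deriv (i # \<kappa>) f = partial_deriv i (iter_deriv \<kappa> f)"

definition cont_diff :: "nat \<Rightarrow> (real^'d \<Rightarrow> real) \<Rightarrow> bool" where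
  "cont_diff n f \<longleftrightarrow>
     (\<forall>\<kappa>. length \<kappa> < n \<longrightarrow> (\<forall>x. iter_deriv \<kappa> f differentiable (at x))) \<and>
     (\<forall>\<kappa>. length \<kappa> \<le> n \<longrightarrow> continuous_on UNIV (iter_deriv \<kappa> f))"

text \<open>Norms take values in \<open>ennreal\<close>, so that they are infinite (rather than an unspecified real
  number) on functions with unbounded derivatives or difference quotients.\<close>

definition sup_norm :: "(real^'d \<Rightarrow> real) \<Rightarrow> ennreal" where
  "sup_norm f = (SUP x. ennreal \<bar>f x\<bar>)"

definition holder_seminorm :: "real \<Rightarrow> (real^'d \<Rightarrow> real) \<Rightarrow> ennreal" where
  "holder_seminorm \<sigma> f =
     (SUP x. SUP h\<in>- {0}. ennreal (\<bar>f (x + h) - f x\<bar> / norm h powr \<sigma>))"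

text \<open>For \<open>\<gamma> \<ge> 0\<close>, an integer or not; for integer \<open>\<gamma>\<close> no seminorm is added, so \<open>Cb 2\<close> is the
  space of functions with two bounded continuous derivatives, not a space of functions with
  Lipschitz derivatives.\<close>

definition Cb_norm :: "real \<Rightarrow> (real^'d \<Rightarrow> real) \<Rightarrow> ennreal" where
  "Cb_norm \<gamma> f =
     (\<Sum>j\<le>nat \<lfloor>\<gamma>\<rfloor>. SUP \<kappa>\<in>{\<kappa>. length \<kappa> = j}. sup_norm (iter_deriv \<kappa> f)) +
     (if frac \<gamma> = 0 then 0
      else SUP \<kappa>\<in>{\<kappa>. length \<kappa> = nat \<lfloor>\<gamma>\<rfloor>}. holder_seminorm (frac \<gamma>) (iter_deriv \<kappa> f))"

definition Cb :: "real \<Rightarrow> (real^'d \<Rightarrow> real) set" where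
  "Cb \<gamma> = {f. cont_diff (nat \<lfloor>\<gamma>\<rfloor>) f \<and> Cb_norm \<gamma> f < \<infinity>}"

definition Cb_infinity :: "(real^'d \<Rightarrow> real) set" where
  "Cb_infinity = (\<Inter>n::nat. Cb (real n))"


section \<open>Levy operators and their heat kernels\<close>

text \<open>A Borel measure on the punctured space is represented by a Borel measure on the whole space
  that does not charge the origin.\<close>

definition levy_triplet :: "real^'d^'d \<Rightarrow> (real^'d) measure \<Rightarrow> bool" where
  "levy_triplet A \<mu> \<longleftrightarrow>
     transpose A = A \<and> (\<forall>\<xi>. 0 \<le> \<xi> \<bullet> (A *v \<xi>)) \<and>
     sets \<mu> = sets borel \<and> emeasure \<mu> {0} = 0 \<and>
     (\<integral>\<^sup>+ z. ennreal (min 1 ((norm z)\<^sup>2)) \<partial>\<mu>) < \<infinity>"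

text \<open>Minus the Fourier symbol of the operator mapping \<open>\<phi>\<close> to
  \<open>x \<mapsto> div (A D\<phi>(x)) + \<integral> (\<phi>(x + z) - \<phi>(x) - 1\<^bsub>|z|<1\<^esub> D\<phi>(x) \<bullet> z) d\<mu>(z)\<close>. This operator
  enters mild solutions only through its heat kernel.\<close>

definition levy_symbol :: "real^'d^'d \<Rightarrow> (real^'d) measure \<Rightarrow> real^'d \<Rightarrow> complex" where
  "levy_symbol A \<mu> \<xi> =
     of_real (\<xi> \<bullet> (A *v \<xi>)) +
     (\<integral>z. 1 - exp (\<i> * of_real (\<xi> \<bullet> z)) + \<i> * of_real (\<xi> \<bullet> z) * indicator (ball 0 1) z \<partial>\<mu>)"

definition heat_kernel ::
    "real^'d^'d \<Rightarrow> (real^'d) measure \<Rightarrow> (real \<Rightarrow> real^'d \<Rightarrow> real) \<Rightarrow> bool" where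
  "heat_kernel A \<mu> p \<longleftrightarrow>
     (\<forall>t>0. p t \<in> borel_measurable borel \<and> (\<forall>x. 0 \<le> p t x) \<and>
        prob_space (density lborel (\<lambda>x. ennreal (p t x))) \<and>
        (\<forall>\<xi>. (\<integral>x. exp (- (\<i> * of_real (\<xi> \<bullet> x))) \<partial>density lborel (\<lambda>x. ennreal (p t x))) =
             exp (- (of_real t * levy_symbol A \<mu> \<xi>))))"

text \<open>The convolution of \<open>p t\<close> and \<open>\<phi>\<close>; Lebesgue measurable \<open>\<phi>\<close> are allowed.\<close>

definition semigroup_op ::
    "(real \<Rightarrow> real^'d \<Rightarrow> real) \<Rightarrow> real \<Rightarrow> (real^'d \<Rightarrow> real) \<Rightarrow> real^'d \<Rightarrow> real" where
  "semigroup_op p t \<phi> x = (\<integral>y. p t (x - y) * \<phi> y \<partial>lebesgue)"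


section \<open>Linear operators on bounded differentiable functions, mild solutions\<close>

text \<open>Only the values of \<open>Q\<close> on \<open>Cb 1\<close> matter.\<close>

definition linear_on_Cb1 :: "((real^'d \<Rightarrow> real) \<Rightarrow> real^'d \<Rightarrow> real) \<Rightarrow> bool" where
  "linear_on_Cb1 Q \<longleftrightarrow>
     (\<forall>\<phi>\<in>Cb 1. \<forall>\<psi>\<in>Cb 1. \<forall>a b x. Q (\<lambda>y. a * \<phi> y + b * \<psi> y) x = a * Q \<phi> x + b * Q \<psi> x)"

definition continuous_Cb1 :: "real \<Rightarrow> (real \<Rightarrow> real^'d \<Rightarrow> real) \<Rightarrow> bool" where
  "continuous_Cb1 T u \<longleftrightarrow>
     (\<forall>t\<in>{0<..T}. u t \<in> Cb 1 \<and>
        ((\<lambda>s. Cb_norm 1 (\<lambda>x. u s x - u t x)) \<longlongrightarrow> 0) (at t within {0<..T}))"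

definition bounded_Cb1 :: "real \<Rightarrow> (real \<Rightarrow> real^'d \<Rightarrow> real) \<Rightarrow> bool" where
  "bounded_Cb1 T u \<longleftrightarrow> (\<exists>M::real. \<forall>t\<in>{0<..T}. Cb_norm 1 (u t) \<le> ennreal M)"

text \<open>Solutions are functions on \<open>{0<..T}\<close>: the values of \<open>u t\<close> for other \<open>t\<close> are irrelevant.
  Convergence of the time integral, implicit in its occurrence in the formula, is
  stated explicitly because divergent integrals have value zero in Isabelle.\<close>

definition mild_solution ::
    "(real \<Rightarrow> real^'d \<Rightarrow> real) \<Rightarrow>
     (real \<Rightarrow> real^'d \<Rightarrow> real^'d \<Rightarrow> real \<Rightarrow> real) \<Rightarrow>
     ((real^'d \<Rightarrow> real) \<Rightarrow> real^'d \<Rightarrow> real) \<Rightarrow>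
     (real^'d \<Rightarrow> real) \<Rightarrow> real \<Rightarrow> (real \<Rightarrow> real^'d \<Rightarrow> real) \<Rightarrow> bool" where
  "mild_solution p H Q u0 T u \<longleftrightarrow>
     continuous_Cb1 T u \<and>
     (\<forall>t\<in>{0<..T}. \<forall>x.
        set_integrable lborel {0<..<t}
          (\<lambda>s. semigroup_op p (t - s) (\<lambda>y. H s y (grad (u s) y) (Q (u s) y)) x) \<and>
        u t x = semigroup_op p t u0 x +
          (LBINT s:{0<..<t}. semigroup_op p (t - s) (\<lambda>y. H s y (grad (u s) y) (Q (u s) y)) x))"

end

theory Submission
  imports Defs
begin

text \<open>The heat kernels form a convolution semigroup that is \<open>L\<^sup>1\<close>-continuous in time: both facts are
  read off the Fourier transforms, because a bounded Lipschitz integrable function is recovered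
  from its Fourier transform by smoothing with Gaussians. Splitting \<open>P\<^bsub>t\<^esub> = P\<^bsub>t/2\<^esub> P\<^bsub>t/2\<^esub>\<close> repeatedly,
  the bound on \<open>\<integral>|Dp\<^bsub>t\<^esub>|\<close> gives bounds of order \<open>t powr (- k / \<alpha>)\<close> on \<open>k\<close> derivatives of
  \<open>P\<^bsub>t\<^esub> \<phi>\<close>, improved to \<open>t powr (- (k - \<sigma>) / \<alpha>)\<close> when \<open>\<phi>\<close> is \<open>\<sigma>\<close>-Hoelder. As \<open>\<alpha> > 1\<close>, the gradient
  bound is integrable in time, so the map defining mild solutions is a contraction for small times;
  uniqueness among all bounded solutions follows by iterating the contraction estimate over short
  time steps. For the regularity, the Hoelder exponent of \<open>H(s, x, Du(s, x), Qu(s, x))\<close> in \<open>x\<close> is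
  raised step by step from \<open>0\<close> to \<open>\<beta>\<close>; the endpoint exponent \<open>\<alpha> + \<beta>\<close> is reached by splitting the
  Duhamel integral of an increment \<open>h\<close> at distance \<open>|h| powr \<alpha>\<close> from the final time.\<close>


section \<open>Calculus of partial derivatives\<close>

text \<open>Several obstacles shape the details. \<open>Q\<close> yields functions that are merely
  Lebesgue measurable, so the semigroup integrates over \<open>lebesgue\<close> and bounded
  functions are replaced by Borel versions before convolving. Pointwise convergence can be read off
  Fourier transforms only under a common Lipschitz constant; since \<open>p (t + h)\<close> is
  \<open>p t\<close> averaged against a probability density, it inherits the constant of
  \<open>p t\<close>. For this reason continuity in time is first shown to the right of a fixed time
  and then carried to later times by the semigroup. The datum \<open>u0\<close> is only Lipschitz:
  solutions are bounded in C^1 up to time 0, but continuity into C^1 and Hoelder bounds are claimed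
  for positive times, so each regularity step gives up a part of the interval near 0. The final time
  is cut to at most 1, which makes negative powers of time at least 1 and lets estimates of lower
  order be absorbed into those of higher order. That \<open>\<alpha> + \<beta>\<close> is not an
  integer enters in the last step: the gain of \<alpha> full derivatives by a Duhamel integral is
  obtained for Hoelder exponents with a positive fractional part.\<close>

lemma iter_deriv_append: "iter_deriv (\<kappa> @ \<kappa>') f = iter_deriv \<kappa> (iter_deriv \<kappa>' f)"
  by (induction \<kappa>) auto

text \<open>Expand the increment in the standard basis and use linearity. Derivatives are always
  computed in this coordinate form, from which \<open>partial_deriv_eqI\<close> reads off the
  partial derivatives by uniqueness of the Frechet derivative.\<close>

lemma has_derivative_partial_deriv:
  fixes f :: "real^'d \<Rightarrow> real"
  assumes "f differentiable (at x)"
  shows "(f has_derivative (\<lambda>h. \<Sum>i\<in>UNIV. h $ i * partial_deriv i f x)) (at x)"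
proof -
  have D: "(f has_derivative frechet_derivative f (at x)) (at x)"
    using assms by (simp add: frechet_derivative_works)
  then interpret linear "frechet_derivative f (at x)"
    by (rule has_derivative_linear)
  have "frechet_derivative f (at x) h = (\<Sum>i\<in>UNIV. h $ i * partial_deriv i f x)" for h
  proof -
    have "frechet_derivative f (at x) h =
        frechet_derivative f (at x) (\<Sum>i\<in>UNIV. h $ i *s axis i 1)"
      by (simp add: basis_expansion)
    also have "\<dots> = (\<Sum>i\<in>UNIV. h $ i * partial_deriv i f x)"
      by (simp add: sum scale partial_deriv_def scalar_mult_eq_scaleR)
    finally show ?thesis .
  qed
  then have "frechet_derivative f (at x) = (\<lambda>h. \<Sum>i\<in>UNIV. h $ i * partial_deriv i f x)"
    by blast
  with D show ?thesis by simp
qed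

lemma partial_deriv_eqI:
  fixes f :: "real^'d \<Rightarrow> real"
  assumes "(f has_derivative (\<lambda>h. \<Sum>i\<in>UNIV. h $ i * G i)) (at x)"
  shows "partial_deriv i f x = G i"
proof -
  have "frechet_derivative f (at x) = (\<lambda>h. \<Sum>i\<in>UNIV. h $ i * G i)"
    using frechet_derivative_at[OF assms] by simp
  then show ?thesis
    by (simp add: partial_deriv_def axis_def if_distrib[of "\<lambda>u. u * _"] cong: if_cong)
qed

lemma has_real_derivative_partial_deriv:
  fixes f :: "real^'d \<Rightarrow> real"
  assumes "f differentiable (at (x + s *\<^sub>R axis i 1))"
  shows "((\<lambda>s. f (x + s *\<^sub>R axis i 1)) has_real_derivative
           partial_deriv i f (x + s *\<^sub>R axis i 1)) (at s)"
proof -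
  have "((\<lambda>s::real. x + s *\<^sub>R axis i (1::real)) has_derivative (\<lambda>h. h *\<^sub>R axis i 1)) (at s)"
    by (auto intro!: derivative_eq_intros)
  from has_derivative_compose[OF this has_derivative_partial_deriv[OF assms]]
  have "((\<lambda>s. f (x + s *\<^sub>R axis i 1)) has_derivative
     (\<lambda>h. \<Sum>j\<in>UNIV. (h *\<^sub>R axis i 1) $ j * partial_deriv j f (x + s *\<^sub>R axis i 1))) (at s)" .
  moreover have "(\<lambda>h. \<Sum>j\<in>UNIV. (h *\<^sub>R axis i 1) $ j * partial_deriv j f (x + s *\<^sub>R axis i 1))
     = (*) (partial_deriv i f (x + s *\<^sub>R axis i 1))"
    by (simp add: fun_eq_iff axis_def if_distrib[of "\<lambda>u. u * _"] if_distrib[of "\<lambda>u. _ * u"] cong: if_cong)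
  ultimately show ?thesis
    by (simp add: has_field_derivative_def)
qed

lemma differentiable_sum_partialI:
  "(f has_derivative (\<lambda>h. \<Sum>i\<in>UNIV. h $ i * G i)) (at x) \<Longrightarrow> f differentiable (at x)"
  unfolding differentiable_def by blast

lemma partial_deriv_minus_fun:
  fixes f g :: "real^'d \<Rightarrow> real"
  assumes "f differentiable (at x)" "g differentiable (at x)"
  shows "partial_deriv i (\<lambda>y. f y - g y) x = partial_deriv i f x - partial_deriv i g x"
  by (rule partial_deriv_eqI[of _ "\<lambda>i. partial_deriv i f x - partial_deriv i g x"])
    (use has_derivative_diff[OF assms[THEN has_derivative_partial_deriv]] in
      \<open>simp add: algebra_simps sum_subtractf\<close>)

lemma partial_deriv_add_fun:
  fixes f g :: "real^'d \<Rightarrow> real"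
  assumes "f differentiable (at x)" "g differentiable (at x)"
  shows "partial_deriv i (\<lambda>y. f y + g y) x = partial_deriv i f x + partial_deriv i g x"
  by (rule partial_deriv_eqI[of _ "\<lambda>i. partial_deriv i f x + partial_deriv i g x"])
    (use has_derivative_add[OF assms[THEN has_derivative_partial_deriv]] in
      \<open>simp add: algebra_simps sum.distrib\<close>)

lemma partial_deriv_shift:
  fixes f :: "real^'d \<Rightarrow> real"
  assumes "f differentiable (at (x + c))"
  shows "(\<lambda>x. f (x + c)) differentiable (at x)"
    and "partial_deriv i (\<lambda>x. f (x + c)) x = partial_deriv i f (x + c)"
proof -
  have "((\<lambda>x. x + c) has_derivative (\<lambda>h. h)) (at x)"
    by (auto intro!: derivative_eq_intros)
  from has_derivative_compose[OF this has_derivative_partial_deriv[OF assms]]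
  have *: "((\<lambda>x. f (x + c)) has_derivative (\<lambda>h. \<Sum>j\<in>UNIV. h $ j * partial_deriv j f (x + c))) (at x)" .
  show "(\<lambda>x. f (x + c)) differentiable (at x)"
    using * by (rule differentiable_sum_partialI)
  show "partial_deriv i (\<lambda>x. f (x + c)) x = partial_deriv i f (x + c)"
    using * by (rule partial_deriv_eqI)
qed

text \<open>The partial derivative is a limit of quotients bounded by \<open>L\<close>. For
  Lipschitz initial data this gives gradient bounds that do not blow up as time tends to 0.\<close>

lemma partial_deriv_le_lipschitz:
  fixes f :: "real^'d \<Rightarrow> real"
  assumes "f differentiable (at x)" and lip: "\<And>y h. \<bar>f (y + h) - f y\<bar> \<le> L * norm h"
  shows "\<bar>partial_deriv i f x\<bar> \<le> L"
proof -
  have "((\<lambda>s. f (x + s *\<^sub>R axis i 1)) has_real_derivative partial_deriv i f x) (at 0)"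
    using has_real_derivative_partial_deriv[of f x 0 i] assms(1) by simp
  then have "((\<lambda>s. (f (x + s *\<^sub>R axis i 1) - f x) / s) \<longlongrightarrow> partial_deriv i f x) (at 0)"
    by (simp add: has_field_derivative_iff)
  then have "((\<lambda>s. \<bar>(f (x + s *\<^sub>R axis i 1) - f x) / s\<bar>) \<longlongrightarrow> \<bar>partial_deriv i f x\<bar>) (at 0)"
    by (rule tendsto_rabs)
  moreover have "\<forall>\<^sub>F s::real in at 0. \<bar>(f (x + s *\<^sub>R axis i 1) - f x) / s\<bar> \<le> L"
    using lip[of x "_ *\<^sub>R axis i 1"]
    by (auto simp: eventually_at_filter abs_divide divide_le_eq mult.commute intro!: always_eventually)
  ultimately show ?thesis
    by (rule tendsto_upperbound) simp
qed

lemma partial_deriv_mean_value: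
  fixes f :: "real^'d \<Rightarrow> real"
  assumes "\<And>x. f differentiable (at x)" "r > 0"
  obtains s where "0 < s" "s < r"
    "f (x + r *\<^sub>R axis i 1) - f x = r * partial_deriv i f (x + s *\<^sub>R axis i 1)"
proof -
  have "\<exists>z>0. z < r \<and> f (x + r *\<^sub>R axis i 1) - f (x + 0 *\<^sub>R axis i 1)
       = (r - 0) * partial_deriv i f (x + z *\<^sub>R axis i 1)"
    by (rule MVT2[OF \<open>r > 0\<close>]) (rule has_real_derivative_partial_deriv[OF assms(1)])
  with that show ?thesis by auto
qed

lemma sum_coord_mult_le:
  fixes h :: "real^'d"
  assumes "\<And>i. \<bar>G i\<bar> \<le> K"
  shows "\<bar>\<Sum>i\<in>UNIV. h $ i * G i\<bar> \<le> real CARD('d) * K * norm h"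
proof -
  have "\<bar>\<Sum>i\<in>UNIV. h $ i * G i\<bar> \<le> (\<Sum>i\<in>UNIV. \<bar>h $ i * G i\<bar>)"
    by (rule sum_abs)
  also have "\<dots> \<le> (\<Sum>i\<in>(UNIV::'d set). norm h * K)"
    using assms component_le_norm_cart[of h] by (intro sum_mono) (auto simp: abs_mult intro!: mult_mono)
  finally show ?thesis by (simp add: mult_ac)
qed

text \<open>Mean value inequality, with the differential estimated coordinate by coordinate; this
  costs the factor \<open>CARD('d)\<close>, harmless because constants need not be sharp.\<close>

lemma lipschitz_of_partial_deriv_bound:
  fixes f :: "real^'d \<Rightarrow> real"
  assumes "\<And>x. f differentiable (at x)" "\<And>i x. \<bar>partial_deriv i f x\<bar> \<le> K"
  shows "\<bar>f (x + h) - f x\<bar> \<le> real CARD('d) * K * norm h"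
proof -
  have "norm (f (x + h) - f x) \<le> real CARD('d) * K * norm (x + h - x)"
  proof (rule differentiable_bound[OF convex_UNIV])
    show "(f has_derivative (\<lambda>h. \<Sum>i\<in>UNIV. h $ i * partial_deriv i f y)) (at y within UNIV)" for y
      using has_derivative_partial_deriv[OF assms(1)] by simp
    show "onorm (\<lambda>h. \<Sum>i\<in>UNIV. h $ i * partial_deriv i f y) \<le> real CARD('d) * K" for y
      using sum_coord_mult_le[OF assms(2)] by (intro onorm_le) auto
  qed auto
  then show ?thesis by simp
qed

section \<open>Functions of class C^n\<close>

lemma cont_diff_0_iff: "cont_diff 0 f \<longleftrightarrow> continuous_on UNIV f"
  by (auto simp: cont_diff_def)

lemma cont_diff_mono: "cont_diff n f \<Longrightarrow> m \<le> n \<Longrightarrow> cont_diff m f"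
  by (auto simp: cont_diff_def)

lemma cont_diff_continuous: "cont_diff n f \<Longrightarrow> continuous_on UNIV f"
  by (metis cont_diff_0_iff cont_diff_mono le0)

lemma cont_diff_iter_deriv_continuous:
  "cont_diff n f \<Longrightarrow> length \<kappa> \<le> n \<Longrightarrow> continuous_on UNIV (iter_deriv \<kappa> f)"
  by (auto simp: cont_diff_def)

lemma cont_diff_iter_deriv_differentiable:
  "cont_diff n f \<Longrightarrow> length \<kappa> < n \<Longrightarrow> iter_deriv \<kappa> f differentiable (at x)"
  by (auto simp: cont_diff_def)

lemma cont_diff_1_iff:
  "cont_diff (Suc 0) f \<longleftrightarrow> (\<forall>x. f differentiable (at x)) \<and> (\<forall>i. continuous_on UNIV (partial_deriv i f))"
proof (intro iffI conjI allI)
  assume R: "(\<forall>x. f differentiable (at x)) \<and> (\<forall>i. continuous_on UNIV (partial_deriv i f))"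
  have c: "continuous_on UNIV f"
    using R by (auto simp: continuous_on_eq_continuous_at intro: differentiable_imp_continuous_within)
  have "continuous_on UNIV (iter_deriv \<kappa> f)" if "length \<kappa> \<le> Suc 0" for \<kappa>
    using that c R by (cases \<kappa>) auto
  then show "cont_diff (Suc 0) f"
    using R by (simp add: cont_diff_def)
next
  assume f: "cont_diff (Suc 0) f"
  show "f differentiable (at x)" for x
    using cont_diff_iter_deriv_differentiable[OF f, of "[]"] by simp
  show "continuous_on UNIV (partial_deriv i f)" for i
    using cont_diff_iter_deriv_continuous[OF f, of "[i]"] by simp
qed

text \<open>Reduces class C^(n+1) to class C^1 of every derivative of order at most
  \<open>n\<close>, so that facts about one derivative can be iterated.\<close>

lemma cont_diff_Suc_iff:
  "cont_diff (Suc n) f \<longleftrightarrow>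
     continuous_on UNIV f \<and> (\<forall>\<kappa>. length \<kappa> \<le> n \<longrightarrow> cont_diff (Suc 0) (iter_deriv \<kappa> f))"
proof (intro iffI conjI allI impI)
  assume f: "cont_diff (Suc n) f"
  show "continuous_on UNIV f" by (rule cont_diff_continuous[OF f])
  fix \<kappa> :: "'a list" assume "length \<kappa> \<le> n"
  then show "cont_diff (Suc 0) (iter_deriv \<kappa> f)"
    using cont_diff_iter_deriv_differentiable[OF f, of \<kappa>]
      cont_diff_iter_deriv_continuous[OF f, of "_ # \<kappa>"] by (auto simp: cont_diff_1_iff)
next
  assume R: "continuous_on UNIV f \<and> (\<forall>\<kappa>. length \<kappa> \<le> n \<longrightarrow> cont_diff (Suc 0) (iter_deriv \<kappa> f))"
  have "continuous_on UNIV (iter_deriv \<kappa> f)" if "length \<kappa> \<le> Suc n" for \<kappa>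
    using that R by (cases \<kappa>) (auto simp: cont_diff_1_iff)
  then show "cont_diff (Suc n) f"
    using R by (auto simp: cont_diff_def cont_diff_1_iff less_Suc_eq_le)
qed

lemma cont_diff_1_iter_deriv:
  "cont_diff (Suc n) f \<Longrightarrow> length \<kappa> \<le> n \<Longrightarrow> cont_diff (Suc 0) (iter_deriv \<kappa> f)"
  unfolding cont_diff_Suc_iff[of n f] by blast

text \<open>Here the derivative taken first, the last letter of the word, is split off, whereas
  \<open>iter_deriv\<close> recurses on the one taken last. This order suits the semigroup, whose
  first derivative is again a semigroup image.\<close>

lemma cont_diff_Suc_partial:
  assumes "\<And>x. f differentiable (at x)" "\<And>i. cont_diff n (partial_deriv i f)"
  shows "cont_diff (Suc n) f"
proof -
  have c: "continuous_on UNIV f"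
    using assms(1) by (auto simp: continuous_on_eq_continuous_at intro: differentiable_imp_continuous_within)
  have *: "iter_deriv (\<kappa> @ [i]) f = iter_deriv \<kappa> (partial_deriv i f)" for \<kappa> i
    by (simp add: iter_deriv_append)
  show ?thesis
    unfolding cont_diff_def
  proof (intro conjI allI impI)
    show "iter_deriv \<kappa> f differentiable (at x)" if "length \<kappa> < Suc n" for \<kappa> x
      using that assms cont_diff_iter_deriv_differentiable[OF assms(2)]
      by (cases \<kappa> rule: rev_cases) (auto simp: *)
    show "continuous_on UNIV (iter_deriv \<kappa> f)" if "length \<kappa> \<le> Suc n" for \<kappa>
      using that c cont_diff_iter_deriv_continuous[OF assms(2)]
      by (cases \<kappa> rule: rev_cases) (auto simp: *)
  qed
qed

lemma iter_deriv_minus_fun: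
  assumes "cont_diff n f" "cont_diff n g" "length \<kappa> \<le> n"
  shows "iter_deriv \<kappa> (\<lambda>x. f x - g x) = (\<lambda>x. iter_deriv \<kappa> f x - iter_deriv \<kappa> g x)"
  using assms(3)
proof (induction \<kappa>)
  case (Cons i \<kappa>)
  then have "iter_deriv \<kappa> (\<lambda>x. f x - g x) = (\<lambda>x. iter_deriv \<kappa> f x - iter_deriv \<kappa> g x)"
    and "length \<kappa> < n" by auto
  then show ?case
    using cont_diff_iter_deriv_differentiable[OF assms(1), of \<kappa>]
      cont_diff_iter_deriv_differentiable[OF assms(2), of \<kappa>]
    by (simp add: partial_deriv_minus_fun)
qed auto

lemma iter_deriv_add_fun:
  assumes "cont_diff n f" "cont_diff n g" "length \<kappa> \<le> n"
  shows "iter_deriv \<kappa> (\<lambda>x. f x + g x) = (\<lambda>x. iter_deriv \<kappa> f x + iter_deriv \<kappa> g x)"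
  using assms(3)
proof (induction \<kappa>)
  case (Cons i \<kappa>)
  then have "iter_deriv \<kappa> (\<lambda>x. f x + g x) = (\<lambda>x. iter_deriv \<kappa> f x + iter_deriv \<kappa> g x)"
    and "length \<kappa> < n" by auto
  then show ?case
    using cont_diff_iter_deriv_differentiable[OF assms(1), of \<kappa>]
      cont_diff_iter_deriv_differentiable[OF assms(2), of \<kappa>]
    by (simp add: partial_deriv_add_fun)
qed auto

lemma cont_diff_diff:
  assumes "cont_diff n f" "cont_diff n g"
  shows "cont_diff n (\<lambda>x. f x - g x)"
  using assms unfolding cont_diff_def
  by (auto simp: iter_deriv_minus_fun[OF assms] less_imp_le intro!: continuous_intros derivative_intros)

lemma cont_diff_add:
  assumes "cont_diff n f" "cont_diff n g"
  shows "cont_diff n (\<lambda>x. f x + g x)"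
  using assms unfolding cont_diff_def
  by (auto simp: iter_deriv_add_fun[OF assms] less_imp_le intro!: continuous_intros derivative_intros)

lemma cont_diff_const: "cont_diff n (\<lambda>x::real^'d. c)"
proof -
  have p: "partial_deriv i (\<lambda>x::real^'d. c) = (\<lambda>x. 0)" for i and c :: real
    by (simp add: partial_deriv_def fun_eq_iff)
  have "\<exists>c'. iter_deriv \<kappa> (\<lambda>x::real^'d. c) = (\<lambda>x. c')" for \<kappa> and c :: real
    by (induction \<kappa>) (auto simp: p)
  then show ?thesis
    unfolding cont_diff_def by (metis differentiable_const continuous_on_const)
qed

text \<open>Uniform convergence of the partial derivatives on a ball makes the differentials
  converge uniformly relative to the increment, so the theorem on derivatives of sequences applies
  on that convex set; its limit agrees with \<open>v\<close> by pointwise convergence. Balls suffice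
  because differentiability and continuity are local.\<close>

lemma cont_diff_1_uniform_limit:
  fixes w :: "nat \<Rightarrow> real^'d \<Rightarrow> real"
  assumes w: "\<And>n. cont_diff (Suc 0) (w n)" and lim: "\<And>x. (\<lambda>n. w n x) \<longlonglongrightarrow> v x"
    and unif: "\<And>i R. uniform_limit (ball 0 R) (\<lambda>n. partial_deriv i (w n)) (G i) sequentially"
  shows "cont_diff (Suc 0) v" and "partial_deriv i v x = G i x"
proof -
  have D: "(v has_derivative (\<lambda>h. \<Sum>i\<in>UNIV. h $ i * G i x)) (at x)" for x
  proof -
    define R where "R = norm x + 1"
    have x: "x \<in> ball 0 R" by (simp add: R_def)
    have "\<exists>g. \<forall>y\<in>ball 0 R. (\<lambda>n. w n y) \<longlonglongrightarrow> g y \<and>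
        (g has_derivative (\<lambda>h. \<Sum>i\<in>UNIV. h $ i * G i y)) (at y within ball 0 R)"
    proof (rule has_derivative_sequence[OF convex_ball _ _ x lim])
      show "(w n has_derivative (\<lambda>h. \<Sum>i\<in>UNIV. h $ i * partial_deriv i (w n) y)) (at y within ball 0 R)" for n y
        using w[of n] unfolding cont_diff_1_iff
        by (intro has_derivative_at_withinI[OF has_derivative_partial_deriv]) blast
      fix e :: real assume "e > 0"
      \<comment> \<open>\<open>CARD('d)\<close> coordinate errors of size \<open>e'\<close> add up
        to \<open>e\<close>.\<close>
      define e' where "e' = e / real CARD('d)"
      have e': "e' > 0" using \<open>e > 0\<close> by (simp add: e'_def)
      have "\<forall>\<^sub>F n in sequentially. \<forall>i. \<forall>y\<in>ball 0 R. dist (partial_deriv i (w n) y) (G i y) < e'"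
        using unif e' by (intro eventually_all_finite) (auto simp: uniform_limit_iff)
      then show "\<forall>\<^sub>F n in sequentially. \<forall>y\<in>ball 0 R. \<forall>h. norm ((\<Sum>i\<in>UNIV. h $ i * partial_deriv i (w n) y)
          - (\<Sum>i\<in>UNIV. h $ i * G i y)) \<le> e * norm h"
      proof eventually_elim
        case (elim n)
        show ?case
        proof (intro ballI allI)
          fix y h assume "y \<in> ball (0::real^'d) R"
          then have *: "\<bar>partial_deriv i (w n) y - G i y\<bar> \<le> e'" for i
            using elim by (auto simp: dist_real_def less_imp_le)
          have "\<bar>\<Sum>i\<in>UNIV. h $ i * (partial_deriv i (w n) y - G i y)\<bar> \<le> real CARD('d) * e' * norm h"
            by (rule sum_coord_mult_le[OF *])
          then show "norm ((\<Sum>i\<in>UNIV. h $ i * partial_deriv i (w n) y) - (\<Sum>i\<in>UNIV. h $ i * G i y)) \<le> e * norm h"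
            by (simp add: e'_def algebra_simps sum_subtractf)
        qed
      qed
    qed
    then obtain g where g: "\<And>y. y \<in> ball 0 R \<Longrightarrow> (\<lambda>n. w n y) \<longlonglongrightarrow> g y"
      and gD: "(g has_derivative (\<lambda>h. \<Sum>i\<in>UNIV. h $ i * G i x)) (at x within ball 0 R)"
      using x by blast
    have "g y = v y" if "y \<in> ball 0 R" for y
      using g[OF that] lim LIMSEQ_unique by blast
    then have "(v has_derivative (\<lambda>h. \<Sum>i\<in>UNIV. h $ i * G i x)) (at x within ball 0 R)"
      using has_derivative_transform[OF x _ gD, of v] by auto
    then show ?thesis
      using at_within_open[OF x open_ball] by simp
  qed
  have P: "partial_deriv i v = G i" for i
    using partial_deriv_eqI[OF D] by blast
  then show "partial_deriv i v x = G i x" by simp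
  have "continuous_on (ball 0 R) (G i)" for R i
    using w by (intro uniform_limit_theorem[OF _ unif[where R=R]] always_eventually)
      (auto simp: cont_diff_1_iff intro: continuous_on_subset)
  then have "isCont (G i) x" for i x
    using continuous_on_eq_continuous_at[OF open_ball, of 0 "norm x + 1" "G i"] by auto
  then show "cont_diff (Suc 0) v"
    using differentiable_sum_partialI[OF D] P
    by (auto simp: cont_diff_1_iff continuous_on_eq_continuous_at)
qed

section \<open>Differentiation under the integral sign\<close>

lemma norm_divideR_norm: "norm (a /\<^sub>R norm h) = norm a / norm h" for a :: real
  by (simp add: abs_mult divide_inverse mult.commute)

text \<open>Dominated convergence for the remainder quotient of the total derivative: by the mean
  value inequality it is at most \<open>2 * CARD('d) * b s\<close>. A second application gives
  continuity of the partial derivatives.\<close>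

lemma integral_parameter_cont_diff_1:
  fixes g :: "'a \<Rightarrow> real^'d \<Rightarrow> real"
  assumes g: "\<And>s. s \<in> space M \<Longrightarrow> cont_diff (Suc 0) (g s)"
    and int: "\<And>x. integrable M (\<lambda>s. g s x)"
    and b: "integrable M b" and bound: "\<And>s i x. s \<in> space M \<Longrightarrow> \<bar>partial_deriv i (g s) x\<bar> \<le> b s"
  shows "integrable M (\<lambda>s. partial_deriv i (g s) x)"
    and "cont_diff (Suc 0) (\<lambda>x. \<integral>s. g s x \<partial>M)"
    and "partial_deriv i (\<lambda>x. \<integral>s. g s x \<partial>M) x = (\<integral>s. partial_deriv i (g s) x \<partial>M)"
proof -
  let ?D = "\<lambda>i x s. partial_deriv i (g s) x"
  have diff: "g s differentiable (at x)" if "s \<in> space M" for s x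
    using g[OF that] by (auto simp: cont_diff_1_iff)
  \<comment> \<open>Measurability of the derivative in \<open>s\<close> is not among the
    assumptions; it is inherited from difference quotients with steps
    \<open>1 / (n + 1)\<close>.\<close>
  have meas[measurable]: "?D i x \<in> borel_measurable M" for i x
  proof (rule borel_measurable_LIMSEQ_real)
    fix s assume s: "s \<in> space M"
    have "((\<lambda>r. g s (x + r *\<^sub>R axis i 1)) has_real_derivative ?D i x s) (at 0)"
      using has_real_derivative_partial_deriv[of "g s" x 0 i] diff[OF s] by simp
    then have "((\<lambda>r. (g s (x + r *\<^sub>R axis i 1) - g s x) / r) \<longlongrightarrow> ?D i x s) (at 0)"
      by (simp add: has_field_derivative_iff)
    moreover have "filterlim (\<lambda>n. inverse (real (Suc n))) (at 0) sequentially"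
      unfolding filterlim_at using LIMSEQ_inverse_real_of_nat by auto
    ultimately show "(\<lambda>n. (g s (x + inverse (real (Suc n)) *\<^sub>R axis i 1) - g s x) / inverse (real (Suc n)))
        \<longlonglongrightarrow> ?D i x s"
      by (rule filterlim_compose)
  next
    have [measurable]: "(\<lambda>s. g s x) \<in> borel_measurable M" for x
      using int by auto
    show "(\<lambda>s. (g s (x + inverse (real (Suc n)) *\<^sub>R axis i 1) - g s x) / inverse (real (Suc n))) \<in> borel_measurable M" for n
      by measurable
  qed
  show I: "integrable M (?D i x)" for i x
  proof (rule Bochner_Integration.integrable_bound[OF b meas], rule AE_I2)
    show "norm (?D i x s) \<le> norm (b s)" if "s \<in> space M" for s
      using bound[OF that, of i x] by simp
  qed
  define G where "G i x = (\<integral>s. ?D i x s \<partial>M)" for i x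
  have D: "((\<lambda>x. \<integral>s. g s x \<partial>M) has_derivative (\<lambda>h. \<Sum>i\<in>UNIV. h $ i * G i x)) (at x)" for x
  proof -
    let ?q = "\<lambda>h s. (g s (x + h) - g s x - (\<Sum>i\<in>UNIV. h $ i * ?D i x s)) /\<^sub>R norm h"
    have iq: "integrable M (?q h)" for h
      using int I by auto
    have "((\<lambda>h. \<integral>s. ?q h s \<partial>M) \<longlongrightarrow> 0) (at 0)"
    \<comment> \<open>Dominated convergence concerns sequences, so the limit is taken along an
      arbitrary null sequence of increments.\<close>
    proof (subst tendsto_at_iff_sequentially, intro allI impI)
      fix h :: "nat \<Rightarrow> real^'d" assume h0: "\<forall>n. h n \<in> UNIV - {0}" and h: "h \<longlonglongrightarrow> 0"
      have "(\<lambda>n. \<integral>s. ?q (h n) s \<partial>M) \<longlonglongrightarrow> (\<integral>s. 0 \<partial>M)"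
      proof (rule integral_dominated_convergence)
        show "integrable M (\<lambda>s. 2 * real CARD('d) * b s)" using b by simp
        show "?q (h n) \<in> borel_measurable M" for n by (rule borel_measurable_integrable[OF iq])
        show "AE s in M. norm (?q (h n) s) \<le> 2 * real CARD('d) * b s" for n
        proof (rule AE_I2)
          fix s assume s: "s \<in> space M"
          have "\<bar>g s (x + h n) - g s x\<bar> \<le> real CARD('d) * b s * norm (h n)"
            using diff s bound by (intro lipschitz_of_partial_deriv_bound) auto
          moreover have "\<bar>\<Sum>i\<in>UNIV. h n $ i * ?D i x s\<bar> \<le> real CARD('d) * b s * norm (h n)"
            using bound[OF s] by (intro sum_coord_mult_le)
          ultimately have "\<bar>g s (x + h n) - g s x - (\<Sum>i\<in>UNIV. h n $ i * ?D i x s)\<bar>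
              \<le> 2 * real CARD('d) * b s * norm (h n)" by linarith
          then show "norm (?q (h n) s) \<le> 2 * real CARD('d) * b s"
            using h0 by (simp add: abs_mult divide_simps)
        qed
        show "AE s in M. (\<lambda>n. ?q (h n) s) \<longlonglongrightarrow> 0"
        proof (rule AE_I2)
          fix s assume s: "s \<in> space M"
          have "((\<lambda>h. ?q h s) \<longlongrightarrow> 0) (at 0)"
          proof (rule tendsto_norm_zero_cancel)
            have "(\<lambda>h. norm (g s (x + h) - g s x - (\<Sum>i\<in>UNIV. h $ i * ?D i x s)) / norm h) \<midarrow>0\<rightarrow> 0"
              using has_derivative_partial_deriv[OF diff[OF s, of x]] unfolding has_derivative_at by blast
            then show "((\<lambda>h. norm (?q h s)) \<longlongrightarrow> 0) (at 0)"
              by (simp only: norm_divideR_norm)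
          qed
          then show "(\<lambda>n. ?q (h n) s) \<longlonglongrightarrow> 0"
            using h0 h by (auto simp: tendsto_at_iff_sequentially o_def)
        qed
      qed simp
      then show "((\<lambda>h. \<integral>s. ?q h s \<partial>M) \<circ> h) \<longlonglongrightarrow> 0" by (simp add: o_def)
    qed
    moreover have "(\<integral>s. ?q h s \<partial>M) =
        ((\<integral>s. g s (x + h) \<partial>M) - (\<integral>s. g s x \<partial>M) - (\<Sum>i\<in>UNIV. h $ i * G i x)) /\<^sub>R norm h" for h
      using int I by (simp add: G_def)
    ultimately have "((\<lambda>h. ((\<integral>s. g s (x + h) \<partial>M) - (\<integral>s. g s x \<partial>M) - (\<Sum>i\<in>UNIV. h $ i * G i x)) /\<^sub>R norm h) \<longlongrightarrow> 0) (at 0)"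
      by (simp only:)
    from tendsto_norm_zero[OF this]
    have "((\<lambda>h. norm ((\<integral>s. g s (x + h) \<partial>M) - (\<integral>s. g s x \<partial>M) - (\<Sum>i\<in>UNIV. h $ i * G i x)) / norm h) \<longlongrightarrow> 0) (at 0)"
      by (simp only: norm_divideR_norm)
    moreover have "bounded_linear (\<lambda>h. \<Sum>i\<in>UNIV. h $ i * G i x)"
      by (intro bounded_linear_sum bounded_linear_mult_left[THEN bounded_linear_compose] bounded_linear_vec_nth)
    ultimately show ?thesis
      unfolding has_derivative_at by blast
  qed
  show P: "partial_deriv i (\<lambda>x. \<integral>s. g s x \<partial>M) x = (\<integral>s. ?D i x s \<partial>M)" for i x
    using partial_deriv_eqI[OF D] by (simp add: G_def)
  have "isCont (G i) x" for i x
    unfolding continuous_at_sequentially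
  proof (intro allI impI)
    fix u assume u: "u \<longlonglongrightarrow> x"
    have "(\<lambda>n. \<integral>s. ?D i (u n) s \<partial>M) \<longlonglongrightarrow> (\<integral>s. ?D i x s \<partial>M)"
    proof (rule integral_dominated_convergence[OF meas meas b])
      show "AE s in M. norm (?D i (u n) s) \<le> b s" for n
        using bound by (auto intro!: AE_I2)
      show "AE s in M. (\<lambda>n. ?D i (u n) s) \<longlonglongrightarrow> ?D i x s"
      proof (rule AE_I2)
        fix s assume "s \<in> space M"
        then have "isCont (partial_deriv i (g s)) x"
          using g by (auto simp: cont_diff_1_iff continuous_on_eq_continuous_at)
        then show "(\<lambda>n. ?D i (u n) s) \<longlonglongrightarrow> ?D i x s"
          using u isCont_tendsto_compose by blast
      qed
    qed
    then show "(G i \<circ> u) \<longlonglongrightarrow> G i x" by (simp add: G_def o_def)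
  qed
  then show "cont_diff (Suc 0) (\<lambda>x. \<integral>s. g s x \<partial>M)"
    using differentiable_sum_partialI[OF D] P unfolding cont_diff_1_iff
    by (auto simp: continuous_on_eq_continuous_at G_def[abs_def])
qed

text \<open>Induction over the word: one majorant \<open>b\<close> bounds all derivatives up to
  order \<open>Suc n\<close>, so each further letter is the first-order result applied to the
  previous derivative.\<close>

lemma integral_parameter_cont_diff:
  fixes g :: "'a \<Rightarrow> real^'d \<Rightarrow> real"
  assumes g: "\<And>s. s \<in> space M \<Longrightarrow> cont_diff (Suc n) (g s)"
    and int: "\<And>x. integrable M (\<lambda>s. g s x)"
    and b: "integrable M b"
    and bound: "\<And>s \<kappa> x. s \<in> space M \<Longrightarrow> length \<kappa> \<le> Suc n \<Longrightarrow> \<bar>iter_deriv \<kappa> (g s) x\<bar> \<le> b s"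
  shows "cont_diff (Suc n) (\<lambda>x. \<integral>s. g s x \<partial>M)"
    and "length \<kappa> \<le> Suc n \<Longrightarrow> integrable M (\<lambda>s. iter_deriv \<kappa> (g s) x)"
    and "length \<kappa> \<le> Suc n \<Longrightarrow>
      iter_deriv \<kappa> (\<lambda>x. \<integral>s. g s x \<partial>M) x = (\<integral>s. iter_deriv \<kappa> (g s) x \<partial>M)"
proof -
  have *: "(\<forall>x. integrable M (\<lambda>s. iter_deriv \<kappa> (g s) x)) \<and>
      iter_deriv \<kappa> (\<lambda>x. \<integral>s. g s x \<partial>M) = (\<lambda>x. \<integral>s. iter_deriv \<kappa> (g s) x \<partial>M)"
    if "length \<kappa> \<le> Suc n" for \<kappa>
    using that
  proof (induction \<kappa>)
    case (Cons i \<kappa>)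
    have IH: "integrable M (\<lambda>s. iter_deriv \<kappa> (g s) x)"
      "iter_deriv \<kappa> (\<lambda>x. \<integral>s. g s x \<partial>M) = (\<lambda>x. \<integral>s. iter_deriv \<kappa> (g s) x \<partial>M)" for x
      using Cons by auto
    have c: "cont_diff (Suc 0) (iter_deriv \<kappa> (g s))" if "s \<in> space M" for s
      using cont_diff_1_iter_deriv[OF g[OF that]] Cons.prems by simp
    have d: "\<bar>partial_deriv i (iter_deriv \<kappa> (g s)) x\<bar> \<le> b s" if "s \<in> space M" for s i x
      using bound[OF that, of "i # \<kappa>" x] Cons.prems by simp
    show ?case
      using integral_parameter_cont_diff_1[OF c IH(1) b d] by (simp add: IH(2) fun_eq_iff)
  qed (simp add: int)
  show "length \<kappa> \<le> Suc n \<Longrightarrow> integrable M (\<lambda>s. iter_deriv \<kappa> (g s) x)"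
    and "length \<kappa> \<le> Suc n \<Longrightarrow>
      iter_deriv \<kappa> (\<lambda>x. \<integral>s. g s x \<partial>M) x = (\<integral>s. iter_deriv \<kappa> (g s) x \<partial>M)"
    using * by auto
  have "cont_diff (Suc 0) (iter_deriv \<kappa> (\<lambda>x. \<integral>s. g s x \<partial>M))" if "length \<kappa> \<le> n" for \<kappa>
  proof -
    have "cont_diff (Suc 0) (\<lambda>x. \<integral>s. iter_deriv \<kappa> (g s) x \<partial>M)"
    proof (rule integral_parameter_cont_diff_1(2)[OF _ _ b])
      show "cont_diff (Suc 0) (iter_deriv \<kappa> (g s))" if "s \<in> space M" for s
        using cont_diff_1_iter_deriv[OF g[OF that]] \<open>length \<kappa> \<le> n\<close> by simp
      show "integrable M (\<lambda>s. iter_deriv \<kappa> (g s) x)" for x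
        using * that by auto
      show "\<bar>partial_deriv i (iter_deriv \<kappa> (g s)) x\<bar> \<le> b s" if "s \<in> space M" for s i x
        using bound[OF that, of "i # \<kappa>" x] \<open>length \<kappa> \<le> n\<close> by simp
    qed
    then show ?thesis using * that by simp
  qed
  moreover from this[of "[]"] have "continuous_on UNIV (\<lambda>x. \<integral>s. g s x \<partial>M)"
    by (auto intro: cont_diff_continuous)
  ultimately show "cont_diff (Suc n) (\<lambda>x. \<integral>s. g s x \<partial>M)"
    unfolding cont_diff_Suc_iff[of n] by blast
qed

section \<open>Gaussian smoothing and Fourier transforms of densities\<close>

lemma lborel_integral_affine:
  fixes f :: "'a::euclidean_space \<Rightarrow> 'b::{banach, second_countable_topology}"
  assumes "f \<in> borel_measurable borel" "c \<noteq> 0"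
  shows "(\<integral>x. f x \<partial>lborel) = \<bar>c\<bar> ^ DIM('a) *\<^sub>R (\<integral>x. f (t + c *\<^sub>R x) \<partial>lborel)"
proof -
  have "(\<integral>x. f x \<partial>lborel) = (\<integral>x. f x \<partial>density (distr lborel borel (\<lambda>x. t + c *\<^sub>R x)) (\<lambda>_. ennreal (\<bar>c\<bar> ^ DIM('a))))"
    using lborel_affine[OF assms(2), of t] by simp
  also have "\<dots> = \<bar>c\<bar> ^ DIM('a) *\<^sub>R (\<integral>x. f (t + c *\<^sub>R x) \<partial>lborel)"
    using assms(1) by (subst integral_density) (auto simp: integral_distr)
  finally show ?thesis .
qed

lemma lborel_nn_integral_affine:
  fixes f :: "'a::euclidean_space \<Rightarrow> ennreal"
  assumes "f \<in> borel_measurable borel" "c \<noteq> 0"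
  shows "(\<integral>\<^sup>+x. f x \<partial>lborel) = ennreal (\<bar>c\<bar> ^ DIM('a)) * (\<integral>\<^sup>+x. f (t + c *\<^sub>R x) \<partial>lborel)"
proof -
  have "(\<integral>\<^sup>+x. f x \<partial>lborel) = (\<integral>\<^sup>+x. f x \<partial>density (distr lborel borel (\<lambda>x. t + c *\<^sub>R x)) (\<lambda>_. ennreal (\<bar>c\<bar> ^ DIM('a))))"
    using lborel_affine[OF assms(2), of t] by simp
  also have "\<dots> = ennreal (\<bar>c\<bar> ^ DIM('a)) * (\<integral>\<^sup>+x. f (t + c *\<^sub>R x) \<partial>lborel)"
    using assms(1) by (subst nn_integral_density) (auto simp: nn_integral_distr nn_integral_cmult)
  finally show ?thesis .
qed

lemma lborel_integrable_affine:
  fixes f :: "'a::euclidean_space \<Rightarrow> 'b::{banach, second_countable_topology}"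
  assumes "integrable lborel f" "c \<noteq> 0"
  shows "integrable lborel (\<lambda>x. f (t + c *\<^sub>R x))"
proof -
  have [measurable]: "f \<in> borel_measurable borel" using assms(1) by auto
  have "(\<integral>\<^sup>+x. ennreal (norm (f x)) \<partial>lborel) < \<infinity>"
    using assms(1) by (simp add: integrable_iff_bounded)
  moreover have "(\<integral>\<^sup>+x. ennreal (norm (f x)) \<partial>lborel) =
      ennreal (\<bar>c\<bar> ^ DIM('a)) * (\<integral>\<^sup>+x. ennreal (norm (f (t + c *\<^sub>R x))) \<partial>lborel)"
    using assms(2) by (intro lborel_nn_integral_affine) auto
  moreover have "ennreal (\<bar>c\<bar> ^ DIM('a)) \<noteq> 0"
    using assms(2) by (simp add: ennreal_eq_0_iff not_le)
  ultimately have "(\<integral>\<^sup>+x. ennreal (norm (f (t + c *\<^sub>R x))) \<partial>lborel) < \<infinity>"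
    by (auto simp: ennreal_mult_less_top)
  then show ?thesis
    by (auto simp: integrable_iff_bounded)
qed

text \<open>The function is a product of one-dimensional ones in the coordinates, so Tonelli reduces
  the claim to the normal density on the line.\<close>

lemma integrable_exp_norm_square:
  fixes \<sigma> :: real
  assumes "\<sigma> > 0"
  shows "integrable lborel (\<lambda>y::real^'d. exp (- (norm y)\<^sup>2 / (2 * \<sigma>\<^sup>2)))"
proof (rule integrableI_bounded)
  let ?f = "\<lambda>x::real. exp (- x\<^sup>2 / (2 * \<sigma>\<^sup>2))"
  have "integrable lborel (\<lambda>x. sqrt (2 * pi * \<sigma>\<^sup>2) * normal_density 0 \<sigma> x)"
    using integrable_normal_density[OF assms, of 0] by simp
  also have "(\<lambda>x. sqrt (2 * pi * \<sigma>\<^sup>2) * normal_density 0 \<sigma> x) = ?f"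
    using assms by (simp add: normal_density_def fun_eq_iff)
  finally have fin: "(\<integral>\<^sup>+x. ennreal (?f x) \<partial>lborel) < \<infinity>"
    by (simp add: integrable_iff_bounded)
  have sq: "(norm y)\<^sup>2 = (\<Sum>b\<in>Basis. (y \<bullet> b)\<^sup>2)" for y :: "real^'d"
    using euclidean_inner[of y y] by (simp add: power2_norm_eq_inner flip: power2_eq_square)
  have "?f (norm y) = (\<Prod>b\<in>Basis. ?f (y \<bullet> b))" for y :: "real^'d"
    unfolding sq by (subst exp_sum[symmetric]) (auto simp: sum_negf sum_divide_distrib)
  then have "ennreal (norm (?f (norm y))) = (\<Prod>b\<in>Basis. ennreal (?f (y \<bullet> b)))" for y :: "real^'d"
    by (subst prod_ennreal) (auto simp: prod_nonneg)
  then have "(\<integral>\<^sup>+y. ennreal (norm (?f (norm y))) \<partial>(lborel :: (real^'d) measure)) = (\<integral>\<^sup>+y. (\<Prod>b\<in>Basis. ennreal (?f (y \<bullet> b))) \<partial>(lborel :: (real^'d) measure))"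
    by (simp only:)
  also have "\<dots> = (\<Prod>b\<in>(Basis :: (real^'d) set). \<integral>\<^sup>+x. ennreal (?f x) \<partial>lborel)"
    by (rule nn_integral_lborel_prod) auto
  also have "\<dots> < \<infinity>"
    using fin by (simp add: power_less_top_ennreal)
  finally show "(\<integral>\<^sup>+y. ennreal (norm (?f (norm y))) \<partial>(lborel :: (real^'d) measure)) < \<infinity>" .
qed simp

section \<open>The Gaussian and its Fourier representation\<close>

definition gauss :: "real^'d \<Rightarrow> real" where
  "gauss y = exp (- (norm y)\<^sup>2 / 2)"

lemma gauss_measurable[measurable]: "gauss \<in> borel_measurable borel"
  unfolding gauss_def[abs_def] by measurable

lemma gauss_pos: "gauss y > 0" and gauss_le_1: "gauss y \<le> 1"
  by (auto simp: gauss_def)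

lemma abs_gauss[simp]: "\<bar>gauss y\<bar> = gauss y"
  using gauss_pos[of y] by simp

lemma integrable_gauss: "integrable lborel (gauss :: real^'d \<Rightarrow> real)"
  using integrable_exp_norm_square[of 1] by (simp add: gauss_def[abs_def])

lemma integrable_norm_gauss: "integrable lborel (\<lambda>y::real^'d. norm y * gauss y)"
proof (rule Bochner_Integration.integrable_bound)
  show "integrable lborel (\<lambda>y::real^'d. exp (- (norm y)\<^sup>2 / (2 * (sqrt 2)\<^sup>2)))"
    by (rule integrable_exp_norm_square) simp
  have "norm y * gauss y \<le> exp (- (norm y)\<^sup>2 / 4)" for y :: "real^'d"
  proof -
    \<comment> \<open>Half of the exponent is spent on the factor \<open>norm y\<close>, via
      \<open>s \<le> 1 + s^2 / 4 \<le> exp (s^2 / 4)\<close>; the other half stays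
      integrable.\<close>
    have "0 \<le> (norm y / 2 - 1)\<^sup>2" by simp
    then have "norm y \<le> 1 + (norm y)\<^sup>2 / 4"
      by (simp add: power2_eq_square algebra_simps)
    also have "\<dots> \<le> exp ((norm y)\<^sup>2 / 4)" by (rule exp_ge_add_one_self)
    finally have "norm y * gauss y \<le> exp ((norm y)\<^sup>2 / 4) * gauss y"
      using gauss_pos[of y] by (intro mult_right_mono) auto
    also have "\<dots> = exp (- (norm y)\<^sup>2 / 4)"
      by (simp add: gauss_def flip: exp_add)
    finally show ?thesis .
  qed
  then show "AE y::real^'d in lborel. norm (norm y * gauss y) \<le> norm (exp (- (norm y)\<^sup>2 / (2 * (sqrt 2)\<^sup>2)))"
    by (auto simp: abs_mult)
qed simp

text \<open>\<open>gauss\<close> carries no normalising constant. Smoothing with it reproduces a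
  function up to this integral, so its positivity is what permits the division.\<close>

lemma integral_gauss_pos: "(\<integral>y. gauss y \<partial>(lborel :: (real^'d) measure)) > 0"
proof -
  have "(\<integral>y. gauss y \<partial>(lborel :: (real^'d) measure)) \<noteq> 0"
  proof
    assume "(\<integral>y. gauss y \<partial>(lborel :: (real^'d) measure)) = 0"
    then have "AE y in (lborel :: (real^'d) measure). gauss y = 0"
      by (subst (asm) integral_nonneg_eq_0_iff_AE[OF integrable_gauss]) (auto simp: less_imp_le[OF gauss_pos])
    then have "AE y in (lborel :: (real^'d) measure). False"
      by eventually_elim (metis gauss_pos less_irrefl)
    then have "emeasure (lborel :: (real^'d) measure) UNIV = 0"
      by (simp add: AE_iff_measurable[of UNIV])
    then show False by simp
  qed
  then show ?thesis
    using Bochner_Integration.integral_nonneg[of "lborel :: (real^'d) measure" gauss, OF less_imp_le[OF gauss_pos]]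
    by linarith
qed

text \<open>Built as a product of one-dimensional normal laws, so that its characteristic function
  factors. It is a probability measure whose transform is exactly \<open>gauss\<close>, which turns
  Gaussian weights into averages of exponentials.\<close>

definition std_gaussian :: "(real^'d) measure" where
  "std_gaussian = distr (\<Pi>\<^sub>M i\<in>UNIV. std_normal_distribution) borel (\<lambda>\<omega>. \<chi> i. \<omega> i)"

lemma vec_lambda_measurable_PiM[measurable]:
  "(\<lambda>\<omega>. (\<chi> i. \<omega> i) :: real^'d) \<in> borel_measurable (\<Pi>\<^sub>M i\<in>UNIV. std_normal_distribution)"
  by (subst borel_measurable_euclidean_space) (auto simp: Basis_vec_def inner_axis)

interpretation std_normal: prob_space std_normal_distribution
  using real_dist_normal_dist by (simp add: real_distribution_def)

interpretation std_normal_prod: product_prob_space "\<lambda>i::'d::finite. std_normal_distribution" UNIV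
  by (intro product_prob_spaceI std_normal.prob_space_axioms)

lemma sets_std_gaussian[simp, measurable_cong]: "sets std_gaussian = sets borel"
  by (simp add: std_gaussian_def)

lemma prob_space_std_gaussian: "prob_space (std_gaussian :: (real^'d) measure)"
  unfolding std_gaussian_def by (intro std_normal_prod.prob_space_distr vec_lambda_measurable_PiM)

lemma std_gaussian_fourier:
  "(\<integral>\<omega>. exp (\<i> * of_real (\<omega> \<bullet> y)) \<partial>std_gaussian) = of_real (gauss y)"
proof -
  let ?N = "\<lambda>i::'d. std_normal_distribution"
  have "(\<integral>\<omega>. exp (\<i> * of_real (\<omega> \<bullet> y)) \<partial>std_gaussian) =
      (\<integral>\<omega>. exp (\<i> * of_real ((\<chi> i. \<omega> i) \<bullet> y)) \<partial>PiM UNIV ?N)"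
    unfolding std_gaussian_def by (rule integral_distr) measurable
  also have "\<dots> = (\<integral>\<omega>. (\<Prod>i\<in>UNIV. exp (\<i> * of_real (y $ i * \<omega> i))) \<partial>PiM UNIV ?N)"
    by (simp add: inner_vec_def exp_sum[symmetric] sum_distrib_left mult_ac)
  also have "\<dots> = (\<Prod>i\<in>UNIV. \<integral>x. exp (\<i> * of_real (y $ i * x)) \<partial>std_normal_distribution)"
    by (rule std_normal_prod.product_integral_prod)
      (auto intro!: std_normal.integrable_const_bound[where B=1] simp: norm_exp_i_times)
  also have "\<dots> = (\<Prod>i\<in>UNIV. of_real (exp (- ((y $ i)\<^sup>2) / 2)))"
    using char_std_normal_distribution by (auto simp: char_def fun_eq_iff)
  also have "\<dots> = of_real (gauss y)"
    by (simp add: gauss_def exp_sum[symmetric] sum_negf sum_divide_distrib norm_vec_def L2_set_def real_sqrt_pow2 sum_nonneg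
        flip: of_real_prod)
  finally show ?thesis .
qed

text \<open>Writing the weight as the characteristic function of \<open>std_gaussian\<close> and
  exchanging integrals turns a Gaussian average of \<open>F\<close> about \<open>z\<close> into an
  average of the Fourier transform of \<open>F\<close> over a probability measure. The transform is
  thus exploited without being inverted, and its integrability is never at issue.\<close>

lemma integral_gauss_fourier:
  fixes F :: "real^'d \<Rightarrow> real"
  assumes F: "integrable lborel F"
  shows "of_real (\<integral>x. F x * gauss (r *\<^sub>R (x - z)) \<partial>lborel) =
    (\<integral>\<omega>. exp (- (\<i> * of_real (r * (\<omega> \<bullet> z)))) *
      (\<integral>x. exp (- (\<i> * of_real ((- r *\<^sub>R \<omega>) \<bullet> x))) * of_real (F x) \<partial>lborel) \<partial>std_gaussian)"
proof -
  interpret N: prob_space "std_gaussian :: (real^'d) measure" by (rule prob_space_std_gaussian)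
  interpret pair_sigma_finite "lborel :: (real^'d) measure" "std_gaussian :: (real^'d) measure" ..
  let ?f = "\<lambda>x \<omega>. of_real (F x) * exp (\<i> * of_real (\<omega> \<bullet> (r *\<^sub>R (x - z)))) :: complex"
  have [measurable]: "F \<in> borel_measurable borel" using F by auto
  have n: "norm (?f x \<omega>) = \<bar>F x\<bar>" for x \<omega>
    by (simp add: norm_mult norm_exp_i_times)
  have int: "integrable (lborel \<Otimes>\<^sub>M std_gaussian) (\<lambda>(x, \<omega>). ?f x \<omega>)"
  proof (rule Fubini_integrable)
    show "integrable lborel (\<lambda>x. \<integral>\<omega>. norm (case (x, \<omega>) of (x, \<omega>) \<Rightarrow> ?f x \<omega>) \<partial>std_gaussian)"
      using F by (simp only: n prod.case) (simp add: N.prob_space[simplified])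
    show "AE x in lborel. integrable std_gaussian (\<lambda>\<omega>. case (x, \<omega>) of (x, \<omega>) \<Rightarrow> ?f x \<omega>)"
    proof (rule AE_I2)
      show "integrable std_gaussian (\<lambda>\<omega>. case (x, \<omega>) of (x, \<omega>) \<Rightarrow> ?f x \<omega>)" for x
        unfolding prod.case
        by (rule N.integrable_const_bound[where B="\<bar>F x\<bar>"]) (simp only: n, simp, measurable)
    qed
  qed measurable
  have "of_real (\<integral>x. F x * gauss (r *\<^sub>R (x - z)) \<partial>lborel) =
      (\<integral>x. of_real (F x) * (\<integral>\<omega>. exp (\<i> * of_real (\<omega> \<bullet> (r *\<^sub>R (x - z)))) \<partial>std_gaussian) \<partial>lborel)"
    by (simp only: std_gaussian_fourier flip: integral_complex_of_real of_real_mult)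
  also have "\<dots> = (\<integral>x. \<integral>\<omega>. ?f x \<omega> \<partial>std_gaussian \<partial>lborel)"
    by simp
  also have "\<dots> = (\<integral>\<omega>. \<integral>x. ?f x \<omega> \<partial>lborel \<partial>std_gaussian)"
    by (rule Fubini_integral[OF int, symmetric])
  also have "\<dots> = (\<integral>\<omega>. \<integral>x. exp (- (\<i> * of_real (r * (\<omega> \<bullet> z)))) *
       (exp (- (\<i> * of_real ((- r *\<^sub>R \<omega>) \<bullet> x))) * of_real (F x)) \<partial>lborel \<partial>std_gaussian)"
    by (intro Bochner_Integration.integral_cong refl) (simp add: inner_diff_right algebra_simps flip: exp_add)
  finally show ?thesis by simp
qed

text \<open>After rescaling about \<open>z\<close> the weight is \<open>gauss\<close> itself and
  \<open>F\<close> is evaluated at distance \<open>norm y / r\<close> from \<open>z\<close>; the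
  Lipschitz bound leaves the first moment of \<open>gauss\<close>.\<close>

lemma integral_gauss_approx:
  fixes F :: "real^'d \<Rightarrow> real"
  assumes F: "integrable lborel F" and lip: "\<And>x h. \<bar>F (x + h) - F x\<bar> \<le> L * norm h" and r: "r > 0"
  shows "\<bar>r ^ CARD('d) * (\<integral>x. F x * gauss (r *\<^sub>R (x - z)) \<partial>lborel) - F z * (\<integral>y. gauss y \<partial>(lborel :: (real^'d) measure))\<bar>
     \<le> L / r * (\<integral>y. norm y * gauss y \<partial>(lborel :: (real^'d) measure))"
proof -
  have [measurable]: "F \<in> borel_measurable borel" using F by auto
  have "(\<integral>x. F x * gauss (r *\<^sub>R (x - z)) \<partial>lborel) =
     (1 / r) ^ CARD('d) * (\<integral>y. F (z + (1/r) *\<^sub>R y) * gauss y \<partial>lborel)"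
    using lborel_integral_affine[of "\<lambda>x. F x * gauss (r *\<^sub>R (x - z))" "1/r" z] r by simp
  then have 1: "r ^ CARD('d) * (\<integral>x. F x * gauss (r *\<^sub>R (x - z)) \<partial>lborel) = (\<integral>y. F (z + (1/r) *\<^sub>R y) * gauss y \<partial>lborel)"
    using r by (simp add: field_simps)
  have i: "integrable lborel (\<lambda>y. F (z + (1/r) *\<^sub>R y) * gauss y)"
  proof (rule Bochner_Integration.integrable_bound)
    show "integrable lborel (\<lambda>y. F (z + (1/r) *\<^sub>R y))"
      using r F by (intro lborel_integrable_affine) auto
    show "AE y in lborel. norm (F (z + (1/r) *\<^sub>R y) * gauss y) \<le> norm (F (z + (1/r) *\<^sub>R y))"
      by (intro AE_I2, simp only: real_norm_def abs_mult abs_gauss, rule mult_left_le) (auto simp: gauss_le_1)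
  qed measurable
  have "(\<integral>y. F (z + (1/r) *\<^sub>R y) * gauss y \<partial>lborel) - F z * (\<integral>y. gauss y \<partial>(lborel :: (real^'d) measure))
     = (\<integral>y. (F (z + (1/r) *\<^sub>R y) - F z) * gauss y \<partial>lborel)"
    unfolding left_diff_distrib using i integrable_gauss by (subst Bochner_Integration.integral_diff) auto
  also have "\<bar>\<dots>\<bar> \<le> (\<integral>y. L / r * (norm y * gauss y) \<partial>(lborel :: (real^'d) measure))"
  proof (rule integral_abs_bound[THEN order_trans], rule integral_mono)
    show "integrable lborel (\<lambda>y. \<bar>(F (z + (1/r) *\<^sub>R y) - F z) * gauss y\<bar>)"
      using i integrable_gauss by (auto simp: left_diff_distrib intro!: integrable_abs)
    show "integrable lborel (\<lambda>y::real^'d. L / r * (norm y * gauss y))"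
      by (intro integrable_mult_right integrable_norm_gauss)
    show "\<bar>(F (z + (1/r) *\<^sub>R y) - F z) * gauss y\<bar> \<le> L / r * (norm y * gauss y)" for y
      using mult_right_mono[OF lip[of z "(1/r) *\<^sub>R y"], of "gauss y"] r gauss_pos[of y]
      by (simp add: abs_mult less_imp_le)
  qed
  finally show ?thesis by (simp add: 1)
qed

text \<open>For a fixed width the Gaussian averages tend to 0 by dominated convergence of the
  transforms, which are bounded by \<open>B\<close>. The error of averaging is of order
  \<open>1 / r\<close> uniformly in \<open>n\<close>, because \<open>L\<close> is common to the
  sequence; so \<open>r\<close> is fixed before \<open>n\<close>. Constant sequences give uniqueness
  of Fourier transforms.\<close>

lemma fourier_tendsto_imp_tendsto:
  fixes F :: "nat \<Rightarrow> real^'d \<Rightarrow> real"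
  assumes F: "\<And>n. integrable lborel (F n)" and lip: "\<And>n x h. \<bar>F n (x + h) - F n x\<bar> \<le> L * norm h"
    and B: "\<And>n. (\<integral>x. \<bar>F n x\<bar> \<partial>lborel) \<le> B"
    and lim: "\<And>\<xi>. (\<lambda>n. \<integral>x. exp (- (\<i> * of_real (\<xi> \<bullet> x))) * of_real (F n x) \<partial>lborel) \<longlonglongrightarrow> 0"
  shows "(\<lambda>n. F n z) \<longlonglongrightarrow> 0"
proof -
  interpret N: prob_space "std_gaussian :: (real^'d) measure" by (rule prob_space_std_gaussian)
  have [measurable]: "F n \<in> borel_measurable borel" for n using F[of n] by auto
  define c where "c = (\<integral>y. gauss y \<partial>(lborel :: (real^'d) measure))"
  define c1 where "c1 = (\<integral>y. norm y * gauss y \<partial>(lborel :: (real^'d) measure))"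
  have c: "c > 0" by (simp add: c_def integral_gauss_pos)
  have c1: "c1 \<ge> 0" unfolding c1_def
    by (intro Bochner_Integration.integral_nonneg mult_nonneg_nonneg norm_ge_zero less_imp_le[OF gauss_pos])
  let ?I = "\<lambda>r n. \<integral>x. F n x * gauss (r *\<^sub>R (x - z)) \<partial>lborel"
  have I0: "?I r \<longlonglongrightarrow> 0" for r
  proof -
    let ?f = "\<lambda>n \<omega>. exp (- (\<i> * of_real (r * (\<omega> \<bullet> z)))) *
      (\<integral>x. exp (- (\<i> * of_real ((- r *\<^sub>R \<omega>) \<bullet> x))) * of_real (F n x) \<partial>lborel)"
    have "(\<lambda>n. \<integral>\<omega>. ?f n \<omega> \<partial>std_gaussian) \<longlonglongrightarrow> (\<integral>\<omega>. 0 \<partial>(std_gaussian :: (real^'d) measure))"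
    proof (rule integral_dominated_convergence[where w="\<lambda>_. B" and f="\<lambda>_. 0" and s="?f"])
      show "AE \<omega> in std_gaussian. (\<lambda>n. ?f n \<omega>) \<longlonglongrightarrow> 0"
        by (intro AE_I2 tendsto_mult_right_zero lim)
      have "norm (?f n \<omega>) \<le> B" for n \<omega>
      proof -
        have e: "norm (exp (- (\<i> * of_real a))) = 1" for a
          by simp
        have "norm (?f n \<omega>) \<le> (\<integral>x. norm (exp (- (\<i> * of_real ((- r *\<^sub>R \<omega>) \<bullet> x))) * of_real (F n x)) \<partial>lborel)"
          unfolding norm_mult[of "exp _" "integral\<^sup>L _ _"] e mult_1_left by (rule integral_norm_bound)
        also have "\<dots> = (\<integral>x. \<bar>F n x\<bar> \<partial>lborel)"
          by (simp only: norm_mult e) simp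
        finally show ?thesis using B[of n] by linarith
      qed
      then show "AE \<omega> in std_gaussian. norm (?f n \<omega>) \<le> B" for n by simp
      show "?f n \<in> borel_measurable std_gaussian" for n
        by measurable
    qed auto
    then have "(\<lambda>n. complex_of_real (?I r n)) \<longlonglongrightarrow> 0"
      by (simp only: integral_gauss_fourier[OF F] Bochner_Integration.integral_zero)
    from tendsto_Re[OF this] show ?thesis
      by (simp only: Re_complex_of_real zero_complex.sel)
  qed
  show ?thesis
  proof (rule LIMSEQ_I)
    fix e :: real assume e: "e > 0"
    \<comment> \<open>Chosen to bring the averaging error \<open>L / r * c1\<close> below
      \<open>c * e / 2\<close>. The absolute value and the summand 1 keep \<open>r\<close> positive,
      of \<open>c1\<close> only nonnegativity being known and nothing about the sign of
      \<open>L\<close>.\<close>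
    define r where "r = 2 * (\<bar>L\<bar> * c1 + 1) / (c * e)"
    have r: "r > 0" using c e c1 by (simp add: r_def add_nonneg_pos)
    have rL: "L / r * c1 < c * e / 2"
    proof -
      have "L * c1 \<le> \<bar>L\<bar> * c1" using c1 by (intro mult_right_mono) auto
      then have "L * c1 < \<bar>L\<bar> * c1 + 1" by linarith
      also have "\<dots> = c * e / 2 * r" using c e by (simp add: r_def)
      finally show ?thesis using r by (simp add: divide_less_eq)
    qed
    have "(\<lambda>n. r ^ CARD('d) * ?I r n) \<longlonglongrightarrow> 0"
      using I0 by (rule tendsto_mult_right_zero)
    then obtain n0 where n0: "\<And>n. n \<ge> n0 \<Longrightarrow> \<bar>r ^ CARD('d) * ?I r n\<bar> < c * e / 2"
      using LIMSEQ_D[of _ 0 "c * e / 2"] c e by fastforce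
    show "\<exists>n0. \<forall>n\<ge>n0. norm (F n z - 0) < e"
    proof (intro exI allI impI)
      fix n assume "n \<ge> n0"
      have "\<bar>r ^ CARD('d) * ?I r n - F n z * c\<bar> \<le> L / r * c1"
        unfolding c_def c1_def by (rule integral_gauss_approx[OF F lip r])
      then have "\<bar>F n z * c\<bar> < c * e"
        using n0[OF \<open>n \<ge> n0\<close>] rL by linarith
      then show "norm (F n z - 0) < e"
        using c by (simp add: abs_mult)
    qed
  qed
qed

section \<open>Heat kernels: semigroup property and continuity in time\<close>

lemma lborel_integral_reflect:
  fixes f :: "'a::euclidean_space \<Rightarrow> 'b::{banach, second_countable_topology}"
  assumes "f \<in> borel_measurable borel"
  shows "(\<integral>y. f (x - y) \<partial>lborel) = (\<integral>y. f y \<partial>lborel)"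
  using lborel_integral_affine[OF assms, of "-1" x] by simp

lemma lborel_integral_translate:
  fixes f :: "'a::euclidean_space \<Rightarrow> 'b::{banach, second_countable_topology}"
  assumes "f \<in> borel_measurable borel"
  shows "(\<integral>y. f (y - x) \<partial>lborel) = (\<integral>y. f y \<partial>lborel)"
  using lborel_integral_affine[OF assms, of 1 "-x"] by simp

text \<open>Tonelli with the inner integral over \<open>x\<close>, which by translation invariance
  is the \<open>L^1\<close> norm of \<open>f\<close> times the absolute value of
  \<open>g y\<close>.\<close>

lemma integrable_convolution_pair:
  fixes f g :: "'a::euclidean_space \<Rightarrow> real"
  assumes f: "integrable lborel f" and g: "integrable lborel g"
  shows "integrable (lborel \<Otimes>\<^sub>M lborel) (\<lambda>(y, x). f (x - y) * g y)"
proof (rule lborel_pair.Fubini_integrable)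
  have [measurable]: "f \<in> borel_measurable borel" "g \<in> borel_measurable borel" using f g by auto
  show "(\<lambda>(y, x). f (x - y) * g y) \<in> borel_measurable (lborel \<Otimes>\<^sub>M lborel)" by measurable
  have tr: "integrable lborel (\<lambda>x. f (x - y))" for y
    using lborel_integrable_affine[OF f, of 1 "-y"] by simp
  have "(\<integral>x. norm (f (x - y) * g y) \<partial>lborel) = (\<integral>x. \<bar>f x\<bar> \<partial>lborel) * \<bar>g y\<bar>" for y
    using lborel_integral_translate[of "\<lambda>x. \<bar>f x\<bar>" y] by (simp add: abs_mult)
  then show "integrable lborel (\<lambda>y. \<integral>x. norm (case (y, x) of (y, x) \<Rightarrow> f (x - y) * g y) \<partial>lborel)"
    using g by simp
  show "AE y in lborel. integrable lborel (\<lambda>x. case (y, x) of (y, x) \<Rightarrow> f (x - y) * g y)"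
    using tr by simp
qed

lemma integrable_fourier:
  fixes G :: "real^'d \<Rightarrow> real"
  assumes G: "integrable lborel G"
  shows "integrable lborel (\<lambda>x. exp (- (\<i> * of_real (\<xi> \<bullet> x))) * complex_of_real (G x))"
proof (rule Bochner_Integration.integrable_bound[OF G])
  have [measurable]: "G \<in> borel_measurable borel" using G by auto
  show "(\<lambda>x. exp (- (\<i> * of_real (\<xi> \<bullet> x))) * complex_of_real (G x)) \<in> borel_measurable lborel"
    by measurable
  have e: "norm (exp (- (\<i> * of_real a))) = 1" for a by simp
  show "AE x in lborel. norm (exp (- (\<i> * of_real (\<xi> \<bullet> x))) * complex_of_real (G x)) \<le> norm (G x)"
    by (intro AE_I2) (simp only: norm_mult e, simp)
qed

text \<open>Lebesgue measurability is what is known of \<open>Q \<phi>\<close>. The bound is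
  required at every point, so that it can also be used pointwise in the argument of \<open>H\<close>
  and of the semigroup.\<close>

definition bounded_meas :: "real \<Rightarrow> (real^'d \<Rightarrow> real) \<Rightarrow> bool" where
  "bounded_meas M \<phi> \<longleftrightarrow> \<phi> \<in> borel_measurable lebesgue \<and> (\<forall>x. \<bar>\<phi> x\<bar> \<le> M)"

lemma bounded_meas_nonneg: "bounded_meas M \<phi> \<Longrightarrow> 0 \<le> M"
  unfolding bounded_meas_def using order_trans[OF abs_ge_zero[of "\<phi> 0"], of M] by simp

lemma bounded_meas_bound: "bounded_meas M \<phi> \<Longrightarrow> \<bar>\<phi> x\<bar> \<le> M"
  by (simp add: bounded_meas_def)

lemma bounded_measI_borel:
  "\<phi> \<in> borel_measurable borel \<Longrightarrow> (\<And>x. \<bar>\<phi> x\<bar> \<le> M) \<Longrightarrow> bounded_meas M \<phi>"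
  unfolding bounded_meas_def by (intro conjI allI measurable_completion) (simp_all only: measurable_lborel2)

lemma bounded_measI_continuous:
  "continuous_on UNIV \<phi> \<Longrightarrow> (\<And>x. \<bar>\<phi> x\<bar> \<le> M) \<Longrightarrow> bounded_meas M \<phi>"
  by (intro bounded_measI_borel borel_measurable_continuous_onI)

lemma bounded_meas_diff:
  "bounded_meas M \<phi> \<Longrightarrow> bounded_meas M' \<psi> \<Longrightarrow> (\<And>x. \<bar>\<phi> x - \<psi> x\<bar> \<le> K) \<Longrightarrow> bounded_meas K (\<lambda>x. \<phi> x - \<psi> x)"
  unfolding bounded_meas_def by (intro conjI borel_measurable_diff) auto

text \<open>A function measurable for the completion agrees almost everywhere with a Borel one;
  clamping the latter between \<open>- M\<close> and \<open>M\<close> makes the bound hold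
  everywhere.\<close>

lemma bounded_meas_borel_version:
  assumes "bounded_meas M \<phi>"
  obtains \<phi>' where "\<phi>' \<in> borel_measurable borel" "\<And>x. \<bar>\<phi>' x\<bar> \<le> M" "AE x in lebesgue. \<phi> x = \<phi>' x"
proof -
  obtain g where g: "g \<in> borel_measurable lborel" and ae: "AE x in lborel. \<phi> x = g x"
    using completion_ex_borel_measurable_real[of \<phi> lborel] assms by (auto simp: bounded_meas_def)
  show ?thesis
  proof
    show "(\<lambda>x. max (- M) (min M (g x))) \<in> borel_measurable borel"
      using g by (auto intro!: borel_measurable_max borel_measurable_min)
    show "\<bar>max (- M) (min M (g x))\<bar> \<le> M" for x
      using bounded_meas_nonneg[OF assms] by auto
    have "AE x in lborel. \<phi> x = max (- M) (min M (g x))"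
      using ae
    proof eventually_elim
      case (elim x)
      then show ?case using bounded_meas_bound[OF assms, of x] by auto
    qed
    then show "AE x in lebesgue. \<phi> x = max (- M) (min M (g x))"
      by (rule AE_completion)
  qed
qed

text \<open>The exponential form of \<open>p_fourier\<close> is what makes the kernels a semigroup.
  The gradient bound is stated for each partial derivative as a nonnegative integral, so that it
  contains integrability. \<open>Ts\<close> is at most 1 so that negative powers of time are at
  least 1.\<close>

locale heat_semigroup =
  fixes p :: "real \<Rightarrow> real^'d \<Rightarrow> real" and \<psi> :: "real^'d \<Rightarrow> complex" and \<alpha> c0 Ts :: real
  assumes p_meas: "t > 0 \<Longrightarrow> p t \<in> borel_measurable borel"
    and p_nonneg: "t > 0 \<Longrightarrow> 0 \<le> p t x"
    and p_prob: "t > 0 \<Longrightarrow> prob_space (density lborel (\<lambda>x. ennreal (p t x)))"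
    and p_fourier: "t > 0 \<Longrightarrow> (\<integral>x. exp (- (\<i> * of_real (\<xi> \<bullet> x))) \<partial>density lborel (\<lambda>x. ennreal (p t x))) =
        exp (- (of_real t * \<psi> \<xi>))"
    and p_smooth: "t > 0 \<Longrightarrow> cont_diff (Suc 0) (p t)"
    and p_bound: "t > 0 \<Longrightarrow> \<exists>B. \<forall>x. \<bar>p t x\<bar> \<le> B \<and> (\<forall>i. \<bar>partial_deriv i (p t) x\<bar> \<le> B)"
    and p_grad: "0 < t \<Longrightarrow> t \<le> Ts \<Longrightarrow>
        (\<integral>\<^sup>+ y. ennreal \<bar>partial_deriv i (p t) y\<bar> \<partial>lborel) \<le> ennreal (c0 * t powr (- 1 / \<alpha>))"
    and alpha: "1 < \<alpha>" "\<alpha> \<le> 2" and c0: "c0 > 0" and Ts: "0 < Ts" "Ts \<le> 1"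
begin

section \<open>Convolution of the kernels and their continuity in time\<close>

lemma p_integrable: "t > 0 \<Longrightarrow> integrable lborel (p t)"
  and p_integral: "t > 0 \<Longrightarrow> (\<integral>x. p t x \<partial>lborel) = 1"
proof -
  assume t: "t > 0"
  have "(\<integral>\<^sup>+x. ennreal (p t x) \<partial>lborel) = 1"
    using prob_space.emeasure_space_1[OF p_prob[OF t]] p_meas[OF t] by (simp add: emeasure_density)
  then show i: "integrable lborel (p t)"
    using p_meas[OF t] p_nonneg[OF t] by (intro integrableI_nonneg) auto
  have "ennreal (\<integral>x. p t x \<partial>lborel) = 1"
    using nn_integral_eq_integral[OF i] p_nonneg[OF t] \<open>(\<integral>\<^sup>+x. ennreal (p t x) \<partial>lborel) = 1\<close> by simp
  then show "(\<integral>x. p t x \<partial>lborel) = 1"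
    by (simp add: ennreal_eq_1)
qed

lemma p_fourier': "t > 0 \<Longrightarrow> (\<integral>x. exp (- (\<i> * of_real (\<xi> \<bullet> x))) * of_real (p t x) \<partial>lborel) =
    exp (- (of_real t * \<psi> \<xi>))"
  using p_meas[of t] p_nonneg[of t]
  by (subst p_fourier[symmetric], simp, subst integral_density) (auto simp: scaleR_conv_of_real mult.commute)

lemma p_lipschitz:
  assumes "t > 0"
  obtains L where "L \<ge> 0" "\<And>x h. \<bar>p t (x + h) - p t x\<bar> \<le> L * norm h"
proof -
  obtain B where B: "\<And>i x. \<bar>partial_deriv i (p t) x\<bar> \<le> B"
    using p_bound[OF assms] by blast
  have d: "p t differentiable (at x)" for x
    using p_smooth[OF assms] by (simp add: cont_diff_1_iff)
  have "B \<ge> 0" using B[of undefined 0] by linarith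
  then show ?thesis
    using lipschitz_of_partial_deriv_bound[OF d B] that[of "real CARD('d) * B"] by simp
qed

lemma p_shift_integrable: "t > 0 \<Longrightarrow> integrable lborel (\<lambda>y. p t (x - y))"
  using lborel_integrable_affine[OF p_integrable, of t "-1" x] by simp

lemma p_bounded_mult_integrable:
  assumes "t > 0" "\<phi> \<in> borel_measurable borel" "\<And>x. \<bar>\<phi> x\<bar> \<le> M"
  shows "integrable lborel (\<lambda>y. p t y * \<phi> (x - y))"
proof (rule Bochner_Integration.integrable_bound)
  show "integrable lborel (\<lambda>y. M * p t y)" using p_integrable[OF assms(1)] by simp
  show "(\<lambda>y. p t y * \<phi> (x - y)) \<in> borel_measurable lborel"
    using p_meas[OF assms(1)] assms(2) by measurable
  have "\<bar>p t y * \<phi> (x - y)\<bar> \<le> \<bar>M * p t y\<bar>" for y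
    using mult_left_mono[OF assms(3)[of "x - y"] p_nonneg[OF assms(1), of y]] p_nonneg[OF assms(1), of y]
      order_trans[OF abs_ge_zero assms(3)[of 0]]
    by (simp add: abs_mult mult.commute)
  then show "AE y in lborel. norm (p t y * \<phi> (x - y)) \<le> norm (M * p t y)"
    by simp
qed

text \<open>Averaging translates of \<open>p t\<close> against a probability density does not
  increase the Lipschitz constant.\<close>

lemma p_convolution_lipschitz:
  assumes t: "t > 0" and s: "s > 0" and L: "L \<ge> 0" "\<And>x h. \<bar>p t (x + h) - p t x\<bar> \<le> L * norm h"
  shows "\<bar>(\<integral>y. p t (x + h - y) * p s y \<partial>lborel) - (\<integral>y. p t (x - y) * p s y \<partial>lborel)\<bar> \<le> L * norm h"
proof -
  obtain B where B: "\<And>x. \<bar>p t x\<bar> \<le> B" using p_bound[OF t] by blast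
  have inti: "integrable lborel (\<lambda>y. p t (x - y) * p s y)" for x
    using p_bounded_mult_integrable[OF s p_meas[OF t] B] by (simp add: mult.commute)
  have "(\<integral>y. p t (x + h - y) * p s y \<partial>lborel) - (\<integral>y. p t (x - y) * p s y \<partial>lborel)
      = (\<integral>y. (p t (x - y + h) - p t (x - y)) * p s y \<partial>lborel)"
    unfolding left_diff_distrib using inti[of "x + h"] inti[of x]
    by (subst Bochner_Integration.integral_diff) (auto simp: algebra_simps)
  also have "\<bar>\<dots>\<bar> \<le> (\<integral>y. L * norm h * p s y \<partial>lborel)"
  proof (rule integral_abs_bound[THEN order_trans], rule integral_mono')
    show "integrable lborel (\<lambda>y. L * norm h * p s y)"
      using p_integrable[OF s] by simp
    show "\<bar>(p t (x - y + h) - p t (x - y)) * p s y\<bar> \<le> L * norm h * p s y" for y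
      using L(2)[of "x - y" h] p_nonneg[OF s, of y] by (simp add: abs_mult mult_right_mono)
  qed (simp add: L(1) p_nonneg[OF s])
  also have "\<dots> = L * norm h" using p_integral[OF s] by simp
  finally show ?thesis .
qed

text \<open>Both sides are integrable and Lipschitz and have the same transform, as exponentials
  multiply. The convergence lemma, applied to the constant sequence of their difference, gives
  equality at every point and not only almost everywhere.\<close>

lemma p_convolution:
  assumes t: "t > 0" and s: "s > 0"
  shows "(\<integral>y. p t (x - y) * p s y \<partial>lborel) = p (t + s) x"
proof -
  note [measurable] = p_meas[OF t] p_meas[OF s]
  have ts: "t + s > 0" using t s by simp
  obtain L where L: "L \<ge> 0" "\<And>x h. \<bar>p t (x + h) - p t x\<bar> \<le> L * norm h"
    using p_lipschitz[OF t] by blast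
  obtain L' where L': "L' \<ge> 0" "\<And>x h. \<bar>p (t + s) (x + h) - p (t + s) x\<bar> \<le> L' * norm h"
    using p_lipschitz[OF ts] by blast
  define C where "C x = (\<integral>y. p t (x - y) * p s y \<partial>lborel)" for x
  have pair: "integrable (lborel \<Otimes>\<^sub>M lborel) (\<lambda>(y, x). p t (x - y) * p s y)"
    by (rule integrable_convolution_pair[OF p_integrable[OF t] p_integrable[OF s]])
  have Cint: "integrable lborel C"
    unfolding C_def using lborel_pair.integrable_snd[OF pair] .
  have Clip: "\<bar>C (x + h) - C x\<bar> \<le> L * norm h" for x h
    unfolding C_def by (rule p_convolution_lipschitz[OF t s L])
  have F: "(\<integral>x. exp (- (\<i> * of_real (\<xi> \<bullet> x))) * of_real (C x) \<partial>lborel) =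
      exp (- (of_real (t + s) * \<psi> \<xi>))" for \<xi>
  proof -
    let ?e = "\<lambda>x. exp (- (\<i> * of_real (\<xi> \<bullet> x)))"
    have n: "norm (?e x) = 1" for x by simp
    have pe: "integrable (lborel \<Otimes>\<^sub>M lborel) (\<lambda>(y, x). ?e x * of_real (p t (x - y) * p s y))"
    proof (rule Bochner_Integration.integrable_bound[OF pair])
      show "AE z in lborel \<Otimes>\<^sub>M lborel. norm (case z of (y, x) \<Rightarrow> ?e x * of_real (p t (x - y) * p s y))
         \<le> norm (case z of (y, x) \<Rightarrow> p t (x - y) * p s y)"
        by (intro AE_I2) (simp only: split_beta norm_mult n norm_of_real mult_1_left real_norm_def order_refl)
    qed measurable
    have "(\<integral>x. ?e x * of_real (C x) \<partial>lborel) = (\<integral>x. \<integral>y. ?e x * of_real (p t (x - y) * p s y) \<partial>lborel \<partial>lborel)"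
      by (simp only: C_def integral_mult_right_zero flip: integral_complex_of_real)
    also have "\<dots> = (\<integral>y. \<integral>x. ?e x * of_real (p t (x - y) * p s y) \<partial>lborel \<partial>lborel)"
      by (rule lborel_pair.Fubini_integral[OF pe])
    also have "\<dots> = (\<integral>y. (?e y * of_real (p s y)) * (\<integral>x. ?e (x - y) * of_real (p t (x - y)) \<partial>lborel) \<partial>lborel)"
      by (subst integral_mult_right_zero[symmetric], intro Bochner_Integration.integral_cong refl)
        (simp add: inner_diff_right algebra_simps flip: exp_add)
    also have "\<dots> = (\<integral>y. (?e y * of_real (p s y)) * exp (- (of_real t * \<psi> \<xi>)) \<partial>lborel)"
      by (subst lborel_integral_translate[of "\<lambda>x. ?e x * of_real (p t x)"]) (simp, simp only: p_fourier'[OF t])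
    also have "\<dots> = exp (- (of_real s * \<psi> \<xi>)) * exp (- (of_real t * \<psi> \<xi>))"
      by (simp only: integral_mult_left_zero p_fourier'[OF s])
    also have "\<dots> = exp (- (of_real (t + s) * \<psi> \<xi>))"
      by (simp add: algebra_simps flip: exp_add)
    finally show ?thesis .
  qed
  have "(\<lambda>n::nat. C x - p (t + s) x) \<longlonglongrightarrow> 0"
  proof (rule fourier_tendsto_imp_tendsto[where L="L + L'"])
    show "integrable lborel (\<lambda>x. C x - p (t + s) x)" using Cint p_integrable[OF ts] by simp
    show "\<bar>C (x + h) - p (t + s) (x + h) - (C x - p (t + s) x)\<bar> \<le> (L + L') * norm h" for x h
      using Clip[of x h] L'(2)[of x h] by (simp add: algebra_simps)
    show "(\<integral>x. \<bar>C x - p (t + s) x\<bar> \<partial>lborel) \<le> (\<integral>x. \<bar>C x - p (t + s) x\<bar> \<partial>lborel)" ..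
    show "(\<lambda>n. \<integral>x. exp (- (\<i> * of_real (\<xi> \<bullet> x))) * complex_of_real (C x - p (t + s) x) \<partial>lborel) \<longlonglongrightarrow> 0" for \<xi>
      unfolding of_real_diff right_diff_distrib
      by (subst Bochner_Integration.integral_diff[OF integrable_fourier[OF Cint] integrable_fourier[OF p_integrable[OF ts]]])
        (simp only: F p_fourier'[OF ts] diff_self tendsto_const)
  qed
  then show ?thesis
    by (simp add: C_def LIMSEQ_const_iff)
qed

text \<open>Times after \<open>t\<close> are considered because \<open>p (t + h n)\<close> is a
  convolution of \<open>p t\<close> and so shares its Lipschitz constant, as the convergence lemma
  demands. The bound 2 is the sum of two total masses.\<close>

lemma p_time_tendsto:
  assumes t: "t > 0" and h: "h \<longlonglongrightarrow> 0" "\<And>n. h n > 0"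
  shows "(\<lambda>n. p (t + h n) x) \<longlonglongrightarrow> p t x"
proof -
  obtain L where L: "L \<ge> 0" "\<And>x h. \<bar>p t (x + h) - p t x\<bar> \<le> L * norm h"
    using p_lipschitz[OF t] by blast
  have th: "t + h n > 0" for n using t h(2)[of n] by simp
  have lip: "\<bar>p (t + h n) (x + k) - p (t + h n) x\<bar> \<le> L * norm k" for n x k
    using p_convolution_lipschitz[OF t h(2) L] by (simp add: p_convolution[OF t h(2)])
  have "(\<lambda>n. p (t + h n) x - p t x) \<longlonglongrightarrow> 0"
  proof (rule fourier_tendsto_imp_tendsto[where L="L + L" and B=2])
    show i: "integrable lborel (\<lambda>x. p (t + h n) x - p t x)" for n
      using p_integrable[OF t] p_integrable[OF th] by simp
    show "\<bar>p (t + h n) (x + k) - p t (x + k) - (p (t + h n) x - p t x)\<bar> \<le> (L + L) * norm k" for n x k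
      using lip[of n x k] L(2)[of x k] by (simp add: algebra_simps)
    show "(\<integral>x. \<bar>p (t + h n) x - p t x\<bar> \<partial>lborel) \<le> 2" for n
    proof -
      have "(\<integral>x. \<bar>p (t + h n) x - p t x\<bar> \<partial>lborel) \<le> (\<integral>x. p (t + h n) x + p t x \<partial>lborel)"
        using p_integrable[OF t] p_integrable[OF th]  p_nonneg[OF t] p_nonneg[OF th]
        by (intro integral_mono) (auto intro!: abs_triangle_ineq4[THEN order_trans])
      also have "\<dots> = 2" using p_integrable[OF t] p_integrable[OF th] p_integral[OF t] p_integral[OF th] by simp
      finally show ?thesis .
    qed
    show "(\<lambda>n. \<integral>x. exp (- (\<i> * of_real (\<xi> \<bullet> x))) * complex_of_real (p (t + h n) x - p t x) \<partial>lborel) \<longlonglongrightarrow> 0" for \<xi>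
    proof -
      have "(\<lambda>n. exp (- (of_real (t + h n) * \<psi> \<xi>)) - exp (- (of_real t * \<psi> \<xi>)))
          \<longlonglongrightarrow> exp (- (of_real (t + 0) * \<psi> \<xi>)) - exp (- (of_real t * \<psi> \<xi>))"
        by (intro tendsto_intros h)
      moreover have "(\<integral>x. exp (- (\<i> * of_real (\<xi> \<bullet> x))) * complex_of_real (p (t + h n) x - p t x) \<partial>lborel)
         = exp (- (of_real (t + h n) * \<psi> \<xi>)) - exp (- (of_real t * \<psi> \<xi>))" for n
        unfolding of_real_diff right_diff_distrib
        by (subst Bochner_Integration.integral_diff[OF integrable_fourier[OF p_integrable[OF th]] integrable_fourier[OF p_integrable[OF t]]])
          (simp only: p_fourier'[OF th] p_fourier'[OF t])
      ultimately show ?thesis by simp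
    qed
  qed
  from tendsto_add[OF this tendsto_const[of "p t x"]] show ?thesis by simp
qed

text \<open>Pointwise convergence of probability densities upgrades to \<open>L^1\<close>
  convergence by Scheffe's lemma; a failure of the claim would supply a sequence of increments
  contradicting this.\<close>

lemma p_time_continuous_L1:
  assumes t: "t > 0" and e: "e > 0"
  obtains h0 where "h0 > 0" "\<And>h. 0 < h \<Longrightarrow> h \<le> h0 \<Longrightarrow> (\<integral>x. \<bar>p (t + h) x - p t x\<bar> \<partial>lborel) \<le> e"
proof -
  have "\<exists>h0>0. \<forall>h. 0 < h \<and> h \<le> h0 \<longrightarrow> (\<integral>x. \<bar>p (t + h) x - p t x\<bar> \<partial>lborel) \<le> e"
  proof (rule ccontr)
    assume "\<not> ?thesis"
    then have "\<forall>n. \<exists>h. 0 < h \<and> h \<le> inverse (real (Suc n)) \<and> (\<integral>x. \<bar>p (t + h) x - p t x\<bar> \<partial>lborel) > e"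
      by (metis inverse_positive_iff_positive linorder_not_le of_nat_0_less_iff zero_less_Suc)
    then obtain h where h: "\<And>n. 0 < h n" "\<And>n. h n \<le> inverse (real (Suc n))"
      "\<And>n. (\<integral>x. \<bar>p (t + h n) x - p t x\<bar> \<partial>lborel) > e" by metis
    have th: "t + h n > 0" for n using t h(1)[of n] by simp
    have "h \<longlonglongrightarrow> 0"
      using h(1,2) by (intro tendsto_sandwich[OF _ _ tendsto_const LIMSEQ_inverse_real_of_nat])
        (auto intro!: always_eventually simp: less_imp_le)
    then have pt: "(\<lambda>n. p (t + h n) x) \<longlonglongrightarrow> p t x" for x
      by (intro p_time_tendsto t h)
    have one: "(\<integral>\<^sup>+x. ennreal (norm (p s x)) \<partial>lborel) = 1" if "s > 0" for s
      using nn_integral_eq_integral[OF p_integrable[OF that]] p_nonneg[OF that] p_integral[OF that] by simp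
    have "(\<lambda>n. \<integral>\<^sup>+ x. norm (p (t + h n) x - p t x) \<partial>lborel) \<longlonglongrightarrow> 0"
    proof (rule Scheffe_lemma2)
      show "p (t + h n) \<in> borel_measurable lborel" for n using p_meas[OF th] by simp
      show "integrable lborel (p t)" by (rule p_integrable[OF t])
      show "AE x in lborel. (\<lambda>n. p (t + h n) x) \<longlonglongrightarrow> p t x" using pt by simp
      show "(\<integral>\<^sup>+ x. norm (p (t + h n) x) \<partial>lborel) \<le> (\<integral>\<^sup>+ x. norm (p t x) \<partial>lborel)" for n
        using one[OF th] one[OF t] by simp
    qed
    then have "\<forall>\<^sub>F n in sequentially. (\<integral>\<^sup>+ x. norm (p (t + h n) x - p t x) \<partial>lborel) < ennreal e"
      using e by (intro order_tendstoD(2)) auto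
    then obtain n where n: "(\<integral>\<^sup>+ x. norm (p (t + h n) x - p t x) \<partial>lborel) < ennreal e"
      using eventually_happens' sequentially_bot by blast
    have "integrable lborel (\<lambda>x. \<bar>p (t + h n) x - p t x\<bar>)"
      using p_integrable[OF t] p_integrable[OF th] by (intro integrable_abs) simp
    from nn_integral_eq_integral[OF this] n
    have "ennreal (\<integral>x. \<bar>p (t + h n) x - p t x\<bar> \<partial>lborel) < ennreal e" by simp
    then show False using h(3)[of n] e by (auto simp: ennreal_less_iff)
  qed
  then show ?thesis using that by blast
qed

end

section \<open>Smoothing estimates for the semigroup\<close>

lemma cont_diff_1_shift_mult:
  fixes f :: "real^'d \<Rightarrow> real"
  assumes f: "cont_diff (Suc 0) f"
  shows "cont_diff (Suc 0) (\<lambda>x. k * f (x + c))"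
    and "partial_deriv i (\<lambda>x. k * f (x + c)) x = k * partial_deriv i f (x + c)"
proof -
  have D: "((\<lambda>x. k * f (x + c)) has_derivative (\<lambda>h. \<Sum>j\<in>UNIV. h $ j * (k * partial_deriv j f (x + c)))) (at x)" for x
  proof -
    have "((\<lambda>x. x + c) has_derivative (\<lambda>h. h)) (at x)"
      by (auto intro!: derivative_eq_intros)
    moreover have "f differentiable (at (x + c))" using f by (simp add: cont_diff_1_iff)
    ultimately have "((\<lambda>x. f (x + c)) has_derivative (\<lambda>h. \<Sum>j\<in>UNIV. h $ j * partial_deriv j f (x + c))) (at x)"
      by (rule has_derivative_compose[OF _ has_derivative_partial_deriv])
    from has_derivative_mult_right[OF this, of k] show ?thesis
      by (simp add: sum_distrib_left mult_ac)
  qed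
  show P: "partial_deriv i (\<lambda>x. k * f (x + c)) x = k * partial_deriv i f (x + c)" for i x
    by (rule partial_deriv_eqI[OF D])
  have "continuous_on UNIV (\<lambda>x. k * partial_deriv i f (x + c))" for i
  proof -
    have "continuous_on UNIV (partial_deriv i f)" using f unfolding cont_diff_1_iff by blast
    moreover have "continuous_on UNIV (\<lambda>x. x + c)" by (intro continuous_intros)
    ultimately have "continuous_on UNIV (\<lambda>x. partial_deriv i f (x + c))"
      by (rule continuous_on_compose2) simp
    then show ?thesis by (rule continuous_on_mult_left)
  qed
  then show "cont_diff (Suc 0) (\<lambda>x. k * f (x + c))"
    using differentiable_sum_partialI[OF D] P by (simp add: cont_diff_1_iff)
qed

lemma cont_diff_1_differentiable: "cont_diff (Suc 0) f \<Longrightarrow> f differentiable (at x)"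
  and cont_diff_1_partial_continuous: "cont_diff (Suc 0) f \<Longrightarrow> continuous_on UNIV (partial_deriv i f)"
  by (auto simp: cont_diff_1_iff)

lemma one_le_powr_nonpos: "0 < t \<Longrightarrow> t \<le> 1 \<Longrightarrow> a \<le> 0 \<Longrightarrow> 1 \<le> t powr a" for t a :: real
  using powr_mono'[of a 0 t] by simp

lemma holder_continuous_on:
  fixes f :: "real^'d \<Rightarrow> real"
  assumes "\<And>x h. \<bar>f (x + h) - f x\<bar> \<le> M * norm h powr \<sigma>" "\<sigma> > 0"
  shows "continuous_on UNIV f"
proof -
  have "isCont f x" for x
    unfolding isCont_iff
  proof (rule LIM_zero_cancel, rule Lim_null_comparison)
    show "\<forall>\<^sub>F h in at 0. norm (f (x + h) - f x) \<le> M * norm h powr \<sigma>"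
      using assms(1) by simp
    have "((\<lambda>h::real^'d. norm h powr \<sigma>) \<longlongrightarrow> 0) (at 0)"
      using assms(2) tendsto_norm_zero[OF tendsto_ident_at]
      by (intro tendsto_zero_powrI[OF _ tendsto_const]) auto
    then show "((\<lambda>h::real^'d. M * norm h powr \<sigma>) \<longlongrightarrow> 0) (at 0)"
      by (rule tendsto_mult_right_zero)
  qed
  then show ?thesis by (simp add: continuous_on_eq_continuous_at)
qed

context heat_semigroup
begin

abbreviation S where "S \<equiv> semigroup_op p"

lemma S_borel:
  assumes "t > 0" "\<phi> \<in> borel_measurable borel"
  shows "S t \<phi> x = (\<integral>y. p t (x - y) * \<phi> y \<partial>lborel)"
    and "S t \<phi> x = (\<integral>y. p t y * \<phi> (x - y) \<partial>lborel)"
proof -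
  note [measurable] = p_meas[OF assms(1)] assms(2)
  show *: "S t \<phi> x = (\<integral>y. p t (x - y) * \<phi> y \<partial>lborel)"
    unfolding semigroup_op_def by (rule integral_completion) measurable
  show "S t \<phi> x = (\<integral>y. p t y * \<phi> (x - y) \<partial>lborel)"
    using lborel_integral_reflect[of "\<lambda>y. p t y * \<phi> (x - y)" x] unfolding * by simp
qed

text \<open>One representative serves all times, because changing \<phi> on a null set changes no
  convolution with a density.\<close>

lemma S_borel_version:
  assumes "bounded_meas M \<phi>"
  obtains \<phi>' where "\<phi>' \<in> borel_measurable borel" "\<And>x. \<bar>\<phi>' x\<bar> \<le> M" "\<And>t. t > 0 \<Longrightarrow> S t \<phi> = S t \<phi>'"
proof -
  obtain \<phi>' where \<phi>': "\<phi>' \<in> borel_measurable borel" "\<And>x. \<bar>\<phi>' x\<bar> \<le> M" "AE x in lebesgue. \<phi> x = \<phi>' x"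
    using bounded_meas_borel_version[OF assms] by blast
  have "S t \<phi> = S t \<phi>'" if t: "t > 0" for t
    unfolding semigroup_op_def
  proof (intro ext integral_cong_AE)
    have pm: "(\<lambda>y. p t (x - y)) \<in> borel_measurable lebesgue" for x
      using p_meas[OF t] by (intro measurable_completion) simp
    show "(\<lambda>y. p t (x - y) * \<phi> y) \<in> borel_measurable lebesgue" for x
      using assms pm by (intro borel_measurable_times) (auto simp: bounded_meas_def)
    show "(\<lambda>y. p t (x - y) * \<phi>' y) \<in> borel_measurable lebesgue" for x
      using \<phi>'(1) by (intro borel_measurable_times pm measurable_completion) simp
    show "AE y in lebesgue. p t (x - y) * \<phi> y = p t (x - y) * \<phi>' y" for x
      using \<phi>'(3) by eventually_elim simp
  qed
  then show ?thesis using that \<phi>' by blast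
qed

lemma S_integrable:
  assumes "t > 0" "bounded_meas M \<phi>"
  shows "integrable lebesgue (\<lambda>y. p t (x - y) * \<phi> y)"
proof (rule Bochner_Integration.integrable_bound)
  note [measurable] = p_meas[OF assms(1)]
  show "integrable lebesgue (\<lambda>y. p t (x - y) * M)"
    using p_shift_integrable[OF assms(1)] by (subst integrable_completion) auto
  have "(\<lambda>y. p t (x - y)) \<in> borel_measurable lebesgue"
    by (intro measurable_completion) simp
  then show "(\<lambda>y. p t (x - y) * \<phi> y) \<in> borel_measurable lebesgue"
    using assms(2) by (intro borel_measurable_times) (auto simp: bounded_meas_def)
  show "AE y in lebesgue. norm (p t (x - y) * \<phi> y) \<le> norm (p t (x - y) * M)"
    using order_trans[OF bounded_meas_bound[OF assms(2)] abs_ge_self]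
    by (intro AE_I2) (auto simp: abs_mult intro!: mult_left_mono)
qed

lemma S_diff:
  assumes "t > 0" "bounded_meas M \<phi>" "bounded_meas M' \<phi>'"
  shows "S t (\<lambda>y. \<phi> y - \<phi>' y) x = S t \<phi> x - S t \<phi>' x"
  unfolding semigroup_op_def right_diff_distrib
  by (rule Bochner_Integration.integral_diff[OF S_integrable[OF assms(1,2)] S_integrable[OF assms(1,3)]])

lemma S_bound:
  assumes t: "t > 0" and \<phi>: "bounded_meas M \<phi>"
  shows "\<bar>S t \<phi> x\<bar> \<le> M"
proof -
  obtain \<phi>' where \<phi>': "\<phi>' \<in> borel_measurable borel" "\<And>x. \<bar>\<phi>' x\<bar> \<le> M" "S t \<phi> = S t \<phi>'"
    using S_borel_version[OF \<phi>] t by metis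
  have "\<bar>S t \<phi> x\<bar> \<le> (\<integral>y. p t y * M \<partial>lborel)"
    unfolding \<phi>'(3) S_borel(2)[OF t \<phi>'(1)]
  proof (rule integral_abs_bound[THEN order_trans], rule integral_mono')
    show "integrable lborel (\<lambda>y. p t y * M)" using p_integrable[OF t] by simp
    show "\<bar>p t y * \<phi>' (x - y)\<bar> \<le> p t y * M" for y
      using \<phi>'(2) p_nonneg[OF t] by (simp add: abs_mult mult_left_mono)
    show "0 \<le> p t y * M" for y
      using p_nonneg[OF t] bounded_meas_nonneg[OF \<phi>] by simp
  qed
  then show ?thesis using p_integral[OF t] by simp
qed

lemma partial_p_integrable:
  assumes "0 < t" "t \<le> Ts"
  shows "integrable lborel (partial_deriv i (p t))"
    and "(\<integral>y. \<bar>partial_deriv i (p t) y\<bar> \<partial>lborel) \<le> c0 * t powr (- 1 / \<alpha>)"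
proof -
  have m: "partial_deriv i (p t) \<in> borel_measurable borel"
    using p_smooth[OF assms(1)] by (intro borel_measurable_continuous_onI cont_diff_1_partial_continuous)
  show I: "integrable lborel (partial_deriv i (p t))"
    using m p_grad[OF assms, of i] by (intro integrableI_bounded) (auto intro: le_less_trans)
  have "ennreal (\<integral>y. \<bar>partial_deriv i (p t) y\<bar> \<partial>lborel) \<le> ennreal (c0 * t powr (- 1 / \<alpha>))"
    using nn_integral_eq_integral[OF integrable_abs[OF I]] p_grad[OF assms, of i] by simp
  then show "(\<integral>y. \<bar>partial_deriv i (p t) y\<bar> \<partial>lborel) \<le> c0 * t powr (- 1 / \<alpha>)"
    using c0 by (subst (asm) ennreal_le_iff) auto
qed

text \<open>The function \<open>\<phi>\<close> is truncated to balls because the difference quotients of \<open>p t\<close> need not have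
  an integrable majorant.\<close>

lemma S_borel_deriv:
  assumes t: "0 < t" "t \<le> Ts" and \<phi>: "\<phi> \<in> borel_measurable borel" and M: "\<And>x. \<bar>\<phi> x\<bar> \<le> M"
  shows "cont_diff (Suc 0) (S t \<phi>)"
    and "partial_deriv i (S t \<phi>) x = (\<integral>y. partial_deriv i (p t) (x - y) * \<phi> y \<partial>lborel)"
proof -
  note [measurable] = p_meas[OF t(1)] \<phi>
  have [measurable]: "partial_deriv i (p t) \<in> borel_measurable borel" for i
    using p_smooth[OF t(1)] by (intro borel_measurable_continuous_onI cont_diff_1_partial_continuous)
  have M0: "M \<ge> 0" using order_trans[OF abs_ge_zero M] .
  obtain B where B: "\<And>x. \<bar>p t x\<bar> \<le> B" "\<And>i x. \<bar>partial_deriv i (p t) x\<bar> \<le> B"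
    using p_bound[OF t(1)] by blast
  define \<phi>n where "\<phi>n n y = \<phi> y * indicator (cball 0 (real n)) y" for n :: nat and y
  have [measurable]: "cball (0::real^'d) (real n) \<in> sets borel" for n by simp
  have [measurable]: "\<phi>n n \<in> borel_measurable borel" for n unfolding \<phi>n_def[abs_def] by measurable
  have \<phi>nM: "\<bar>\<phi>n n y\<bar> \<le> M" "\<bar>\<phi> y - \<phi>n n y\<bar> \<le> M" for n y
    using M[of y] M0 by (auto simp: \<phi>n_def indicator_def)
  define w where "w n x = (\<integral>y. \<phi>n n y * p t (x + - y) \<partial>lborel)" for n x
  define G where "G i x = (\<integral>y. partial_deriv i (p t) (x - y) * \<phi> y \<partial>lborel)" for i x
  have wint: "integrable lborel (\<lambda>y. \<phi>n n y * p t (x + - y))" for n x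
  proof (rule Bochner_Integration.integrable_bound)
    show "integrable lborel (\<lambda>y. M * p t (x - y))"
      using p_shift_integrable[OF t(1)] by simp
    show "AE y in lborel. norm (\<phi>n n y * p t (x + - y)) \<le> norm (M * p t (x - y))"
      using \<phi>nM(1) M0 by (auto simp: abs_mult intro!: mult_right_mono)
  qed measurable
  have wD: "cont_diff (Suc 0) (w n)"
    "partial_deriv i (w n) x = (\<integral>y. \<phi>n n y * partial_deriv i (p t) (x + - y) \<partial>lborel)"
    "integrable lborel (\<lambda>y. \<phi>n n y * partial_deriv i (p t) (x + - y))" for n i x
  proof -
    note cd = cont_diff_1_shift_mult[OF p_smooth[OF t(1)]]
    \<comment> \<open>After truncation a constant on a ball of finite measure is an integrable
      majorant.\<close>
    have b: "integrable lborel (\<lambda>y::real^'d. M * B * indicator (cball 0 (real n)) y)"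
      by (intro integrable_mult_right integrable_real_indicator emeasure_bounded_finite) auto
    have bd: "\<bar>partial_deriv i (\<lambda>x. \<phi>n n y * p t (x + - y)) x\<bar> \<le> M * B * indicator (cball 0 (real n)) y" for i and x y
      unfolding cd(2) using M[of y] B(2)[of i "x - y"] M0 by (auto simp: \<phi>n_def abs_mult indicator_def intro!: mult_mono)
    note D = integral_parameter_cont_diff_1[OF cd(1) wint b bd]
    show "cont_diff (Suc 0) (w n)" unfolding w_def by (rule D(2))
    show "partial_deriv i (w n) x = (\<integral>y. \<phi>n n y * partial_deriv i (p t) (x + - y) \<partial>lborel)"
      unfolding w_def D(3) cd(2) ..
    show "integrable lborel (\<lambda>y. \<phi>n n y * partial_deriv i (p t) (x + - y))"
      using D(1) unfolding cd(2) .
  qed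
  have ev: "\<forall>\<^sub>F n in sequentially. y \<in> cball 0 (real n)" for y :: "real^'d"
    using eventually_ge_at_top[of "nat \<lceil>norm y\<rceil>"] by eventually_elim auto
  have lim: "(\<lambda>n. w n x) \<longlonglongrightarrow> S t \<phi> x" for x
    unfolding S_borel(1)[OF t(1) \<phi>] w_def
  proof (rule integral_dominated_convergence)
    show "integrable lborel (\<lambda>y. M * p t (x - y))"
      using p_shift_integrable[OF t(1)] by simp
    show "AE y in lborel. norm (\<phi>n n y * p t (x + - y)) \<le> M * p t (x - y)" for n
      using \<phi>nM(1) p_nonneg[OF t(1)] by (auto simp: abs_mult intro!: mult_right_mono)
    show "AE y in lborel. (\<lambda>n. \<phi>n n y * p t (x + - y)) \<longlonglongrightarrow> p t (x - y) * \<phi> y"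
    proof (rule AE_I2)
      fix y
      have "\<forall>\<^sub>F n in sequentially. \<phi>n n y * p t (x + - y) = p t (x - y) * \<phi> y"
        using ev[of y] by eventually_elim (simp add: \<phi>n_def)
      then show "(\<lambda>n. \<phi>n n y * p t (x + - y)) \<longlonglongrightarrow> p t (x - y) * \<phi> y"
        by (rule tendsto_eventually)
    qed
  qed measurable
  note Dp = partial_p_integrable(1)[OF t]
  have Dps: "integrable lborel (\<lambda>y. partial_deriv i (p t) (x - y))" for i x
    using lborel_integrable_affine[OF Dp, where c="-1" and t=x] by simp
  have Gint: "integrable lborel (\<lambda>y. partial_deriv i (p t) (x - y) * \<phi> y)" for i x
  proof (rule Bochner_Integration.integrable_bound)
    show "integrable lborel (\<lambda>y. partial_deriv i (p t) (x - y) * M)" using Dps by simp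
    show "AE y in lborel. norm (partial_deriv i (p t) (x - y) * \<phi> y) \<le> norm (partial_deriv i (p t) (x - y) * M)"
      using M M0 by (auto simp: abs_mult intro!: mult_left_mono)
  qed measurable
  \<comment> \<open>For \<open>x\<close> in \<open>ball 0 R\<close> and \<open>y\<close> outside the
    truncation ball, \<open>x - y\<close> has norm at least \<open>n - R\<close>. The error is
    therefore at most \<open>M\<close> times a tail of the integral of the kernel derivative,
    uniformly in \<open>x\<close>.\<close>
  have unif: "uniform_limit (ball 0 R) (\<lambda>n. partial_deriv i (w n)) (G i) sequentially" for i R
  proof (rule uniform_limitI)
    fix e :: real assume e: "e > 0"
    define T where "T n = (\<integral>z. \<bar>partial_deriv i (p t) z\<bar> * indicator {z. norm z \<ge> real n - R} z \<partial>lborel)" for n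
    have "T \<longlonglongrightarrow> (\<integral>z. 0 \<partial>(lborel :: (real^'d) measure))"
      unfolding T_def
    proof (rule integral_dominated_convergence)
      show "integrable lborel (\<lambda>z. \<bar>partial_deriv i (p t) z\<bar>)" using Dp by simp
      show "AE z in lborel. (\<lambda>n. \<bar>partial_deriv i (p t) z\<bar> * indicator {z. norm z \<ge> real n - R} z) \<longlonglongrightarrow> 0"
      proof (rule AE_I2)
        fix z :: "real^'d"
        have "\<forall>\<^sub>F n in sequentially. \<bar>partial_deriv i (p t) z\<bar> * indicator {z. norm z \<ge> real n - R} z = 0"
          using eventually_gt_at_top[of "nat \<lceil>norm z + R\<rceil>"]
          by eventually_elim (auto simp: indicator_def, linarith)
        then show "(\<lambda>n. \<bar>partial_deriv i (p t) z\<bar> * indicator {z. norm z \<ge> real n - R} z) \<longlonglongrightarrow> 0"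
          by (rule tendsto_eventually)
      qed
      show "AE z in lborel. norm (\<bar>partial_deriv i (p t) z\<bar> * indicator {z. norm z \<ge> real n - R} z) \<le> \<bar>partial_deriv i (p t) z\<bar>" for n
        by (auto simp: indicator_def)
    qed measurable
    then have "(\<lambda>n. M * T n) \<longlonglongrightarrow> 0" by (simp add: tendsto_mult_right_zero)
    then have "\<forall>\<^sub>F n in sequentially. M * T n < e" using e by (rule order_tendstoD)
    then show "\<forall>\<^sub>F n in sequentially. \<forall>x\<in>ball 0 R. dist (partial_deriv i (w n) x) (G i x) < e"
    proof eventually_elim
      case (elim n)
      show ?case
      proof
        fix x :: "real^'d" assume x: "x \<in> ball 0 R"
        have "partial_deriv i (w n) x - G i x = (\<integral>y. \<phi>n n y * partial_deriv i (p t) (x + - y) - partial_deriv i (p t) (x - y) * \<phi> y \<partial>lborel)"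
          unfolding wD(2) G_def by (rule Bochner_Integration.integral_diff[symmetric, OF wD(3) Gint])
        also have "\<bar>\<dots>\<bar> \<le> (\<integral>y. M * (\<bar>partial_deriv i (p t) (x - y)\<bar> * indicator {z. norm z \<ge> real n - R} (x - y)) \<partial>lborel)"
        proof (rule integral_abs_bound[THEN order_trans], rule integral_mono')
          show "integrable lborel (\<lambda>y. M * (\<bar>partial_deriv i (p t) (x - y)\<bar> * indicator {z. norm z \<ge> real n - R} (x - y)))"
          proof (intro integrable_mult_right Bochner_Integration.integrable_bound[OF integrable_abs[OF Dps[of i x]]])
            show "AE y in lborel. norm (\<bar>partial_deriv i (p t) (x - y)\<bar> * indicator {z. norm z \<ge> real n - R} (x - y)) \<le> norm \<bar>partial_deriv i (p t) (x - y)\<bar>"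
              by (auto simp: indicator_def)
          qed measurable
          show "0 \<le> M * (\<bar>partial_deriv i (p t) (x - y)\<bar> * indicator {z. norm z \<ge> real n - R} (x - y))" for y
            using M0 by simp
          show "\<bar>\<phi>n n y * partial_deriv i (p t) (x + - y) - partial_deriv i (p t) (x - y) * \<phi> y\<bar>
             \<le> M * (\<bar>partial_deriv i (p t) (x - y)\<bar> * indicator {z. norm z \<ge> real n - R} (x - y))" for y
          proof (cases "y \<in> cball 0 (real n)")
            case True
            then show ?thesis using M0 by (simp add: \<phi>n_def)
          next
            case False
            then have "norm (x - y) \<ge> real n - R"
              using x norm_triangle_ineq2[of y x] by (simp add: norm_minus_commute)
            then show ?thesis
              using False mult_right_mono[OF M[of y], of "\<bar>partial_deriv i (p t) (x - y)\<bar>"]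
              by (simp add: \<phi>n_def abs_mult mult.commute)
          qed
        qed
        also have "\<dots> = M * T n"
          using lborel_integral_reflect[of "\<lambda>z. M * (\<bar>partial_deriv i (p t) z\<bar> * indicator {z. norm z \<ge> real n - R} z)" x]
          by (simp add: T_def)
        finally show "dist (partial_deriv i (w n) x) (G i x) < e"
          using elim by (simp add: dist_real_def)
      qed
    qed
  qed
  show "cont_diff (Suc 0) (S t \<phi>)"
    by (rule cont_diff_1_uniform_limit(1)[OF wD(1) lim unif])
  show "partial_deriv i (S t \<phi>) x = (\<integral>y. partial_deriv i (p t) (x - y) * \<phi> y \<partial>lborel)"
    using cont_diff_1_uniform_limit(2)[OF wD(1) lim unif] by (simp add: G_def)
qed

lemma S_cont_diff_1:
  assumes t: "0 < t" "t \<le> Ts" and \<phi>: "bounded_meas M \<phi>"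
  shows "cont_diff (Suc 0) (S t \<phi>)"
proof -
  obtain \<phi>' where \<phi>': "\<phi>' \<in> borel_measurable borel" "\<And>x. \<bar>\<phi>' x\<bar> \<le> M" "S t \<phi> = S t \<phi>'"
    using S_borel_version[OF \<phi>] t by metis
  show ?thesis using S_borel_deriv(1)[OF t \<phi>'(1,2)] \<phi>'(3) by simp
qed

lemma S_partial_bound:
  assumes t: "0 < t" "t \<le> Ts" and \<phi>: "bounded_meas M \<phi>"
  shows "\<bar>partial_deriv i (S t \<phi>) x\<bar> \<le> c0 * t powr (- 1 / \<alpha>) * M"
proof -
  obtain \<phi>' where \<phi>': "\<phi>' \<in> borel_measurable borel" "\<And>x. \<bar>\<phi>' x\<bar> \<le> M" "S t \<phi> = S t \<phi>'"
    using S_borel_version[OF \<phi>] t by metis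
  have M0: "M \<ge> 0" by (rule bounded_meas_nonneg[OF \<phi>])
  note Dp = partial_p_integrable[OF t]
  have "\<bar>partial_deriv i (S t \<phi>) x\<bar> \<le> (\<integral>y. \<bar>partial_deriv i (p t) (x - y)\<bar> * M \<partial>lborel)"
    unfolding \<phi>'(3) S_borel_deriv(2)[OF t \<phi>'(1,2)]
  proof (rule integral_abs_bound[THEN order_trans], rule integral_mono')
    show "integrable lborel (\<lambda>y. \<bar>partial_deriv i (p t) (x - y)\<bar> * M)"
      using lborel_integrable_affine[OF Dp(1), where c="-1" and t=x] by simp
  qed (use \<phi>'(2) M0 in \<open>auto simp: abs_mult intro!: mult_left_mono\<close>)
  also have "\<dots> = (\<integral>y. \<bar>partial_deriv i (p t) y\<bar> \<partial>lborel) * M"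
    using lborel_integral_reflect[of "\<lambda>y. \<bar>partial_deriv i (p t) y\<bar>" x] borel_measurable_integrable[OF Dp(1)] by simp
  also have "\<dots> \<le> c0 * t powr (- 1 / \<alpha>) * M"
    using Dp(2) M0 by (rule mult_right_mono)
  finally show ?thesis .
qed

lemma S_meas: "0 < t \<Longrightarrow> t \<le> Ts \<Longrightarrow> bounded_meas M \<phi> \<Longrightarrow> bounded_meas M (S t \<phi>)"
  by (rule bounded_measI_continuous[OF cont_diff_continuous[OF S_cont_diff_1] S_bound])

lemma S_partial_meas: "0 < t \<Longrightarrow> t \<le> Ts \<Longrightarrow> bounded_meas M \<phi> \<Longrightarrow>
    bounded_meas (c0 * t powr (- 1 / \<alpha>) * M) (partial_deriv i (S t \<phi>))"
  by (rule bounded_measI_continuous[OF cont_diff_1_partial_continuous[OF S_cont_diff_1] S_partial_bound])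

text \<open>The convolution is written with the shift on \<phi>, so that the derivative falls on
  \<phi>; the kernel times \<open>M'\<close> is the majorant.\<close>

lemma S_partial_commute:
  assumes t: "t > 0" and \<phi>: "cont_diff (Suc 0) \<phi>" "bounded_meas M \<phi>" "\<And>i x. \<bar>partial_deriv i \<phi> x\<bar> \<le> M'"
  shows "partial_deriv i (S t \<phi>) x = S t (partial_deriv i \<phi>) x"
proof -
  have bm: "\<phi> \<in> borel_measurable borel" "partial_deriv i \<phi> \<in> borel_measurable borel" for i
    using cont_diff_continuous[OF \<phi>(1)] cont_diff_1_partial_continuous[OF \<phi>(1)]
    by (auto intro: borel_measurable_continuous_onI)
  note cd = cont_diff_1_shift_mult[OF \<phi>(1)]
  have int: "integrable lborel (\<lambda>y. p t y * \<phi> (x + - y))" for x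
    using p_bounded_mult_integrable[OF t bm(1) bounded_meas_bound[OF \<phi>(2)]] by simp
  have b: "integrable lborel (\<lambda>y. p t y * M')" using p_integrable[OF t] by simp
  have bd: "\<bar>partial_deriv i (\<lambda>x. p t y * \<phi> (x + - y)) x\<bar> \<le> p t y * M'" for i x y
    unfolding cd(2) using \<phi>(3) p_nonneg[OF t] by (simp add: abs_mult mult_left_mono)
  have "S t \<phi> = (\<lambda>x. \<integral>y. p t y * \<phi> (x + - y) \<partial>lborel)"
    using S_borel(2)[OF t bm(1)] by (simp add: fun_eq_iff)
  then have "partial_deriv i (S t \<phi>) x = (\<integral>y. partial_deriv i (\<lambda>x. p t y * \<phi> (x + - y)) x \<partial>lborel)"
    using integral_parameter_cont_diff_1(3)[OF cd(1) int b bd] by (simp only:)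
  then show ?thesis
    unfolding cd(2) using S_borel(2)[OF t bm(2)] by simp
qed

text \<open>Fubini and the convolution identity of the kernels. The bound on \<open>s\<close>
  ensures that \<open>S s \<phi>\<close> is continuous and hence Borel.\<close>

lemma S_semigroup:
  assumes t: "t > 0" and s: "s > 0" and \<phi>: "bounded_meas M \<phi>" and sm: "s \<le> Ts"
  shows "S t (S s \<phi>) = S (t + s) \<phi>"
proof
  fix x
  obtain \<phi>' where \<phi>'[measurable]: "\<phi>' \<in> borel_measurable borel" and M: "\<And>x. \<bar>\<phi>' x\<bar> \<le> M"
    and S': "\<And>t. t > 0 \<Longrightarrow> S t \<phi> = S t \<phi>'"
    using S_borel_version[OF \<phi>] by metis
  note [measurable] = p_meas[OF t] p_meas[OF s]
  have ts: "t + s > 0" using t s by simp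
  have [measurable]: "S s \<phi>' \<in> borel_measurable borel"
    by (intro borel_measurable_continuous_onI cont_diff_continuous[OF S_borel_deriv(1)[OF s sm \<phi>' M]])
  have pair: "integrable (lborel \<Otimes>\<^sub>M lborel) (\<lambda>(y, w). p s (w - y) * p t y * \<phi>' (x - w))"
  proof (rule Bochner_Integration.integrable_bound)
    show "integrable (lborel \<Otimes>\<^sub>M lborel) (\<lambda>z. M * (case z of (y, w) \<Rightarrow> p s (w - y) * p t y))"
      using integrable_convolution_pair[OF p_integrable[OF s] p_integrable[OF t]] by (rule integrable_mult_right)
    show "AE z in lborel \<Otimes>\<^sub>M lborel. norm (case z of (y, w) \<Rightarrow> p s (w - y) * p t y * \<phi>' (x - w))
        \<le> norm (M * (case z of (y, w) \<Rightarrow> p s (w - y) * p t y))"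
    proof (rule AE_I2)
      fix z :: "(real^'d) \<times> (real^'d)"
      obtain y w where z: "z = (y, w)" by (cases z)
      have "\<bar>\<phi>' (x - w)\<bar> * \<bar>p s (w - y) * p t y\<bar> \<le> \<bar>M\<bar> * \<bar>p s (w - y) * p t y\<bar>"
        using order_trans[OF M[of "x - w"] abs_ge_self] by (rule mult_right_mono) simp
      then show "norm (case z of (y, w) \<Rightarrow> p s (w - y) * p t y * \<phi>' (x - w))
          \<le> norm (M * (case z of (y, w) \<Rightarrow> p s (w - y) * p t y))"
        by (simp add: z abs_mult mult_ac)
    qed
  qed measurable
  have "S t (S s \<phi>) x = (\<integral>y. p t y * S s \<phi>' (x - y) \<partial>lborel)"
    unfolding S'[OF s] by (rule S_borel(2)[OF t]) simp
  also have "\<dots> = (\<integral>y. \<integral>w. p s (w - y) * p t y * \<phi>' (x - w) \<partial>lborel \<partial>lborel)"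
  proof (intro Bochner_Integration.integral_cong refl)
    fix y
    have "S s \<phi>' (x - y) = (\<integral>z. p s z * \<phi>' (x - y - z) \<partial>lborel)"
      by (rule S_borel(2)[OF s]) simp
    also have "\<dots> = (\<integral>w. p s (w - y) * \<phi>' (x - w) \<partial>lborel)"
      using lborel_integral_translate[of "\<lambda>z. p s z * \<phi>' (x - y - z)" y] by (simp add: algebra_simps)
    finally have "p t y * S s \<phi>' (x - y) = p t y * (\<integral>w. p s (w - y) * \<phi>' (x - w) \<partial>lborel)" by simp
    also have "\<dots> = (\<integral>w. p s (w - y) * p t y * \<phi>' (x - w) \<partial>lborel)"
      by (subst integral_mult_right_zero[symmetric]) (simp add: mult_ac)
    finally show "p t y * S s \<phi>' (x - y) = (\<integral>w. p s (w - y) * p t y * \<phi>' (x - w) \<partial>lborel)" .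
  qed
  also have "\<dots> = (\<integral>w. \<integral>y. p s (w - y) * p t y * \<phi>' (x - w) \<partial>lborel \<partial>lborel)"
    by (rule lborel_pair.Fubini_integral[OF pair, symmetric])
  also have "\<dots> = (\<integral>w. p (t + s) w * \<phi>' (x - w) \<partial>lborel)"
    by (simp add: p_convolution[OF s t] add.commute)
  also have "\<dots> = S (t + s) \<phi> x"
    unfolding S'[OF ts] by (rule S_borel(2)[OF ts \<phi>', symmetric])
  finally show "S t (S s \<phi>) x = S (t + s) \<phi> x" .
qed

section \<open>Translations and continuity in time of the semigroup\<close>

lemma S_shift:
  assumes "t > 0" "\<phi> \<in> borel_measurable borel"
  shows "S t (\<lambda>y. \<phi> (y + h)) x = S t \<phi> (x + h)"
  using assms by (simp add: S_borel(2) algebra_simps)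

text \<open>The semigroup commutes with translations, so the increment of \<open>S t \<phi>\<close>
  is the semigroup applied to the increment of \<phi>, to which the sup and gradient bounds
  apply.\<close>

lemma S_oscillation:
  assumes t: "t > 0" and \<phi>: "\<phi> \<in> borel_measurable borel" "bounded_meas M \<phi>"
    and osc: "\<And>y. \<bar>\<phi> (y + h) - \<phi> y\<bar> \<le> K"
  shows "\<bar>S t \<phi> (x + h) - S t \<phi> x\<bar> \<le> K"
    and "t \<le> Ts \<Longrightarrow> \<bar>partial_deriv i (S t \<phi>) (x + h) - partial_deriv i (S t \<phi>) x\<bar> \<le> c0 * t powr (- 1 / \<alpha>) * K"
proof -
  have sh: "bounded_meas M (\<lambda>y. \<phi> (y + h))"
    using \<phi> by (intro bounded_measI_borel) (auto simp: bounded_meas_bound)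
  have bm: "bounded_meas K (\<lambda>y. \<phi> (y + h) - \<phi> y)"
    using bounded_meas_diff[OF sh \<phi>(2) osc] .
  have eq: "S t (\<lambda>y. \<phi> (y + h) - \<phi> y) = (\<lambda>x. S t \<phi> (x + h) - S t \<phi> x)"
    by (simp add: fun_eq_iff S_diff[OF t sh \<phi>(2)] S_shift[OF t \<phi>(1)])
  show "\<bar>S t \<phi> (x + h) - S t \<phi> x\<bar> \<le> K"
    using S_bound[OF t bm, of x] by (simp add: eq)
  assume tT: "t \<le> Ts"
  have d: "S t \<phi> differentiable (at x)" for x
    using S_cont_diff_1[OF t tT \<phi>(2)] by (rule cont_diff_1_differentiable)
  show "\<bar>partial_deriv i (S t \<phi>) (x + h) - partial_deriv i (S t \<phi>) x\<bar> \<le> c0 * t powr (- 1 / \<alpha>) * K"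
    using S_partial_bound[OF t tT bm, of i x] partial_deriv_shift[OF d]
    by (simp add: eq partial_deriv_minus_fun d)
qed

text \<open>\<open>L^1\<close> continuity of the kernel gives the bound at time \<delta>, uniformly
  in \<phi> and \<open>x\<close>. For a later \<open>t\<close> the contraction
  \<open>S (t - \<delta>)\<close> is applied to the difference at time \<delta>, so the same
  \<open>h0\<close> works for all \<open>t\<close>.\<close>

lemma S_time_continuous:
  assumes \<delta>: "\<delta> > 0" "\<delta> \<le> Ts" and e: "e > 0"
  obtains h0 where "h0 > 0"
    "\<And>t h \<phi> M x. \<delta> \<le> t \<Longrightarrow> 0 \<le> h \<Longrightarrow> h \<le> h0 \<Longrightarrow> t + h \<le> Ts \<Longrightarrow> bounded_meas M \<phi> \<Longrightarrow> \<bar>S (t + h) \<phi> x - S t \<phi> x\<bar> \<le> e * M"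
proof -
  obtain h0 where h0: "h0 > 0"
    "\<And>h. 0 < h \<Longrightarrow> h \<le> h0 \<Longrightarrow> (\<integral>x. \<bar>p (\<delta> + h) x - p \<delta> x\<bar> \<partial>lborel) \<le> e"
    using p_time_continuous_L1[OF \<delta>(1) e] by blast
  have base: "\<bar>S (\<delta> + h) \<phi> x - S \<delta> \<phi> x\<bar> \<le> e * M"
    if h: "0 < h" "h \<le> h0" and \<phi>: "bounded_meas M \<phi>" for h \<phi> M x
  proof -
    obtain \<phi>' where \<phi>'[measurable]: "\<phi>' \<in> borel_measurable borel" and M: "\<And>x. \<bar>\<phi>' x\<bar> \<le> M"
      and S': "\<And>t. t > 0 \<Longrightarrow> S t \<phi> = S t \<phi>'"
      using S_borel_version[OF \<phi>] by metis
    have \<delta>h: "\<delta> + h > 0" using \<delta> h by simp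
    have i: "integrable lborel (\<lambda>x. p (\<delta> + h) x - p \<delta> x)"
      using p_integrable[OF \<delta>(1)] p_integrable[OF \<delta>h] by simp
    have "S (\<delta> + h) \<phi> x - S \<delta> \<phi> x = (\<integral>y. (p (\<delta> + h) y - p \<delta> y) * \<phi>' (x - y) \<partial>lborel)"
      unfolding S'[OF \<delta>h] S'[OF \<delta>(1)] S_borel(2)[OF \<delta>h \<phi>'] S_borel(2)[OF \<delta>(1) \<phi>'] left_diff_distrib
      by (rule Bochner_Integration.integral_diff[symmetric, OF
            p_bounded_mult_integrable[OF \<delta>h \<phi>' M] p_bounded_mult_integrable[OF \<delta>(1) \<phi>' M]])
    also have "\<bar>\<dots>\<bar> \<le> (\<integral>y. \<bar>p (\<delta> + h) y - p \<delta> y\<bar> * M \<partial>lborel)"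
      by (rule integral_abs_bound[THEN order_trans], rule integral_mono')
        (use i M bounded_meas_nonneg[OF \<phi>] in \<open>auto simp: abs_mult intro!: mult_left_mono integrable_abs\<close>)
    also have "\<dots> = (\<integral>y. \<bar>p (\<delta> + h) y - p \<delta> y\<bar> \<partial>lborel) * M" by simp
    also have "\<dots> \<le> e * M"
      using h0(2)[OF h] bounded_meas_nonneg[OF \<phi>] by (rule mult_right_mono)
    finally show ?thesis .
  qed
  show ?thesis
  proof
    show "h0 > 0" by fact
    fix t h M :: real and \<phi> :: "real^'d \<Rightarrow> real" and x assume t: "\<delta> \<le> t" and h: "0 \<le> h" "h \<le> h0" and tT: "t + h \<le> Ts" and \<phi>: "bounded_meas M \<phi>"
    consider "h = 0" | "h > 0" "t = \<delta>" | "h > 0" "t > \<delta>" using t h by linarith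
    then show "\<bar>S (t + h) \<phi> x - S t \<phi> x\<bar> \<le> e * M"
    proof cases
      case 1 then show ?thesis using e bounded_meas_nonneg[OF \<phi>] by simp
    next
      case 2 then show ?thesis using base h \<phi> by blast
    next
      case 3
      then have pos: "t - \<delta> > 0" "\<delta> + h > 0" "\<delta> + h \<le> Ts" using \<delta> tT by auto
      have bm: "bounded_meas (e * M) (\<lambda>x. S (\<delta> + h) \<phi> x - S \<delta> \<phi> x)"
        using bounded_meas_diff[OF S_meas[OF pos(2,3) \<phi>] S_meas[OF \<delta> \<phi>] base[OF 3(1) h(2) \<phi>]] .
      have "S (t + h) \<phi> = S (t - \<delta>) (S (\<delta> + h) \<phi>)" "S t \<phi> = S (t - \<delta>) (S \<delta> \<phi>)"
        using S_semigroup[OF pos(1,2) \<phi> pos(3)] S_semigroup[OF pos(1) \<delta>(1) \<phi> \<delta>(2)] by (auto simp: algebra_simps)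
      then have "S (t + h) \<phi> x - S t \<phi> x = S (t - \<delta>) (\<lambda>x. S (\<delta> + h) \<phi> x - S \<delta> \<phi> x) x"
        using S_diff[OF pos(1) S_meas[OF pos(2,3) \<phi>] S_meas[OF \<delta> \<phi>]] by simp
      then show ?thesis using S_bound[OF pos(1) bm] by simp
    qed
  qed
qed

text \<open>A stretch \<open>r = \<delta> / 2\<close> of the time is reserved for taking the
  derivative, at the fixed cost \<open>k\<close>; the undifferentiated statement handles the rest,
  which is at least \<open>r\<close> long, with tolerance \<open>e / k\<close>.\<close>

lemma S_partial_time_continuous:
  assumes \<delta>: "\<delta> > 0" "\<delta> \<le> Ts" and e: "e > 0"
  obtains h0 where "h0 > 0"
    "\<And>t h \<phi> M x i. \<delta> \<le> t \<Longrightarrow> 0 \<le> h \<Longrightarrow> h \<le> h0 \<Longrightarrow> t + h \<le> Ts \<Longrightarrow> bounded_meas M \<phi> \<Longrightarrow>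
       \<bar>partial_deriv i (S (t + h) \<phi>) x - partial_deriv i (S t \<phi>) x\<bar> \<le> e * M"
proof -
  define r where "r = \<delta> / 2"
  have r: "0 < r" "r \<le> Ts" "r < \<delta>" using \<delta> by (auto simp: r_def)
  define k where "k = c0 * r powr (- 1 / \<alpha>)"
  have k: "k > 0" using c0 r by (simp add: k_def)
  obtain h0 where h0: "h0 > 0"
    "\<And>t h \<phi> M x. r \<le> t \<Longrightarrow> 0 \<le> h \<Longrightarrow> h \<le> h0 \<Longrightarrow> t + h \<le> Ts \<Longrightarrow> bounded_meas M \<phi> \<Longrightarrow> \<bar>S (t + h) \<phi> x - S t \<phi> x\<bar> \<le> (e / k) * M"
    using S_time_continuous[OF r(1,2), of "e / k"] e k by auto
  show ?thesis
  proof
    show "h0 > 0" by fact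
    fix t h M :: real and \<phi> :: "real^'d \<Rightarrow> real" and x i assume t: "\<delta> \<le> t" and h: "0 \<le> h" "h \<le> h0" and tT: "t + h \<le> Ts" and \<phi>: "bounded_meas M \<phi>"
    have pos: "0 < t - r" "0 < t - r + h" "t - r \<le> Ts" "t - r + h \<le> Ts" "r \<le> t - r" "t \<le> Ts" "0 < t" "0 < t + h"
      using t h tT r \<delta> by (auto simp: r_def)
    note bm = S_meas[OF pos(1,3) \<phi>] S_meas[OF pos(2,4) \<phi>]
    have bd: "bounded_meas (e / k * M) (\<lambda>x. S (t - r + h) \<phi> x - S (t - r) \<phi> x)"
      by (rule bounded_meas_diff[OF bm(2,1) h0(2)[OF pos(5) h pos(4) \<phi>]])
    have "r + (t - r) = t" "r + (t - r + h) = t + h" by simp_all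
    then have "S r (\<lambda>x. S (t - r + h) \<phi> x - S (t - r) \<phi> x) = (\<lambda>x. S (t + h) \<phi> x - S t \<phi> x)"
      using S_semigroup[OF r(1) pos(1) \<phi> pos(3)] S_semigroup[OF r(1) pos(2) \<phi> pos(4)]
      by (simp only: fun_eq_iff S_diff[OF r(1) bm(2,1)]) simp
    then have "partial_deriv i (S r (\<lambda>x. S (t - r + h) \<phi> x - S (t - r) \<phi> x)) x =
        partial_deriv i (S (t + h) \<phi>) x - partial_deriv i (S t \<phi>) x"
      using pos tT cont_diff_1_differentiable[OF S_cont_diff_1[OF _ _ \<phi>]] by (simp add: partial_deriv_minus_fun)
    moreover have "\<bar>partial_deriv i (S r (\<lambda>x. S (t - r + h) \<phi> x - S (t - r) \<phi> x)) x\<bar> \<le> k * (e / k * M)"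
      using S_partial_bound[OF r(1,2) bd] by (simp add: k_def)
    ultimately show "\<bar>partial_deriv i (S (t + h) \<phi>) x - partial_deriv i (S t \<phi>) x\<bar> \<le> e * M"
      using k by simp
  qed
qed

section \<open>Higher derivatives by halving the time\<close>

lemma S_partial_half:
  assumes t: "0 < t" "t \<le> Ts" and \<phi>: "bounded_meas M \<phi>"
  shows "partial_deriv i (S t \<phi>) = S (t/2) (partial_deriv i (S (t/2) \<phi>))"
proof
  fix x
  have h: "0 < t/2" "t/2 \<le> Ts" using t by auto
  have "S t \<phi> = S (t/2) (S (t/2) \<phi>)"
    using S_semigroup[OF h(1,1) \<phi> h(2)] by simp
  then show "partial_deriv i (S t \<phi>) x = S (t/2) (partial_deriv i (S (t/2) \<phi>)) x"
    using S_partial_commute[OF h(1) S_cont_diff_1[OF h \<phi>] S_meas[OF h \<phi>] S_partial_bound[OF h \<phi>]] by simp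
qed

text \<open>A derivative produced in one half of the time is a bounded function on which the other
  half acts, so the induction applies to it, with \<phi> and its bound changed.\<close>

lemma S_cont_diff:
  "0 < t \<Longrightarrow> t \<le> Ts \<Longrightarrow> bounded_meas M \<phi> \<Longrightarrow> cont_diff n (S t \<phi>)"
proof (induction n arbitrary: t \<phi> M)
  case 0
  then show ?case using cont_diff_mono[OF S_cont_diff_1] by blast
next
  case (Suc n)
  have h: "0 < t/2" "t/2 \<le> Ts" using Suc.prems by auto
  show ?case
  proof (rule cont_diff_Suc_partial)
    show "S t \<phi> differentiable (at x)" for x
      using S_cont_diff_1[OF Suc.prems] by (rule cont_diff_1_differentiable)
    show "cont_diff n (partial_deriv i (S t \<phi>))" for i
      unfolding S_partial_half[OF Suc.prems] by (rule Suc.IH[OF h S_partial_meas[OF h Suc.prems(3)]])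
  qed
qed

text \<open>The derivative taken first uses half of the time and costs order
  \<open>t powr (- 1 / \<alpha>)\<close>; the others share the second half. Shorter words obey the
  same bound since \<open>t\<close> is at most 1, and the \<open>max 1\<close> in the constant
  covers the empty word.\<close>

lemma S_iter_deriv_bound:
  "\<exists>C\<ge>0. \<forall>t \<phi> M \<kappa> x. 0 < t \<longrightarrow> t \<le> Ts \<longrightarrow> bounded_meas M \<phi> \<longrightarrow> length \<kappa> \<le> n \<longrightarrow>
     \<bar>iter_deriv \<kappa> (S t \<phi>) x\<bar> \<le> C * t powr (- real n / \<alpha>) * M"
proof (induction n)
  case 0
  show ?case
    by (rule exI[of _ 1]) (auto simp: S_bound)
next
  case (Suc n)
  then obtain C where C: "C \<ge> 0" "\<And>t \<phi> M \<kappa> x. 0 < t \<Longrightarrow> t \<le> Ts \<Longrightarrow> bounded_meas M \<phi> \<Longrightarrow> length \<kappa> \<le> n \<Longrightarrow>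
     \<bar>iter_deriv \<kappa> (S t \<phi>) x\<bar> \<le> C * t powr (- real n / \<alpha>) * M" by blast
  define C' where "C' = max 1 (C * c0 * (1/2) powr (- real (Suc n) / \<alpha>))"
  show ?case
  proof (intro exI[of _ C'] conjI allI impI)
    show "C' \<ge> 0" by (simp add: C'_def)
    fix t M :: real and \<phi> :: "real^'d \<Rightarrow> real" and \<kappa> :: "'d list" and x assume t: "0 < t" "t \<le> Ts" and \<phi>: "bounded_meas M \<phi>" and \<kappa>: "length \<kappa> \<le> Suc n"
    have M: "M \<ge> 0" by (rule bounded_meas_nonneg[OF \<phi>])
    have h: "0 < t/2" "t/2 \<le> Ts" using t by auto
    show "\<bar>iter_deriv \<kappa> (S t \<phi>) x\<bar> \<le> C' * t powr (- real (Suc n) / \<alpha>) * M"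
    proof (cases \<kappa> rule: rev_cases)
      case Nil
      have "1 \<le> t powr (- real (Suc n) / \<alpha>)"
        using t Ts alpha by (intro one_le_powr_nonpos divide_nonpos_pos) auto
      then have "1 * 1 \<le> C' * t powr (- real (Suc n) / \<alpha>)"
        by (intro mult_mono) (auto simp: C'_def)
      then have "1 * M \<le> C' * t powr (- real (Suc n) / \<alpha>) * M"
        using M by (intro mult_right_mono) auto
      then show ?thesis using S_bound[OF t(1) \<phi>, of x] Nil by simp
    next
      case (snoc \<kappa>' i)
      then have "iter_deriv \<kappa> (S t \<phi>) x = iter_deriv \<kappa>' (S (t/2) (partial_deriv i (S (t/2) \<phi>))) x"
        by (simp add: iter_deriv_append S_partial_half[OF t \<phi>])
      also have "\<bar>\<dots>\<bar> \<le> C * (t/2) powr (- real n / \<alpha>) * (c0 * (t/2) powr (- 1 / \<alpha>) * M)"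
        using \<kappa> snoc by (intro C(2)[OF h S_partial_meas[OF h \<phi>]]) simp
      also have "\<dots> = C * c0 * (t * (1/2)) powr (- real (Suc n) / \<alpha>) * M"
        by (simp add: powr_add[symmetric] add_divide_distrib diff_divide_distrib algebra_simps)
      also have "\<dots> = (C * c0 * (1/2) powr (- real (Suc n) / \<alpha>)) * t powr (- real (Suc n) / \<alpha>) * M"
        using t by (subst powr_mult) (auto simp: mult_ac)
      also have "\<dots> \<le> C' * t powr (- real (Suc n) / \<alpha>) * M"
        using M by (intro mult_right_mono) (auto simp: C'_def)
      finally show ?thesis .
    qed
  qed
qed

text \<open>The derivative is compared with the difference quotient of step \<open>t powr (1 / \<alpha>)\<close>,
  which by the mean value theorem is the derivative at an intermediate point.\<close>

lemma S_partial_holder_bound: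
  assumes t: "0 < t" "t \<le> Ts" and \<sigma>: "0 < \<sigma>" "\<sigma> \<le> 1" and \<phi>: "bounded_meas M0 \<phi>"
    and hol: "\<And>x h. \<bar>\<phi> (x + h) - \<phi> x\<bar> \<le> M * norm h powr \<sigma>"
  shows "\<bar>partial_deriv i (S t \<phi>) x\<bar> \<le> (1 + c0) * t powr (- (1 - \<sigma>) / \<alpha>) * M"
proof -
  define e where "e = t powr (1 / \<alpha>)"
  have e: "e > 0" using t by (simp add: e_def)
  have M: "M \<ge> 0" using order_trans[OF abs_ge_zero hol[of 0 "axis undefined 1"]] by (simp add: norm_axis_1)
  have bo: "\<phi> \<in> borel_measurable borel"
    using holder_continuous_on[OF hol \<sigma>(1)] by (rule borel_measurable_continuous_onI)
  have d: "S t \<phi> differentiable (at x)" for x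
    using S_cont_diff_1[OF t \<phi>] by (rule cont_diff_1_differentiable)
  obtain s where s: "0 < s" "s < e"
    "S t \<phi> (x + e *\<^sub>R axis i 1) - S t \<phi> x = e * partial_deriv i (S t \<phi>) (x + s *\<^sub>R axis i 1)"
    using partial_deriv_mean_value[OF d e] by metis
  have hb: "M * norm (r *\<^sub>R axis i (1::real)) powr \<sigma> \<le> M * e powr \<sigma>" if "0 < r" "r \<le> e" for r
    using that M \<sigma> by (intro mult_left_mono powr_mono2) (auto simp: norm_axis_1)
  have "\<bar>S t \<phi> (x + e *\<^sub>R axis i 1) - S t \<phi> x\<bar> \<le> M * e powr \<sigma>"
    by (intro S_oscillation(1)[OF t(1) bo \<phi>] order_trans[OF hol hb] e order_refl)
  then have "\<bar>partial_deriv i (S t \<phi>) (x + s *\<^sub>R axis i 1)\<bar> \<le> M * e powr \<sigma> / e"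
    using e s(3) by (simp add: abs_mult field_simps)
  also have "M * e powr \<sigma> / e = M * e powr (\<sigma> - 1)"
    using e by (simp add: powr_diff)
  finally have 1: "\<bar>partial_deriv i (S t \<phi>) (x + s *\<^sub>R axis i 1)\<bar> \<le> M * e powr (\<sigma> - 1)" .
  \<comment> \<open>Going back to \<open>x\<close> is a displacement shorter than \<open>e\<close>,
    over which \<phi> oscillates by at most \<open>M * e powr \<sigma>\<close>. The gradient rate
    \<open>t powr (- 1 / \<alpha>)\<close> equals \<open>1 / e\<close>, so both contributions are of
    order \<open>e powr (\<sigma> - 1)\<close>.\<close>
  have "\<bar>partial_deriv i (S t \<phi>) (x + s *\<^sub>R axis i 1) - partial_deriv i (S t \<phi>) x\<bar>
      \<le> c0 * t powr (- 1 / \<alpha>) * (M * e powr \<sigma>)"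
    using s by (intro S_oscillation(2)[OF t(1) bo \<phi> _ t(2)] order_trans[OF hol hb]) auto
  also have "\<dots> = c0 * (M * e powr (\<sigma> - 1))"
    using t by (simp add: e_def powr_powr powr_add[symmetric] diff_divide_distrib)
  finally have "\<bar>partial_deriv i (S t \<phi>) x\<bar> \<le> (1 + c0) * e powr (\<sigma> - 1) * M"
    using 1 by (simp add: algebra_simps)
  also have "e powr (\<sigma> - 1) = t powr (- (1 - \<sigma>) / \<alpha>)"
    by (simp add: e_def powr_powr)
  finally show ?thesis .
qed

text \<open>Hoelder continuity improves the derivative taken first, in one half of the time; the
  remaining ones cost the full rate in the other half. For \<open>\<sigma> = 0\<close> the Hoelder
  premise is void and this is the plain bound. As \<open>\<sigma> \<le> 1 \<le> n\<close>, the power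
  of \<open>t\<close> is at least 1, which settles the empty word.\<close>

lemma S_iter_deriv_holder_bound:
  assumes n: "n \<ge> 1"
  shows "\<exists>C\<ge>0. \<forall>t \<phi> M \<kappa> x. 0 < t \<longrightarrow> t \<le> Ts \<longrightarrow> bounded_meas M \<phi> \<longrightarrow> length \<kappa> \<le> n \<longrightarrow>
     0 \<le> \<sigma> \<longrightarrow> \<sigma> \<le> 1 \<longrightarrow> (0 < \<sigma> \<longrightarrow> (\<forall>x h. \<bar>\<phi> (x + h) - \<phi> x\<bar> \<le> M * norm h powr \<sigma>)) \<longrightarrow>
     \<bar>iter_deriv \<kappa> (S t \<phi>) x\<bar> \<le> C * t powr (- (real n - \<sigma>) / \<alpha>) * M"
proof -
  obtain m where m: "n = Suc m" using n by (cases n) auto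
  obtain C where C: "C \<ge> 0" "\<And>t \<phi> M \<kappa> x. 0 < t \<Longrightarrow> t \<le> Ts \<Longrightarrow> bounded_meas M \<phi> \<Longrightarrow> length \<kappa> \<le> m \<Longrightarrow>
     \<bar>iter_deriv \<kappa> (S t \<phi>) x\<bar> \<le> C * t powr (- real m / \<alpha>) * M" using S_iter_deriv_bound[of m] by blast
  obtain Cn where Cn: "Cn \<ge> 0" "\<And>t \<phi> M \<kappa> x. 0 < t \<Longrightarrow> t \<le> Ts \<Longrightarrow> bounded_meas M \<phi> \<Longrightarrow> length \<kappa> \<le> n \<Longrightarrow>
     \<bar>iter_deriv \<kappa> (S t \<phi>) x\<bar> \<le> Cn * t powr (- real n / \<alpha>) * M" using S_iter_deriv_bound[of n] by blast
  define q where "q = (real n - \<sigma>) / \<alpha>"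
  define C' where "C' = max 1 (max Cn (C * (1 + c0) * (1/2) powr (- q)))"
  show ?thesis
  proof (intro exI[of _ C'] conjI allI impI)
    show "C' \<ge> 0" by (simp add: C'_def)
    fix t M :: real and \<phi> :: "real^'d \<Rightarrow> real" and \<kappa> :: "'d list" and x assume t: "0 < t" "t \<le> Ts" and \<phi>: "bounded_meas M \<phi>" and \<kappa>: "length \<kappa> \<le> n"
      and \<sigma>: "0 \<le> \<sigma>" "\<sigma> \<le> 1" and hol: "0 < \<sigma> \<longrightarrow> (\<forall>x h. \<bar>\<phi> (x + h) - \<phi> x\<bar> \<le> M * norm h powr \<sigma>)"
    have M: "M \<ge> 0" by (rule bounded_meas_nonneg[OF \<phi>])
    have h: "0 < t/2" "t/2 \<le> Ts" using t by auto
    have "\<bar>iter_deriv \<kappa> (S t \<phi>) x\<bar> \<le> C' * t powr (- q) * M"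
    proof (cases "\<sigma> = 0")
      case True
      have "\<bar>iter_deriv \<kappa> (S t \<phi>) x\<bar> \<le> Cn * t powr (- q) * M"
        using Cn(2)[OF t \<phi> \<kappa>, of x] True by (simp add: q_def)
      also have "\<dots> \<le> C' * t powr (- q) * M"
        using M by (intro mult_right_mono) (auto simp: C'_def)
      finally show ?thesis .
    next
      case False
      then have \<sigma>0: "0 < \<sigma>" using \<sigma> by simp
      show ?thesis
      proof (cases \<kappa> rule: rev_cases)
        case Nil
        have "q \<ge> 0" using n \<sigma> alpha by (simp add: q_def)
        then have "1 \<le> t powr (- q)"
          using t Ts by (intro one_le_powr_nonpos) auto
        then have "1 * 1 \<le> C' * t powr (- q)"
          by (intro mult_mono) (auto simp: C'_def)
        then have "1 * M \<le> C' * t powr (- q) * M"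
          using M by (intro mult_right_mono) auto
        then show ?thesis using S_bound[OF t(1) \<phi>, of x] Nil by simp
      next
        case (snoc \<kappa>' i)
        have hb: "\<bar>partial_deriv i (S (t/2) \<phi>) x\<bar> \<le> (1 + c0) * (t/2) powr (- (1 - \<sigma>) / \<alpha>) * M" for x
          using hol \<sigma>0 by (intro S_partial_holder_bound[OF h \<sigma>0 \<sigma>(2) \<phi>]) auto
        have bm: "bounded_meas ((1 + c0) * (t/2) powr (- (1 - \<sigma>) / \<alpha>) * M) (partial_deriv i (S (t/2) \<phi>))"
          by (intro bounded_measI_continuous cont_diff_1_partial_continuous S_cont_diff_1[OF h \<phi>] hb)
        from snoc have "iter_deriv \<kappa> (S t \<phi>) x = iter_deriv \<kappa>' (S (t/2) (partial_deriv i (S (t/2) \<phi>))) x"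
          by (simp add: iter_deriv_append S_partial_half[OF t \<phi>])
        also have "\<bar>\<dots>\<bar> \<le> C * (t/2) powr (- real m / \<alpha>) * ((1 + c0) * (t/2) powr (- (1 - \<sigma>) / \<alpha>) * M)"
          using \<kappa> snoc m by (intro C(2)[OF h bm]) simp
        also have "\<dots> = C * (1 + c0) * ((t/2) powr (- real m / \<alpha>) * (t/2) powr (- (1 - \<sigma>) / \<alpha>)) * M"
          by (simp add: mult_ac)
        also have "(t/2) powr (- real m / \<alpha>) * (t/2) powr (- (1 - \<sigma>) / \<alpha>) = (t * (1/2)) powr (- q)"
          unfolding powr_add[symmetric] by (simp add: q_def m add_divide_distrib diff_divide_distrib algebra_simps)
        also have "C * (1 + c0) * (t * (1/2)) powr (- q) * M = (C * (1 + c0) * (1/2) powr (- q)) * t powr (- q) * M"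
          using t by (subst powr_mult) (auto simp: mult_ac)
        also have "\<dots> \<le> C' * t powr (- q) * M"
          using M by (intro mult_right_mono) (auto simp: C'_def)
        finally show ?thesis .
      qed
    qed
    then show "\<bar>iter_deriv \<kappa> (S t \<phi>) x\<bar> \<le> C' * t powr (- (real n - \<sigma>) / \<alpha>) * M"
      by (simp only: q_def minus_divide_left)
  qed
qed

end

section \<open>Duhamel integrals\<close>

text \<open>The majorant enters through its nonnegative integral, so that one inequality yields both
  integrability and the bound, which is convenient for singular powers of time.\<close>

lemma set_integral_abs_bound_nn:
  fixes f b :: "real \<Rightarrow> real"
  assumes A: "A \<in> sets borel" and f: "set_borel_measurable lborel A f" and b: "\<And>s. s \<in> A \<Longrightarrow> \<bar>f s\<bar> \<le> b s"
    and B: "(\<integral>\<^sup>+s\<in>A. ennreal (b s) \<partial>lborel) \<le> ennreal B" "B \<ge> 0"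
  shows "set_integrable lborel A f" and "\<bar>LBINT s:A. f s\<bar> \<le> B"
proof -
  have "(\<integral>\<^sup>+s. ennreal (norm (indicator A s *\<^sub>R f s)) \<partial>lborel) \<le> (\<integral>\<^sup>+s\<in>A. ennreal (b s) \<partial>lborel)"
    using b by (intro nn_integral_mono) (auto simp: indicator_def intro!: ennreal_leI)
  then have le: "(\<integral>\<^sup>+s. ennreal (norm (indicator A s *\<^sub>R f s)) \<partial>lborel) \<le> ennreal B"
    using B(1) by (rule order_trans)
  show i: "set_integrable lborel A f"
    using f le unfolding set_integrable_def set_borel_measurable_def
    by (intro integrableI_bounded) (auto intro: le_less_trans)
  have "ennreal (norm (LBINT s:A. f s)) \<le> ennreal B"
    using integral_norm_bound_ennreal[OF i[unfolded set_integrable_def]] le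
    unfolding set_lebesgue_integral_def by (rule order_trans)
  then show "\<bar>LBINT s:A. f s\<bar> \<le> B"
    using B(2) by (simp add: ennreal_le_iff)
qed

text \<open>Differentiation under the integral for the measure restricted to \<open>A\<close>, read
  back as set integrals; the bound \<open>B\<close> on the majorant then bounds all derivatives at
  once.\<close>

lemma set_integral_cont_diff:
  fixes g :: "real \<Rightarrow> real^'d \<Rightarrow> real"
  assumes A: "A \<in> sets borel" and g: "\<And>s. s \<in> A \<Longrightarrow> cont_diff (Suc n) (g s)"
    and meas: "\<And>x. set_borel_measurable lborel A (\<lambda>s. g s x)"
    and b: "b \<in> borel_measurable borel"
    and bound: "\<And>s \<kappa> x. s \<in> A \<Longrightarrow> length \<kappa> \<le> Suc n \<Longrightarrow> \<bar>iter_deriv \<kappa> (g s) x\<bar> \<le> b s"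
    and B: "(\<integral>\<^sup>+s\<in>A. ennreal (b s) \<partial>lborel) \<le> ennreal B" "B \<ge> 0"
  shows "cont_diff (Suc n) (\<lambda>x. LBINT s:A. g s x)"
    and "length \<kappa> \<le> Suc n \<Longrightarrow> set_integrable lborel A (\<lambda>s. iter_deriv \<kappa> (g s) x)"
    and "length \<kappa> \<le> Suc n \<Longrightarrow>
      iter_deriv \<kappa> (\<lambda>x. LBINT s:A. g s x) x = (LBINT s:A. iter_deriv \<kappa> (g s) x)"
    and "length \<kappa> \<le> Suc n \<Longrightarrow> \<bar>iter_deriv \<kappa> (\<lambda>x. LBINT s:A. g s x) x\<bar> \<le> B"
proof -
  let ?M = "restrict_space lborel A"
  have sp: "A \<inter> space lborel \<in> sets lborel" using A by simp
  have int: "integrable ?M f \<longleftrightarrow> set_integrable lborel A f" for f :: "real \<Rightarrow> real"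
    unfolding integrable_restrict_space[OF sp] set_integrable_def ..
  have lint: "integral\<^sup>L ?M f = (LBINT s:A. f s)" for f :: "real \<Rightarrow> real"
    unfolding integral_restrict_space[OF sp] set_lebesgue_integral_def ..
  have spM: "space ?M = A" by (simp add: space_restrict_space)
  have b0: "b s \<ge> 0" if "s \<in> A" for s
    using order_trans[OF abs_ge_zero bound[OF that, of "[]"]] by simp
  have bi: "integrable ?M b"
    unfolding int using A b b0 B
    by (intro set_integral_abs_bound_nn(1)[where b=b and B=B]) (auto simp: set_borel_measurable_def)
  have gi: "integrable ?M (\<lambda>s. g s x)" for x
    unfolding int by (rule set_integral_abs_bound_nn(1)[OF A meas _ B]) (use bound[of _ "[]"] in auto)
  have g': "cont_diff (Suc n) (g s)" if "s \<in> space ?M" for s using g that spM by simp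
  have bound': "\<bar>iter_deriv \<kappa> (g s) x\<bar> \<le> b s" if "s \<in> space ?M" "length \<kappa> \<le> Suc n" for s \<kappa> x
    using bound that spM by simp
  note I = integral_parameter_cont_diff[where M="?M" and g=g and b=b, OF g' gi bi bound', unfolded lint int]
  show "cont_diff (Suc n) (\<lambda>x. LBINT s:A. g s x)" by (rule I(1))
  show 2: "length \<kappa> \<le> Suc n \<Longrightarrow> set_integrable lborel A (\<lambda>s. iter_deriv \<kappa> (g s) x)"
    by (rule I(2))
  show 3: "length \<kappa> \<le> Suc n \<Longrightarrow>
      iter_deriv \<kappa> (\<lambda>x. LBINT s:A. g s x) x = (LBINT s:A. iter_deriv \<kappa> (g s) x)"
    by (rule I(3))
  show "length \<kappa> \<le> Suc n \<Longrightarrow> \<bar>iter_deriv \<kappa> (\<lambda>x. LBINT s:A. g s x) x\<bar> \<le> B"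
  proof -
    assume \<kappa>: "length \<kappa> \<le> Suc n"
    have "set_borel_measurable lborel A (\<lambda>s. iter_deriv \<kappa> (g s) x)"
      using 2[OF \<kappa>] unfolding set_integrable_def set_borel_measurable_def by (rule borel_measurable_integrable)
    from set_integral_abs_bound_nn(2)[OF A this bound[OF _ \<kappa>] B] show ?thesis
      unfolding 3[OF \<kappa>] .
  qed
qed

section \<open>Integrals of powers of time\<close>

lemma nn_integral_powr_near:
  fixes e c :: real
  assumes "e < 1" "c \<ge> 0"
  shows "(\<integral>\<^sup>+x\<in>{0..c}. ennreal (x powr (- e)) \<partial>lborel) = ennreal (c powr (1 - e) / (1 - e))"
  using nn_integral_has_integral_lebesgue'[OF _ has_integral_powr_from_0[of "- e" c]] assms by simp

lemma nn_integral_powr_far: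
  fixes e a :: real
  assumes "e > 1" "a > 0"
  shows "(\<integral>\<^sup>+x\<in>{a..}. ennreal (x powr (- e)) \<partial>lborel) = ennreal (a powr (1 - e) / (e - 1))"
proof -
  have "(\<integral>\<^sup>+x\<in>{a..}. ennreal (x powr (- e)) \<partial>lborel) = ennreal (- (a powr (- e + 1)) / (- e + 1))"
    using assms by (intro nn_integral_has_integral_lebesgue' has_integral_powr_to_inf) auto
  also have "- (a powr (- e + 1)) / (- e + 1) = a powr (1 - e) / (e - 1)"
    using assms by (simp add: field_simps)
  finally show ?thesis .
qed

lemma nn_integral_time_reflect:
  fixes f :: "real \<Rightarrow> ennreal"
  assumes "f \<in> borel_measurable borel"
  shows "(\<integral>\<^sup>+s. f (t - s) \<partial>lborel) = (\<integral>\<^sup>+s. f s \<partial>lborel)"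
  using nn_integral_real_affine[OF assms, of "-1" t] by simp

lemma nn_integral_time_powr:
  fixes e :: real
  assumes "e < 1" "a \<le> t"
  shows "(\<integral>\<^sup>+s\<in>{a<..<t}. ennreal ((t - s) powr (- e)) \<partial>lborel) \<le> ennreal ((t - a) powr (1 - e) / (1 - e))"
proof -
  have "(\<integral>\<^sup>+s\<in>{a<..<t}. ennreal ((t - s) powr (- e)) \<partial>lborel)
      \<le> (\<integral>\<^sup>+s. ennreal ((t - s) powr (- e)) * indicator {0..t - a} (t - s) \<partial>lborel)"
    by (intro nn_integral_mono) (auto simp: indicator_def)
  also have "\<dots> = (\<integral>\<^sup>+s\<in>{0..t - a}. ennreal (s powr (- e)) \<partial>lborel)"
    by (rule nn_integral_time_reflect) simp
  also have "\<dots> = ennreal ((t - a) powr (1 - e) / (1 - e))"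
    using assms by (intro nn_integral_powr_near) auto
  finally show ?thesis .
qed

lemma length_le_1_cases: "length \<kappa> \<le> Suc 0 \<Longrightarrow> \<kappa> = [] \<or> (\<exists>i. \<kappa> = [i])"
  by (cases \<kappa>) auto

lemma iter_deriv_zero: "iter_deriv \<kappa> (\<lambda>_::real^'d. 0) = (\<lambda>_. 0)"
  by (induction \<kappa>) (auto simp: partial_deriv_def)

context heat_semigroup
begin

lemma S_C1_time_continuous:
  assumes \<delta>: "\<delta> > 0" "\<delta> \<le> Ts" and e: "e > 0"
  obtains h0 where "h0 > 0"
    "\<And>t t' \<phi> M x i. \<delta> \<le> t \<Longrightarrow> t \<le> Ts \<Longrightarrow> \<delta> \<le> t' \<Longrightarrow> t' \<le> Ts \<Longrightarrow> \<bar>t - t'\<bar> \<le> h0 \<Longrightarrow> bounded_meas M \<phi> \<Longrightarrow>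
       \<bar>S t \<phi> x - S t' \<phi> x\<bar> \<le> e * M \<and> \<bar>partial_deriv i (S t \<phi>) x - partial_deriv i (S t' \<phi>) x\<bar> \<le> e * M"
proof -
  obtain h1 where h1: "h1 > 0"
    "\<And>t h \<phi> M x. \<delta> \<le> t \<Longrightarrow> 0 \<le> h \<Longrightarrow> h \<le> h1 \<Longrightarrow> t + h \<le> Ts \<Longrightarrow> bounded_meas M \<phi> \<Longrightarrow> \<bar>S (t + h) \<phi> x - S t \<phi> x\<bar> \<le> e * M"
    using S_time_continuous[OF \<delta> e] by blast
  obtain h2 where h2: "h2 > 0"
    "\<And>t h \<phi> M x i. \<delta> \<le> t \<Longrightarrow> 0 \<le> h \<Longrightarrow> h \<le> h2 \<Longrightarrow> t + h \<le> Ts \<Longrightarrow> bounded_meas M \<phi> \<Longrightarrow>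
       \<bar>partial_deriv i (S (t + h) \<phi>) x - partial_deriv i (S t \<phi>) x\<bar> \<le> e * M"
    using S_partial_time_continuous[OF \<delta> e] by blast
  have main: "\<bar>S t' \<phi> x - S t \<phi> x\<bar> \<le> e * M \<and> \<bar>partial_deriv i (S t' \<phi>) x - partial_deriv i (S t \<phi>) x\<bar> \<le> e * M"
    if "\<delta> \<le> t" "t \<le> t'" "t' \<le> Ts" "t' - t \<le> min h1 h2" "bounded_meas M \<phi>" for t t' \<phi> M x i
    using h1(2)[of t "t' - t" M \<phi> x] h2(2)[of t "t' - t" M \<phi> i x] that by simp
  show ?thesis
  proof
    show "min h1 h2 > 0" using h1 h2 by simp
    fix t t' M :: real and \<phi> :: "real^'d \<Rightarrow> real" and x i
    assume t: "\<delta> \<le> t" "t \<le> Ts" "\<delta> \<le> t'" "t' \<le> Ts" "\<bar>t - t'\<bar> \<le> min h1 h2" and \<phi>: "bounded_meas M \<phi>"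
    show "\<bar>S t \<phi> x - S t' \<phi> x\<bar> \<le> e * M \<and> \<bar>partial_deriv i (S t \<phi>) x - partial_deriv i (S t' \<phi>) x\<bar> \<le> e * M"
    proof (cases "t \<le> t'")
      case True
      then show ?thesis using main[of t t' M \<phi> x i] t \<phi> by (simp add: abs_minus_commute)
    next
      case False
      then show ?thesis using main[of t' t M \<phi> x i] t \<phi> by simp
    qed
  qed
qed

text \<open>Continuity in time is asked at each point \<open>y\<close> separately and for positive
  times; together with the uniform bound this is what dominated convergence under the semigroup
  uses.\<close>

definition source :: "real \<Rightarrow> real \<Rightarrow> (real \<Rightarrow> real^'d \<Rightarrow> real) \<Rightarrow> bool" where
  "source T M f \<longleftrightarrow> (\<forall>s\<in>{0<..T}. bounded_meas M (f s)) \<and> (\<forall>y. continuous_on {0<..T} (\<lambda>s. f s y))"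

definition duhamel :: "(real \<Rightarrow> real^'d \<Rightarrow> real) \<Rightarrow> real \<Rightarrow> real^'d \<Rightarrow> real" where
  "duhamel f t x = (LBINT s:{0<..<t}. S (t - s) (f s) x)"

lemma sourceD: "source T M f \<Longrightarrow> 0 < s \<Longrightarrow> s \<le> T \<Longrightarrow> bounded_meas M (f s)"
  by (auto simp: source_def)

lemma source_nonneg: "source T M f \<Longrightarrow> 0 < T \<Longrightarrow> 0 \<le> M"
  using sourceD[of T M f T] bounded_meas_nonneg by auto

lemma source_diff:
  assumes "source T M f" "source T M' f'"
  shows "source T (M + M') (\<lambda>s y. f s y - f' s y)"
  unfolding source_def
proof (intro conjI ballI allI)
  show "bounded_meas (M + M') (\<lambda>y. f s y - f' s y)" if "s \<in> {0<..T}" for s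
  proof -
    have bm: "bounded_meas M (f s)" "bounded_meas M' (f' s)"
      using sourceD[OF assms(1), of s] sourceD[OF assms(2), of s] that by auto
    show ?thesis
      by (rule bounded_meas_diff[OF bm order_trans[OF abs_triangle_ineq4
            add_mono[OF bm[THEN bounded_meas_bound]]]])
  qed
  show "continuous_on {0<..T} (\<lambda>s. f s y - f' s y)" for y
    using assms by (intro continuous_intros) (auto simp: source_def)
qed

text \<open>Measurability comes from continuity in \<open>s\<close>. As kernel time and source vary
  together, the increment is split: \<open>S (t - u n) - S (t - s)\<close> acting on
  \<open>f (u n)\<close> is small uniformly over bounded functions, while \<open>S (t - s)\<close>
  acting on \<open>f (u n) - f s\<close> tends to 0 by dominated convergence.\<close>

lemma S_source_measurable:
  assumes f: "source T M0 f" and t: "0 < t" "t \<le> T" "T \<le> Ts"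
  shows "set_borel_measurable lborel {0<..<t} (\<lambda>s. S (t - s) (f s) x)"
proof -
  have M0: "M0 \<ge> 0" using source_nonneg[OF f] t by simp
  have "continuous_on {0<..<t} (\<lambda>s. S (t - s) (f s) x)"
    unfolding continuous_on_sequentially
  proof (intro allI ballI impI, elim conjE)
    fix u s assume s: "s \<in> {0<..<t}" and u: "\<forall>n. u n \<in> {0<..<t}" "u \<longlonglongrightarrow> s"
    have ub: "bounded_meas M0 (f (u n))" for n
      using u(1)[rule_format, of n] t by (intro sourceD[OF f]) auto
    have sb: "bounded_meas M0 (f s)"
      using s t by (intro sourceD[OF f]) auto
    have ts: "t - s > 0" using s by simp
    have A: "(\<lambda>n. S (t - s) (f (u n)) x) \<longlonglongrightarrow> S (t - s) (f s) x"
      unfolding semigroup_op_def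
    proof (rule integral_dominated_convergence)
      show "integrable lebesgue (\<lambda>y. p (t - s) (x - y) * M0)"
        using S_integrable[OF ts, of M0 "\<lambda>_. M0" x] M0 by (simp add: bounded_meas_def)
      show "(\<lambda>y. p (t - s) (x - y) * f s y) \<in> borel_measurable lebesgue"
        by (rule borel_measurable_integrable[OF S_integrable[OF ts sb]])
      show "(\<lambda>y. p (t - s) (x - y) * f (u n) y) \<in> borel_measurable lebesgue" for n
        by (rule borel_measurable_integrable[OF S_integrable[OF ts ub]])
      show "AE y in lebesgue. norm (p (t - s) (x - y) * f (u n) y) \<le> p (t - s) (x - y) * M0" for n
        using bounded_meas_bound[OF ub] p_nonneg[OF ts]
        by (intro AE_I2) (auto simp: abs_mult intro!: mult_left_mono)
      show "AE y in lebesgue. (\<lambda>n. p (t - s) (x - y) * f (u n) y) \<longlonglongrightarrow> p (t - s) (x - y) * f s y"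
      proof (rule AE_I2, rule tendsto_mult_left)
        fix y
        have "continuous_on {0<..T} (\<lambda>s. f s y)" using f by (simp add: source_def)
        then show "(\<lambda>n. f (u n) y) \<longlonglongrightarrow> f s y"
        proof -
          have "\<forall>n. u n \<in> {0<..T}" "s \<in> {0<..T}"
            using u(1) s t by (auto intro: order_trans[OF less_imp_le])
          then show ?thesis
            using \<open>continuous_on {0<..T} (\<lambda>s. f s y)\<close> u(2)
            unfolding continuous_on_sequentially o_def by blast
        qed
      qed
    qed
    have "(\<lambda>n. S (t - u n) (f (u n)) x - S (t - s) (f (u n)) x) \<longlonglongrightarrow> 0"
    proof (rule LIMSEQ_I)
      fix e :: real assume e: "e > 0"
      \<comment> \<open>Keeps \<open>t - s\<close> and eventually \<open>t - u n\<close> above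
        \<delta>, where continuity in time is uniform.\<close>
      define \<delta> where "\<delta> = (t - s) / 2"
      have \<delta>: "\<delta> > 0" "\<delta> \<le> Ts" using ts t s by (auto simp: \<delta>_def)
      have e': "e / (M0 + 1) > 0" using e M0 by simp
      obtain h0 where h0: "h0 > 0"
        "\<And>t t' \<phi> M x i. \<delta> \<le> t \<Longrightarrow> t \<le> Ts \<Longrightarrow> \<delta> \<le> t' \<Longrightarrow> t' \<le> Ts \<Longrightarrow> \<bar>t - t'\<bar> \<le> h0 \<Longrightarrow> bounded_meas M \<phi> \<Longrightarrow>
          \<bar>S t \<phi> x - S t' \<phi> x\<bar> \<le> e / (M0 + 1) * M \<and> \<bar>partial_deriv i (S t \<phi>) x - partial_deriv i (S t' \<phi>) x\<bar> \<le> e / (M0 + 1) * M"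
        using S_C1_time_continuous[OF \<delta> e'] by blast
      have "\<forall>\<^sub>F n in sequentially. dist (u n) s < min \<delta> h0"
        using u(2) \<delta>(1) h0(1) by (intro tendstoD) auto
      then obtain n0 where n0: "\<And>n. n \<ge> n0 \<Longrightarrow> dist (u n) s < min \<delta> h0"
        by (auto simp: eventually_sequentially)
      show "\<exists>n0. \<forall>n\<ge>n0. norm (S (t - u n) (f (u n)) x - S (t - s) (f (u n)) x - 0) < e"
      proof (intro exI allI impI)
        fix n assume "n \<ge> n0"
        then have d: "\<bar>u n - s\<bar> < \<delta>" "\<bar>u n - s\<bar> < h0"
          using n0 by (auto simp: dist_real_def)
        have un: "0 < u n" "u n < t" using u(1) by auto
        have "\<bar>S (t - u n) (f (u n)) x - S (t - s) (f (u n)) x\<bar> \<le> e / (M0 + 1) * M0"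
          using d un s t \<delta> by (intro h0(2)[THEN conjunct1] ub) (auto simp: \<delta>_def abs_if split: if_splits)
        also have "\<dots> < e" using e M0 by (simp add: field_simps)
        finally show "norm (S (t - u n) (f (u n)) x - S (t - s) (f (u n)) x - 0) < e" by simp
      qed
    qed
    from tendsto_add[OF this A] show "((\<lambda>s. S (t - s) (f s) x) \<circ> u) \<longlonglongrightarrow> S (t - s) (f s) x"
      by (simp add: o_def)
  qed
  then show ?thesis
    unfolding set_borel_measurable_def
    using borel_measurable_continuous_on_indicator[of "{0<..<t}" "\<lambda>s. S (t - s) (f s) x"] by simp
qed

text \<open>The power of time left after integrating the gradient rate
  \<open>t powr (- 1 / \<alpha>)\<close>. Its positivity expresses \<open>\<alpha> > 1\<close> and
  is what makes contraction over short times possible.\<close>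

definition kap :: real where "kap = 1 - 1 / \<alpha>"

lemma kap_pos: "kap > 0" and kap_eq: "1 - 1 / \<alpha> = kap"
  using alpha by (auto simp: kap_def)

lemma S_C1_bound:
  assumes t: "0 < t" "t \<le> Ts" and \<phi>: "bounded_meas M \<phi>"
  shows "\<bar>S t \<phi> x\<bar> \<le> (1 + c0) * M * t powr (- (1 / \<alpha>))"
    and "\<bar>partial_deriv i (S t \<phi>) x\<bar> \<le> (1 + c0) * M * t powr (- (1 / \<alpha>))"
proof -
  have M: "M \<ge> 0" by (rule bounded_meas_nonneg[OF \<phi>])
  have 1: "1 \<le> t powr (- (1 / \<alpha>))"
    using t Ts alpha by (intro one_le_powr_nonpos) auto
  have "M * 1 \<le> ((1 + c0) * M) * t powr (- (1 / \<alpha>))"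
    using 1 M c0 by (intro mult_mono) (auto simp: algebra_simps)
  then show "\<bar>S t \<phi> x\<bar> \<le> (1 + c0) * M * t powr (- (1 / \<alpha>))"
    using S_bound[OF t(1) \<phi>, of x] by linarith
  have "c0 * t powr (- 1 / \<alpha>) * M \<le> (1 + c0) * M * t powr (- (1 / \<alpha>))"
    using M by (simp add: algebra_simps)
  then show "\<bar>partial_deriv i (S t \<phi>) x\<bar> \<le> (1 + c0) * M * t powr (- (1 / \<alpha>))"
    using S_partial_bound[OF t \<phi>, of i x] by linarith
qed

lemma S_iter_deriv_C1_bound:
  assumes "0 < t" "t \<le> Ts" "bounded_meas M \<phi>" "length \<kappa> \<le> Suc 0"
  shows "\<bar>iter_deriv \<kappa> (S t \<phi>) x\<bar> \<le> (1 + c0) * M * t powr (- (1 / \<alpha>))"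
  using length_le_1_cases[OF assms(4)] S_C1_bound[OF assms(1-3)] by auto

lemma S_zero: "t > 0 \<Longrightarrow> S t (\<lambda>_. 0) = (\<lambda>_. 0)"
  by (simp add: semigroup_op_def fun_eq_iff)

text \<open>A source that vanishes up to time \<open>a\<close> contributes only over the length
  \<open>t - a\<close>, as uniqueness on successive time steps requires; \<open>a = 0\<close> gives
  the general estimate. \<open>M\<close> serves measurability, \<open>M'\<close> measures the source
  on the active interval.\<close>

lemma duhamel_C1:
  assumes f: "source T M f" and t: "0 < t" "t \<le> T" "T \<le> Ts" and a: "0 \<le> a" "a < t" and M': "M' \<ge> 0"
    and f0: "\<And>s. 0 < s \<Longrightarrow> s \<le> a \<Longrightarrow> f s = (\<lambda>_. 0)"
    and f1: "\<And>s y. a < s \<Longrightarrow> s < t \<Longrightarrow> \<bar>f s y\<bar> \<le> M'"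
  shows "set_integrable lborel {0<..<t} (\<lambda>s. S (t - s) (f s) x)"
    and "cont_diff (Suc 0) (duhamel f t)"
    and "\<bar>duhamel f t x\<bar> \<le> (1 + c0) * M' * (t - a) powr kap / kap"
    and "\<bar>partial_deriv i (duhamel f t) x\<bar> \<le> (1 + c0) * M' * (t - a) powr kap / kap"
proof -
  let ?b = "\<lambda>s. (1 + c0) * M' * (indicator {a<..<t} s * (t - s) powr (- (1 / \<alpha>)))"
  let ?B = "(1 + c0) * M' * (t - a) powr kap / kap"
  have bm: "bounded_meas M (f s)" if "s \<in> {0<..<t}" for s
    using that t by (intro sourceD[OF f]) auto
  have cd: "cont_diff (Suc 0) (S (t - s) (f s))" if "s \<in> {0<..<t}" for s
    using that t by (intro S_cont_diff_1[OF _ _ bm[OF that]]) auto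
  have bound: "\<bar>iter_deriv \<kappa> (S (t - s) (f s)) x\<bar> \<le> ?b s" if s: "s \<in> {0<..<t}" and \<kappa>: "length \<kappa> \<le> Suc 0" for s \<kappa> x
  proof (cases "s \<le> a")
    case True
    then show ?thesis using f0[of s] s by (simp add: S_zero iter_deriv_zero)
  next
    case False
    then have "bounded_meas M' (f s)"
      using bm[OF s] f1[of s] s by (auto simp: bounded_meas_def)
    then show ?thesis
      using S_iter_deriv_C1_bound[OF _ _ _ \<kappa>, of "t - s" M' "f s" x] False s t by simp
  qed
  have nn: "(\<integral>\<^sup>+s\<in>{0<..<t}. ennreal (?b s) \<partial>lborel) \<le> ennreal ?B"
  proof -
    have "(\<integral>\<^sup>+s\<in>{0<..<t}. ennreal (?b s) \<partial>lborel) \<le>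
        (\<integral>\<^sup>+s. ennreal ((1 + c0) * M') * (ennreal ((t - s) powr (- (1 / \<alpha>))) * indicator {a<..<t} s) \<partial>lborel)"
      using c0 M' by (intro nn_integral_mono) (auto simp: indicator_def ennreal_mult)
    also have "\<dots> = ennreal ((1 + c0) * M') * (\<integral>\<^sup>+s\<in>{a<..<t}. ennreal ((t - s) powr (- (1 / \<alpha>))) \<partial>lborel)"
      by (rule nn_integral_cmult) measurable
    also have "\<dots> \<le> ennreal ((1 + c0) * M') * ennreal ((t - a) powr (1 - 1 / \<alpha>) / (1 - 1 / \<alpha>))"
      using alpha a by (intro mult_left_mono nn_integral_time_powr) auto
    also have "\<dots> = ennreal ?B"
      using c0 M' kap_pos by (simp add: kap_eq ennreal_mult[symmetric])
    finally show ?thesis .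
  qed
  have B0: "?B \<ge> 0" using c0 M' kap_pos by simp
  have meas: "set_borel_measurable lborel {0<..<t} (\<lambda>s. S (t - s) (f s) x)" for x
    by (rule S_source_measurable[OF f t])
  have b: "?b \<in> borel_measurable borel" by measurable
  have A: "{0<..<t} \<in> sets borel" by simp
  note I = set_integral_cont_diff[OF A cd meas b bound nn B0, folded duhamel_def[abs_def]]
  show "set_integrable lborel {0<..<t} (\<lambda>s. S (t - s) (f s) x)"
    using I(2)[of "[]"] by simp
  show "cont_diff (Suc 0) (duhamel f t)"
    using I(1) by (simp add: duhamel_def[abs_def])
  show "\<bar>duhamel f t x\<bar> \<le> ?B"
    using I(4)[of "[]"] by (simp add: duhamel_def[abs_def])
  show "\<bar>partial_deriv i (duhamel f t) x\<bar> \<le> ?B"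
    using I(4)[of "[i]"] by (simp add: duhamel_def[abs_def])
qed

lemma duhamel_integrable:
  assumes f: "source T M f" and t: "0 < t" "t \<le> T" "T \<le> Ts"
  shows "set_integrable lborel {0<..<t} (\<lambda>s. S (t - s) (f s) x)"
  by (rule duhamel_C1(1)[OF f t order_refl t(1) source_nonneg[OF f]])
    (use t in \<open>auto intro!: bounded_meas_bound sourceD[OF f]\<close>)

lemma duhamel_diff:
  assumes f: "source T M f" "source T M' f'" and t: "0 < t" "t \<le> T" "T \<le> Ts"
  shows "duhamel (\<lambda>s y. f s y - f' s y) t x = duhamel f t x - duhamel f' t x"
proof -
  have "duhamel f t x - duhamel f' t x = (LBINT s:{0<..<t}. S (t - s) (f s) x - S (t - s) (f' s) x)"
    unfolding duhamel_def
    by (rule set_integral_diff(2)[symmetric, OF duhamel_integrable[OF f(1) t] duhamel_integrable[OF f(2) t]])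
  also have "\<dots> = duhamel (\<lambda>s y. f s y - f' s y) t x"
    unfolding duhamel_def
    using t by (intro set_lebesgue_integral_cong) (auto intro!: S_diff[symmetric] sourceD[OF f(1)] sourceD[OF f(2)])
  finally show ?thesis ..
qed

text \<open>For \<open>r < r'\<close> the difference is a single integral of \<open>g\<close> in
  three ranges. For \<open>s\<close> above \<open>r\<close> only the later integrand is present; for
  \<open>s\<close> within \<delta> below \<open>r\<close> both singularities are integrated over a
  short interval; for earlier \<open>s\<close> the kernel times exceed \<delta> and uniform
  continuity in time applies. The majorant \<open>b\<close> serves the function and its first
  derivatives alike.\<close>

lemma duhamel_time_continuous:
  assumes f: "source T M f" and T: "0 < T" "T \<le> Ts" and e: "e > 0"
  obtains h0 where "h0 > 0" "\<And>r r' x i. 0 < r \<Longrightarrow> r < r' \<Longrightarrow> r' \<le> T \<Longrightarrow> r' - r \<le> h0 \<Longrightarrow>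
      \<bar>duhamel f r' x - duhamel f r x\<bar> \<le> e \<and>
      \<bar>partial_deriv i (duhamel f r') x - partial_deriv i (duhamel f r) x\<bar> \<le> e"
proof -
  have M: "M \<ge> 0" by (rule source_nonneg[OF f T(1)])
  \<comment> \<open>The factor 3 counts two kernels just below \<open>r\<close> and one above it;
    the summand 1 keeps \<open>K\<close> positive if \<open>M = 0\<close>. The choice of \<delta>
    below makes \<open>K * \<delta> powr kap\<close> at most \<open>e / 2\<close>.\<close>
  define K where "K = 3 * ((1 + c0) * M) / kap + 1"
  have K: "K > 0" using c0 M kap_pos by (simp add: K_def add_nonneg_pos)
  define \<delta> where "\<delta> = min Ts ((e / (2 * K)) powr (1 / kap))"
  have \<delta>: "\<delta> > 0" "\<delta> \<le> Ts" using Ts e K by (auto simp: \<delta>_def)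
  have K\<delta>: "K * \<delta> powr kap \<le> e / 2"
  proof -
    have "\<delta> powr kap \<le> ((e / (2 * K)) powr (1 / kap)) powr kap"
      using \<delta> kap_pos by (intro powr_mono2) (auto simp: \<delta>_def)
    also have "\<dots> = e / (2 * K)" using kap_pos e K by (simp add: powr_powr)
    finally show ?thesis using K by (simp add: field_simps)
  qed
  have e': "e / (2 * (M + 1)) > 0" using e M by simp
  obtain h1 where h1: "h1 > 0"
    "\<And>t t' \<phi> M' x i. \<delta> \<le> t \<Longrightarrow> t \<le> Ts \<Longrightarrow> \<delta> \<le> t' \<Longrightarrow> t' \<le> Ts \<Longrightarrow> \<bar>t - t'\<bar> \<le> h1 \<Longrightarrow> bounded_meas M' \<phi> \<Longrightarrow>
      \<bar>S t \<phi> x - S t' \<phi> x\<bar> \<le> e / (2 * (M + 1)) * M' \<and>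
      \<bar>partial_deriv i (S t \<phi>) x - partial_deriv i (S t' \<phi>) x\<bar> \<le> e / (2 * (M + 1)) * M'"
    using S_C1_time_continuous[OF \<delta> e'] by blast
  define h0 where "h0 = min h1 \<delta>"
  have main: "\<bar>iter_deriv \<kappa> (\<lambda>x. duhamel f r' x - duhamel f r x) x\<bar> \<le> e"
    if r: "0 < r" "r < r'" "r' \<le> T" "r' - r \<le> h0" and \<kappa>: "length \<kappa> \<le> Suc 0" for r r' x \<kappa>
  proof -
    let ?A = "{0<..<r'}"
    define g where "g s = (\<lambda>x. S (r' - s) (f s) x - (if s < r then S (r - s) (f s) x else 0))" for s
    let ?w = "\<lambda>t s. (t - s) powr (- (1 / \<alpha>))"
    define b where "b s = e / 2 + (2 * ((1 + c0) * M) * (indicator {max 0 (r - \<delta>)<..<r} s * ?w r s) + (1 + c0) * M * (indicator {r..<r'} s * ?w r' s))" for s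
    define c where "c = (1 + c0) * M"
    have cM: "(1 + c0) * M \<ge> 0" "c \<ge> 0" using c0 M by (simp_all add: c_def)
    have bm: "bounded_meas M (f s)" if "s \<in> ?A" for s
      using that r by (intro sourceD[OF f]) auto
    have cd: "cont_diff (Suc 0) (g s)" if "s \<in> ?A" for s
      unfolding g_def using that r T bm[OF that] by (cases "s < r")
        (auto intro!: cont_diff_diff S_cont_diff_1[of _ M] cont_diff_const)
    have meas: "set_borel_measurable lborel ?A (\<lambda>s. g s x)" for x
    proof -
      have "set_borel_measurable lborel ?A (\<lambda>s. S (r' - s) (f s) x)"
        using r T by (intro S_source_measurable[OF f]) auto
      moreover have "set_borel_measurable lborel {0<..<r} (\<lambda>s. S (r - s) (f s) x)"
        using r T by (intro S_source_measurable[OF f]) auto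
      moreover have "indicator ?A s *\<^sub>R g s x = indicator ?A s *\<^sub>R S (r' - s) (f s) x - indicator {0<..<r} s *\<^sub>R S (r - s) (f s) x" for s
        using r by (auto simp: g_def indicator_def)
      ultimately show ?thesis
        unfolding set_borel_measurable_def by simp
    qed
    have bmeas: "b \<in> borel_measurable borel"
      unfolding b_def[abs_def] by measurable
    have bound: "\<bar>iter_deriv \<kappa> (g s) x\<bar> \<le> b s" if s: "s \<in> ?A" and \<kappa>: "length \<kappa> \<le> Suc 0" for s \<kappa> x
    proof -
      have r's: "0 < r' - s" "r' - s \<le> Ts" using s r T by auto
      note B' = S_iter_deriv_C1_bound[OF r's bm[OF s] \<kappa>, of x]
      consider "s \<ge> r" | "s < r" "r - s < \<delta>" | "s < r" "r - s \<ge> \<delta>" by linarith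
      then show ?thesis
      proof cases
        case 1
        then show ?thesis
          using B' e s by (simp add: g_def b_def)
      next
        case 2
        have rs: "0 < r - s" "r - s \<le> Ts" using 2 s r T by auto
        have g: "g s = (\<lambda>x. S (r' - s) (f s) x - S (r - s) (f s) x)" using 2 by (simp add: g_def)
        have "iter_deriv \<kappa> (g s) x = iter_deriv \<kappa> (S (r' - s) (f s)) x - iter_deriv \<kappa> (S (r - s) (f s)) x"
          unfolding g by (subst iter_deriv_minus_fun[OF S_cont_diff_1[OF r's bm[OF s]] S_cont_diff_1[OF rs bm[OF s]] \<kappa>]) simp
        \<comment> \<open>The later kernel is the less singular one, so both are charged to
          \<open>r - s\<close>.\<close>
        moreover have "(1 + c0) * M * ?w r' s \<le> (1 + c0) * M * ?w r s"
          using rs r alpha cM(1) by (intro mult_left_mono powr_mono2') auto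
        ultimately have "\<bar>iter_deriv \<kappa> (g s) x\<bar> \<le> 2 * ((1 + c0) * M) * ?w r s"
          using B' S_iter_deriv_C1_bound[OF rs bm[OF s] \<kappa>, of x] by linarith
        then show ?thesis using 2 s e by (simp add: b_def)
      next
        case 3
        have rs: "0 < r - s" "r - s \<le> Ts" using 3 \<delta> s r T by auto
        have g: "g s = (\<lambda>x. S (r' - s) (f s) x - S (r - s) (f s) x)" using 3 by (simp add: g_def)
        have "\<bar>iter_deriv \<kappa> (g s) x\<bar> = \<bar>iter_deriv \<kappa> (S (r' - s) (f s)) x - iter_deriv \<kappa> (S (r - s) (f s)) x\<bar>"
          unfolding g by (subst iter_deriv_minus_fun[OF S_cont_diff_1[OF r's bm[OF s]] S_cont_diff_1[OF rs bm[OF s]] \<kappa>]) simp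
        also have "\<dots> \<le> e / (2 * (M + 1)) * M"
          using length_le_1_cases[OF \<kappa>]
            h1(2)[of "r' - s" "r - s" M "f s" x] 3 r's rs r bm[OF s] by (auto simp: h0_def)
        also have "\<dots> \<le> e / 2" using e M by (simp add: field_simps)
        also have "\<dots> \<le> b s" using cM by (auto simp: b_def indicator_def)
        finally show ?thesis .
      qed
    qed
    have B: "(\<integral>\<^sup>+s\<in>?A. ennreal (b s) \<partial>lborel) \<le> ennreal e"
    proof -
      let ?I1 = "\<integral>\<^sup>+s\<in>{max 0 (r - \<delta>)<..<r}. ennreal (?w r s) \<partial>lborel"
      let ?I2 = "\<integral>\<^sup>+s\<in>{r..<r'}. ennreal (?w r' s) \<partial>lborel"
      have "(\<integral>\<^sup>+s\<in>?A. ennreal (b s) \<partial>lborel) \<le>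
         (\<integral>\<^sup>+s. ennreal (e / 2) * indicator ?A s + (ennreal (2 * ((1 + c0) * M)) * (ennreal (?w r s) * indicator {max 0 (r - \<delta>)<..<r} s)
           + ennreal ((1 + c0) * M) * (ennreal (?w r' s) * indicator {r..<r'} s)) \<partial>lborel)"
        using cM e unfolding b_def c_def[symmetric]
        by (intro nn_integral_mono) (auto simp: indicator_def ennreal_plus ennreal_mult)
      also have "\<dots> = ennreal (e / 2) * emeasure lborel ?A + (ennreal (2 * ((1 + c0) * M)) * ?I1 + ennreal ((1 + c0) * M) * ?I2)"
      proof -
        let ?F = "\<lambda>s. ennreal (2 * ((1 + c0) * M)) * (ennreal (?w r s) * indicator {max 0 (r - \<delta>)<..<r} s)"
        let ?G = "\<lambda>s. ennreal ((1 + c0) * M) * (ennreal (?w r' s) * indicator {r..<r'} s)"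
        have "(\<integral>\<^sup>+s. ennreal (e / 2) * indicator ?A s + (?F s + ?G s) \<partial>lborel)
            = (\<integral>\<^sup>+s. ennreal (e / 2) * indicator ?A s \<partial>lborel) + (\<integral>\<^sup>+s. ?F s + ?G s \<partial>lborel)"
          by (rule nn_integral_add) measurable
        moreover have "(\<integral>\<^sup>+s. ?F s + ?G s \<partial>lborel) = (\<integral>\<^sup>+s. ?F s \<partial>lborel) + (\<integral>\<^sup>+s. ?G s \<partial>lborel)"
          by (rule nn_integral_add) measurable
        moreover have "(\<integral>\<^sup>+s. ?F s \<partial>lborel) = ennreal (2 * ((1 + c0) * M)) * ?I1"
          by (rule nn_integral_cmult) measurable
        moreover have "(\<integral>\<^sup>+s. ?G s \<partial>lborel) = ennreal ((1 + c0) * M) * ?I2"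
          by (rule nn_integral_cmult) measurable
        moreover have "(\<integral>\<^sup>+s. ennreal (e / 2) * indicator ?A s \<partial>lborel) = ennreal (e / 2) * emeasure lborel ?A"
          by (rule nn_integral_cmult_indicator) simp
        ultimately show ?thesis by (simp only:)
      qed
      also have "\<dots> \<le> ennreal (e / 2) * ennreal 1 + (ennreal (2 * ((1 + c0) * M)) * ennreal (\<delta> powr kap / kap) + ennreal ((1 + c0) * M) * ennreal (\<delta> powr kap / kap))"
      proof (intro add_mono mult_left_mono)
        \<comment> \<open>The interval has length at most 1 because \<open>Ts\<close> is at most
          1.\<close>
        show "emeasure lborel ?A \<le> ennreal 1" using r T Ts by (auto simp: ennreal_leI)
        have "?I1 \<le> ennreal ((r - max 0 (r - \<delta>)) powr (1 - 1 / \<alpha>) / (1 - 1 / \<alpha>))"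
          using alpha r \<delta> by (intro nn_integral_time_powr) auto
        also have "\<dots> \<le> ennreal (\<delta> powr kap / kap)"
          unfolding kap_eq using kap_pos r \<delta> by (intro ennreal_leI divide_right_mono powr_mono2) auto
        finally show "?I1 \<le> ennreal (\<delta> powr kap / kap)" .
        have "?I2 = (\<integral>\<^sup>+s\<in>{r<..<r'}. ennreal (?w r' s) \<partial>lborel)"
          by (intro nn_integral_cong_AE, rule AE_mp[OF AE_lborel_singleton[of r]]) (auto simp: indicator_def)
        also have "\<dots> \<le> ennreal ((r' - r) powr (1 - 1 / \<alpha>) / (1 - 1 / \<alpha>))"
          using alpha r by (intro nn_integral_time_powr) auto
        also have "\<dots> \<le> ennreal (\<delta> powr kap / kap)"
          unfolding kap_eq using kap_pos r \<delta> by (intro ennreal_leI divide_right_mono powr_mono2) (auto simp: h0_def)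
        finally show "?I2 \<le> ennreal (\<delta> powr kap / kap)" .
      qed auto
      also have "\<dots> = ennreal (e / 2 + (2 * ((1 + c0) * M) * (\<delta> powr kap / kap) + (1 + c0) * M * (\<delta> powr kap / kap)))"
      proof -
        define X where "X = \<delta> powr kap / kap"
        have X: "X \<ge> 0" using kap_pos by (simp add: X_def)
        have "ennreal (e / 2) * ennreal 1 + (ennreal (2 * c) * ennreal X + ennreal c * ennreal X)
            = ennreal (e / 2) + (ennreal (2 * c * X) + ennreal (c * X))"
          using cM(2) X by (simp only: ennreal_1 mult_1_right ennreal_mult[symmetric] mult_nonneg_nonneg zero_le_numeral)
        also have "\<dots> = ennreal (e / 2 + (2 * c * X + c * X))"
          using cM(2) X e by (subst ennreal_plus[symmetric], simp, simp, subst ennreal_plus[symmetric]) auto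
        finally show ?thesis unfolding c_def X_def .
      qed
      also have "\<dots> \<le> ennreal e"
      proof (rule ennreal_leI)
        have "2 * ((1 + c0) * M) * (\<delta> powr kap / kap) + (1 + c0) * M * (\<delta> powr kap / kap) \<le> K * \<delta> powr kap"
          by (simp add: K_def algebra_simps add_divide_distrib)
        then show "e / 2 + (2 * ((1 + c0) * M) * (\<delta> powr kap / kap) + (1 + c0) * M * (\<delta> powr kap / kap)) \<le> e"
          using K\<delta> by linarith
      qed
      finally show ?thesis .
    qed
    have A: "?A \<in> sets borel" by simp
    have "duhamel f r' x - duhamel f r x = (LBINT s:?A. g s x)" for x
    proof -
      have i1: "set_integrable lborel ?A (\<lambda>s. S (r' - s) (f s) x)"
        using r T by (intro duhamel_integrable[OF f]) auto
      have i2: "set_integrable lborel {0<..<r} (\<lambda>s. S (r - s) (f s) x)"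
        using r T by (intro duhamel_integrable[OF f]) auto
      have "duhamel f r' x - duhamel f r x =
          (\<integral>s. indicator ?A s *\<^sub>R S (r' - s) (f s) x - indicator {0<..<r} s *\<^sub>R S (r - s) (f s) x \<partial>lborel)"
        unfolding duhamel_def set_lebesgue_integral_def
        by (rule Bochner_Integration.integral_diff[symmetric, OF i1[unfolded set_integrable_def] i2[unfolded set_integrable_def]])
      also have "\<dots> = (LBINT s:?A. g s x)"
        unfolding set_lebesgue_integral_def
        using r by (intro Bochner_Integration.integral_cong) (auto simp: g_def indicator_def)
      finally show ?thesis .
    qed
    then show ?thesis
      using set_integral_cont_diff(4)[OF A cd meas bmeas bound B less_imp_le[OF e] \<kappa>] by simp
  qed
  have cdd: "cont_diff (Suc 0) (duhamel f r)" if "0 < r" "r \<le> T" for r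
    by (rule duhamel_C1(2)[OF f that T(2) order_refl that(1) M])
      (use that in \<open>auto intro!: bounded_meas_bound sourceD[OF f]\<close>)
  show ?thesis
  proof
    show "h0 > 0" using h1 \<delta> by (simp add: h0_def)
    fix r r' x i assume r: "0 < r" "r < r'" "r' \<le> T" "r' - r \<le> h0"
    have "partial_deriv i (\<lambda>x. duhamel f r' x - duhamel f r x) x =
        partial_deriv i (duhamel f r') x - partial_deriv i (duhamel f r) x"
      using r cdd by (intro partial_deriv_minus_fun cont_diff_1_differentiable) auto
    then show "\<bar>duhamel f r' x - duhamel f r x\<bar> \<le> e \<and>
      \<bar>partial_deriv i (duhamel f r') x - partial_deriv i (duhamel f r) x\<bar> \<le> e"
      using main[OF r, of "[]" x] main[OF r, of "[i]" x] by simp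
  qed
qed

end

section \<open>Hoelder regularity of Duhamel integrals\<close>

text \<open>As in \<^const>\<open>Cb_norm\<close>, no seminorm is involved for \<open>\<delta> = 0\<close>.\<close>

definition holder_le :: "nat \<Rightarrow> real \<Rightarrow> real \<Rightarrow> (real^'d \<Rightarrow> real) \<Rightarrow> bool" where
  "holder_le n \<delta> B \<phi> \<longleftrightarrow> cont_diff n \<phi> \<and> (\<forall>\<kappa> x. length \<kappa> \<le> n \<longrightarrow> \<bar>iter_deriv \<kappa> \<phi> x\<bar> \<le> B) \<and>
     (\<delta> > 0 \<longrightarrow> (\<forall>\<kappa> x h. length \<kappa> = n \<longrightarrow> \<bar>iter_deriv \<kappa> \<phi> (x + h) - iter_deriv \<kappa> \<phi> x\<bar> \<le> B * norm h powr \<delta>))"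

abbreviation C1_le :: "real \<Rightarrow> (real^'d \<Rightarrow> real) \<Rightarrow> bool" where
  "C1_le \<equiv> holder_le (Suc 0) 0"

lemma holder_leD:
  assumes "holder_le n \<delta> B \<phi>"
  shows "cont_diff n \<phi>" and "length \<kappa> \<le> n \<Longrightarrow> \<bar>iter_deriv \<kappa> \<phi> x\<bar> \<le> B"
    and "\<delta> > 0 \<Longrightarrow> length \<kappa> = n \<Longrightarrow> \<bar>iter_deriv \<kappa> \<phi> (x + h) - iter_deriv \<kappa> \<phi> x\<bar> \<le> B * norm h powr \<delta>"
  using assms by (auto simp: holder_le_def)

lemma holder_le_nonneg: "holder_le n \<delta> B \<phi> \<Longrightarrow> 0 \<le> B"
  using order_trans[OF abs_ge_zero holder_leD(2)[of n \<delta> B \<phi> "[]"]] by simp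

lemma holder_le_mono: "holder_le n \<delta> B \<phi> \<Longrightarrow> B \<le> B' \<Longrightarrow> holder_le n \<delta> B' \<phi>"
  unfolding holder_le_def
  by (intro conjI allI impI) (auto intro: order_trans mult_right_mono[of B B' "_ powr \<delta>", THEN order_trans[rotated]])

lemma holder_le_add:
  assumes "holder_le n \<delta> B \<phi>" "holder_le n \<delta> B' \<phi>'"
  shows "holder_le n \<delta> (B + B') (\<lambda>x. \<phi> x + \<phi>' x)"
  unfolding holder_le_def
proof (intro conjI allI impI)
  note cd = holder_leD(1)[OF assms(1)] holder_leD(1)[OF assms(2)]
  show "cont_diff n (\<lambda>x. \<phi> x + \<phi>' x)" by (rule cont_diff_add[OF cd])
  show "\<bar>iter_deriv \<kappa> (\<lambda>x. \<phi> x + \<phi>' x) x\<bar> \<le> B + B'" if "length \<kappa> \<le> n" for \<kappa> x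
    using holder_leD(2)[OF assms(1) that, of x] holder_leD(2)[OF assms(2) that, of x]
    by (simp add: iter_deriv_add_fun[OF cd that])
  show "\<bar>iter_deriv \<kappa> (\<lambda>x. \<phi> x + \<phi>' x) (x + h) - iter_deriv \<kappa> (\<lambda>x. \<phi> x + \<phi>' x) x\<bar> \<le> (B + B') * norm h powr \<delta>"
    if "\<delta> > 0" "length \<kappa> = n" for \<kappa> x h
    using holder_leD(3)[OF assms(1) that, of x h] holder_leD(3)[OF assms(2) that, of x h] that
    by (simp add: iter_deriv_add_fun[OF cd] algebra_simps)
qed

lemma holder_le_diff:
  assumes "holder_le n \<delta> B \<phi>" "holder_le n \<delta> B' \<phi>'"
  shows "holder_le n \<delta> (B + B') (\<lambda>x. \<phi> x - \<phi>' x)"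
  unfolding holder_le_def
proof (intro conjI allI impI)
  note cd = holder_leD(1)[OF assms(1)] holder_leD(1)[OF assms(2)]
  show "cont_diff n (\<lambda>x. \<phi> x - \<phi>' x)" by (rule cont_diff_diff[OF cd])
  show "\<bar>iter_deriv \<kappa> (\<lambda>x. \<phi> x - \<phi>' x) x\<bar> \<le> B + B'" if "length \<kappa> \<le> n" for \<kappa> x
    using holder_leD(2)[OF assms(1) that, of x] holder_leD(2)[OF assms(2) that, of x]
    by (simp add: iter_deriv_minus_fun[OF cd that])
  show "\<bar>iter_deriv \<kappa> (\<lambda>x. \<phi> x - \<phi>' x) (x + h) - iter_deriv \<kappa> (\<lambda>x. \<phi> x - \<phi>' x) x\<bar> \<le> (B + B') * norm h powr \<delta>"
    if "\<delta> > 0" "length \<kappa> = n" for \<kappa> x h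
    using holder_leD(3)[OF assms(1) that, of x h] holder_leD(3)[OF assms(2) that, of x h] that
    by (simp add: iter_deriv_minus_fun[OF cd] algebra_simps)
qed

lemma holder_le_1I:
  assumes "cont_diff (Suc 0) \<phi>" "\<And>x. \<bar>\<phi> x\<bar> \<le> B" "\<And>i x. \<bar>partial_deriv i \<phi> x\<bar> \<le> B"
  shows "C1_le B \<phi>"
  using assms length_le_1_cases by (fastforce simp: holder_le_def)

lemma holder_le_1D:
  assumes "C1_le B \<phi>"
  shows "cont_diff (Suc 0) \<phi>" "\<bar>\<phi> x\<bar> \<le> B" "\<bar>partial_deriv i \<phi> x\<bar> \<le> B"
  using holder_leD(1)[OF assms] holder_leD(2)[OF assms, of "[]"] holder_leD(2)[OF assms, of "[i]"] by auto

text \<open>Increments of length at most 1 are controlled by the next derivative and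
  \<open>norm h \<le> norm h powr \<delta>\<close>, longer ones by twice the sup bound and
  \<open>1 \<le> norm h powr \<delta>\<close>; the factor \<open>2 * CARD('d)\<close> covers
  both.\<close>

lemma holder_le_Suc_imp:
  fixes \<phi> :: "real^'d \<Rightarrow> real"
  assumes \<delta>: "0 \<le> \<delta>" "\<delta> \<le> 1" and \<phi>: "cont_diff (Suc n) \<phi>" "\<And>\<kappa> x. length \<kappa> \<le> Suc n \<Longrightarrow> \<bar>iter_deriv \<kappa> \<phi> x\<bar> \<le> B"
  shows "holder_le n \<delta> (2 * real CARD('d) * B) \<phi>"
  unfolding holder_le_def
proof (intro conjI allI impI)
  have B: "B \<ge> 0" using order_trans[OF abs_ge_zero \<phi>(2)[of "[]"]] by simp
  have d: "real CARD('d) \<ge> 1" by (simp add: Suc_le_eq)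
  have dB: "B \<le> real CARD('d) * B" using mult_right_mono[OF d B] by simp
  show "cont_diff n \<phi>" using \<phi>(1) by (rule cont_diff_mono) simp
  show "\<bar>iter_deriv \<kappa> \<phi> x\<bar> \<le> 2 * real CARD('d) * B" if "length \<kappa> \<le> n" for \<kappa> x
    using \<phi>(2)[of \<kappa> x] that dB B by simp
  fix \<kappa> :: "'d list" and x h assume \<kappa>: "length \<kappa> = n"
  show "\<bar>iter_deriv \<kappa> \<phi> (x + h) - iter_deriv \<kappa> \<phi> x\<bar> \<le> 2 * real CARD('d) * B * norm h powr \<delta>"
  proof (cases "norm h \<le> 1")
    case True
    have "\<bar>iter_deriv \<kappa> \<phi> (x + h) - iter_deriv \<kappa> \<phi> x\<bar> \<le> real CARD('d) * B * norm h"
    proof (rule lipschitz_of_partial_deriv_bound)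
      show "iter_deriv \<kappa> \<phi> differentiable (at x)" for x
        using cont_diff_iter_deriv_differentiable[OF \<phi>(1)] \<kappa> by simp
      show "\<bar>partial_deriv i (iter_deriv \<kappa> \<phi>) x\<bar> \<le> B" for i x
        using \<phi>(2)[of "i # \<kappa>" x] \<kappa> by simp
    qed
    also have "\<dots> \<le> 2 * real CARD('d) * B * norm h powr \<delta>"
    proof -
      have "norm h \<le> norm h powr \<delta>"
        using powr_mono'[of \<delta> 1 "norm h"] True \<delta> by simp
      then show ?thesis using B d by (intro mult_mono) auto
    qed
    finally show ?thesis .
  next
    case False
    have "\<bar>iter_deriv \<kappa> \<phi> (x + h) - iter_deriv \<kappa> \<phi> x\<bar> \<le> B + B"
      using \<phi>(2)[of \<kappa> "x + h"] \<phi>(2)[of \<kappa> x] \<kappa> by simp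
    also have "\<dots> \<le> 2 * real CARD('d) * B * 1" using dB by simp
    also have "\<dots> \<le> 2 * real CARD('d) * B * norm h powr \<delta>"
      using False \<delta> B by (intro mult_left_mono) (auto intro!: ge_one_powr_ge_zero)
    finally show ?thesis .
  qed
qed

section \<open>Comparison with the norms of the spaces \<open>Cb\<close>\<close>

lemma sup_norm_le_iff: "B \<ge> 0 \<Longrightarrow> sup_norm \<phi> \<le> ennreal B \<longleftrightarrow> (\<forall>x. \<bar>\<phi> x\<bar> \<le> B)"
  by (simp add: sup_norm_def SUP_le_iff ennreal_le_iff)

lemma holder_seminorm_le_iff:
  fixes \<phi> :: "real^'d \<Rightarrow> real"
  assumes "B \<ge> 0" "\<sigma> > 0"
  shows "holder_seminorm \<sigma> \<phi> \<le> ennreal B \<longleftrightarrow> (\<forall>x h. \<bar>\<phi> (x + h) - \<phi> x\<bar> \<le> B * norm h powr \<sigma>)"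
proof -
  have "holder_seminorm \<sigma> \<phi> \<le> ennreal B \<longleftrightarrow> (\<forall>x. \<forall>h\<in>-{0}. \<bar>\<phi> (x + h) - \<phi> x\<bar> / norm h powr \<sigma> \<le> B)"
    using assms by (simp add: holder_seminorm_def SUP_le_iff ennreal_le_iff)
  also have "\<dots> \<longleftrightarrow> (\<forall>x h. \<bar>\<phi> (x + h) - \<phi> x\<bar> \<le> B * norm h powr \<sigma>)"
  proof (intro iffI allI ballI)
    fix x h :: "real^'d" assume L: "\<forall>x. \<forall>h\<in>-{0}. \<bar>\<phi> (x + h) - \<phi> x\<bar> / norm h powr \<sigma> \<le> B"
    show "\<bar>\<phi> (x + h) - \<phi> x\<bar> \<le> B * norm h powr \<sigma>"
    proof (cases "h = 0")
      case False
      then have "\<bar>\<phi> (x + h) - \<phi> x\<bar> / norm h powr \<sigma> \<le> B" using L by simp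
      then show ?thesis using False by (simp add: divide_le_eq)
    qed simp
  next
    fix x h :: "real^'d" assume L: "\<forall>x h. \<bar>\<phi> (x + h) - \<phi> x\<bar> \<le> B * norm h powr \<sigma>" and "h \<in> - {0}"
    then show "\<bar>\<phi> (x + h) - \<phi> x\<bar> / norm h powr \<sigma> \<le> B"
      by (simp add: divide_le_eq)
  qed
  finally show ?thesis .
qed

lemma floor_frac_add:
  assumes "0 \<le> \<delta>" "\<delta> < 1"
  shows "nat \<lfloor>real n + \<delta>\<rfloor> = n" "frac (real n + \<delta>) = \<delta>"
proof -
  have "\<lfloor>real n + \<delta>\<rfloor> = int n" using assms by (simp add: floor_eq_iff)
  then show "nat \<lfloor>real n + \<delta>\<rfloor> = n" "frac (real n + \<delta>) = \<delta>" by (auto simp: frac_def)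
qed

text \<open>Orders 0 to \<open>n\<close> and one seminorm make \<open>n + 2\<close> copies of
  \<open>B\<close>. With \<open>\<delta> < 1\<close>, \<open>n\<close> and \<delta> are the integer
  and the fractional part of the exponent.\<close>

lemma holder_le_imp_Cb:
  assumes \<phi>: "holder_le n \<delta> B \<phi>" and \<delta>: "0 \<le> \<delta>" "\<delta> < 1"
  shows "\<phi> \<in> Cb (real n + \<delta>)" and "Cb_norm (real n + \<delta>) \<phi> \<le> ennreal ((real n + 2) * B)"
proof -
  note ff = floor_frac_add[OF \<delta>, of n]
  have B: "B \<ge> 0" by (rule holder_le_nonneg[OF \<phi>])
  have "(\<Sum>j\<le>n. SUP \<kappa>\<in>{\<kappa>. length \<kappa> = j}. sup_norm (iter_deriv \<kappa> \<phi>)) \<le> (\<Sum>j\<le>n. ennreal B)"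
    using holder_leD(2)[OF \<phi>] by (intro sum_mono SUP_least) (simp add: sup_norm_le_iff[OF B])
  also have "\<dots> = ennreal ((real n + 1) * B)"
    using B by (simp add: ennreal_mult ennreal_of_nat_eq_real_of_nat add.commute)
  finally have 1: "(\<Sum>j\<le>n. SUP \<kappa>\<in>{\<kappa>. length \<kappa> = j}. sup_norm (iter_deriv \<kappa> \<phi>)) \<le> ennreal ((real n + 1) * B)" .
  have 2: "(if \<delta> = 0 then 0 else SUP \<kappa>\<in>{\<kappa>. length \<kappa> = n}. holder_seminorm \<delta> (iter_deriv \<kappa> \<phi>)) \<le> ennreal B"
    using holder_leD(3)[OF \<phi>] \<delta> by (auto intro!: SUP_least simp: holder_seminorm_le_iff[OF B])
  have "Cb_norm (real n + \<delta>) \<phi> \<le> ennreal ((real n + 1) * B) + ennreal B"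
    unfolding Cb_norm_def ff by (rule add_mono[OF 1 2])
  also have "\<dots> = ennreal ((real n + 2) * B)"
    using B by (simp add: algebra_simps flip: ennreal_plus)
  finally show le: "Cb_norm (real n + \<delta>) \<phi> \<le> ennreal ((real n + 2) * B)" .
  show "\<phi> \<in> Cb (real n + \<delta>)"
    unfolding Cb_def mem_Collect_eq ff using holder_leD(1)[OF \<phi>] le by (auto intro: le_less_trans)
qed

lemma holder_le_1_imp_Cb:
  assumes "C1_le B \<phi>"
  shows "\<phi> \<in> Cb 1" and "Cb_norm 1 \<phi> \<le> ennreal (3 * B)"
  using holder_le_imp_Cb[OF assms] by simp_all

lemma Cb_1_imp_holder_le:
  assumes "\<phi> \<in> Cb 1" "Cb_norm 1 \<phi> \<le> ennreal B" "B \<ge> 0"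
  shows "C1_le B \<phi>"
proof -
  have sum: "(\<Sum>j\<le>Suc 0. SUP \<kappa>\<in>{\<kappa>. length \<kappa> = j}. sup_norm (iter_deriv \<kappa> \<phi>)) \<le> ennreal B"
    using assms(2) by (simp add: Cb_norm_def)
  have "\<bar>iter_deriv \<kappa> \<phi> x\<bar> \<le> B" if "length \<kappa> \<le> Suc 0" for \<kappa> x
  proof -
    have "sup_norm (iter_deriv \<kappa> \<phi>) \<le> (SUP \<kappa>'\<in>{\<kappa>'. length \<kappa>' = length \<kappa>}. sup_norm (iter_deriv \<kappa>' \<phi>))"
      by (rule SUP_upper) simp
    also have "\<dots> \<le> (\<Sum>j\<le>Suc 0. SUP \<kappa>\<in>{\<kappa>. length \<kappa> = j}. sup_norm (iter_deriv \<kappa> \<phi>))"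
      using that by (intro member_le_sum) auto
    finally show ?thesis using sum sup_norm_le_iff[OF assms(3)] order_trans by blast
  qed
  then show ?thesis
    using assms(1) by (auto simp: holder_le_def Cb_def)
qed

text \<open>The two functions under the minimum agree at \<open>t - s = r powr \<alpha>\<close>.
  Closer to \<open>t\<close> the first is integrated, with exponent below 1 as
  \<open>\<delta> > 0\<close>; farther away the second, up to infinity, with exponent above 1 as
  \<open>\<delta> < 1\<close>. Both pieces scale like \<open>r powr \<delta>\<close>, with constants
  \<open>\<alpha> / \<delta>\<close> and \<open>\<alpha> / (1 - \<delta>)\<close>.\<close>

lemma nn_integral_min_powr:
  fixes \<alpha> \<delta> r t :: real
  assumes \<alpha>: "\<alpha> > 0" and \<delta>: "0 < \<delta>" "\<delta> < 1" and r: "r > 0"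
  shows "(\<integral>\<^sup>+s\<in>{0<..<t}. ennreal (min ((t - s) powr (- (1 - \<delta> / \<alpha>))) (r * (t - s) powr (- (1 - \<delta> / \<alpha> + 1 / \<alpha>)))) \<partial>lborel)
     \<le> ennreal ((\<alpha> / \<delta> + \<alpha> / (1 - \<delta>)) * r powr \<delta>)"
proof -
  define e where "e = 1 - \<delta> / \<alpha>"
  define e' where "e' = 1 - \<delta> / \<alpha> + 1 / \<alpha>"
  have e: "e < 1" "e' > 1" using \<alpha> \<delta> by (auto simp: e_def e'_def divide_strict_right_mono)
  let ?c = "r powr \<alpha>"
  have c: "?c > 0" using r by simp
  have "(\<integral>\<^sup>+s\<in>{0<..<t}. ennreal (min ((t - s) powr (- e)) (r * (t - s) powr (- e'))) \<partial>lborel)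
     \<le> (\<integral>\<^sup>+s. (ennreal ((t - s) powr (- e)) * indicator {0..?c} (t - s)
        + ennreal r * (ennreal ((t - s) powr (- e')) * indicator {?c..} (t - s))) \<partial>lborel)"
    using r by (intro nn_integral_mono)
      (auto simp: indicator_def min_le_iff_disj ennreal_mult[symmetric] intro!: ennreal_leI add_increasing add_increasing2)
  also have "\<dots> = (\<integral>\<^sup>+s. (ennreal (s powr (- e)) * indicator {0..?c} s
        + ennreal r * (ennreal (s powr (- e')) * indicator {?c..} s)) \<partial>lborel)"
    by (rule nn_integral_time_reflect) measurable
  also have "\<dots> = (\<integral>\<^sup>+s\<in>{0..?c}. ennreal (s powr (- e)) \<partial>lborel)
        + (\<integral>\<^sup>+s. ennreal r * (ennreal (s powr (- e')) * indicator {?c..} s) \<partial>lborel)"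
    by (rule nn_integral_add) measurable
  also have "(\<integral>\<^sup>+s. ennreal r * (ennreal (s powr (- e')) * indicator {?c..} s) \<partial>lborel)
      = ennreal r * (\<integral>\<^sup>+s\<in>{?c..}. ennreal (s powr (- e')) \<partial>lborel)"
    by (rule nn_integral_cmult) measurable
  also have "(\<integral>\<^sup>+s\<in>{0..?c}. ennreal (s powr (- e)) \<partial>lborel) = ennreal (?c powr (1 - e) / (1 - e))"
    using e c by (intro nn_integral_powr_near) auto
  also have "(\<integral>\<^sup>+s\<in>{?c..}. ennreal (s powr (- e')) \<partial>lborel) = ennreal (?c powr (1 - e') / (e' - 1))"
    using e c by (intro nn_integral_powr_far) auto
  also have "ennreal (?c powr (1 - e) / (1 - e)) + ennreal r * ennreal (?c powr (1 - e') / (e' - 1))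
     = ennreal (?c powr (1 - e) / (1 - e) + r * (?c powr (1 - e') / (e' - 1)))"
    using e r by (simp add: ennreal_mult[symmetric])
  also have "?c powr (1 - e) / (1 - e) + r * (?c powr (1 - e') / (e' - 1)) = (\<alpha> / \<delta> + \<alpha> / (1 - \<delta>)) * r powr \<delta>"
  proof -
    have 1: "?c powr (1 - e) = r powr \<delta>" using \<alpha> by (simp add: e_def powr_powr)
    have "?c powr (1 - e') = r powr (\<delta> - 1)" using \<alpha> by (simp add: e'_def powr_powr algebra_simps)
    then have 2: "r * ?c powr (1 - e') = r powr \<delta>" using r by (simp add: powr_diff)
    have 3: "1 - e = \<delta> / \<alpha>" "e' - 1 = (1 - \<delta>) / \<alpha>" by (auto simp: e_def e'_def diff_divide_distrib)
    have "?c powr (1 - e) / (1 - e) + r * (?c powr (1 - e') / (e' - 1)) = r powr \<delta> / (1 - e) + r powr \<delta> / (e' - 1)"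
      by (simp only: times_divide_eq_right 1 2)
    also have "\<dots> = r powr \<delta> / (\<delta> / \<alpha>) + r powr \<delta> / ((1 - \<delta>) / \<alpha>)"
      by (simp only: 3)
    finally show ?thesis by (simp add: algebra_simps)
  qed
  finally show ?thesis by (simp add: e_def e'_def)
qed

context heat_semigroup
begin

text \<open>Away from time 0 all derivatives are bounded, and one derivative more than asked gives
  the Hoelder condition. This handles the part of the solution that stems from the initial
  datum.\<close>

lemma S_holder_le:
  assumes a: "0 < a" and \<delta>: "0 \<le> \<delta>" "\<delta> \<le> 1" and \<phi>: "bounded_meas M \<phi>"
  shows "\<exists>B. \<forall>t. a \<le> t \<longrightarrow> t \<le> Ts \<longrightarrow> holder_le n \<delta> B (S t \<phi>)"
proof -
  obtain C where C: "C \<ge> 0" "\<And>t \<phi> M \<kappa> x. 0 < t \<Longrightarrow> t \<le> Ts \<Longrightarrow> bounded_meas M \<phi> \<Longrightarrow> length \<kappa> \<le> Suc n \<Longrightarrow>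
     \<bar>iter_deriv \<kappa> (S t \<phi>) x\<bar> \<le> C * t powr (- real (Suc n) / \<alpha>) * M" using S_iter_deriv_bound[of "Suc n"] by blast
  show ?thesis
  proof (intro exI allI impI)
    fix t assume t: "a \<le> t" "t \<le> Ts"
    have t0: "0 < t" using a t by simp
    show "holder_le n \<delta> (2 * real CARD('d) * (C * a powr (- real (Suc n) / \<alpha>) * M)) (S t \<phi>)"
    proof (rule holder_le_Suc_imp[OF \<delta> S_cont_diff[OF t0 t(2) \<phi>]])
      fix \<kappa> :: "'d list" and x assume \<kappa>: "length \<kappa> \<le> Suc n"
      have "\<bar>iter_deriv \<kappa> (S t \<phi>) x\<bar> \<le> C * t powr (- real (Suc n) / \<alpha>) * M"
        by (rule C(2)[OF t0 t(2) \<phi> \<kappa>])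
      also have "\<dots> \<le> C * a powr (- real (Suc n) / \<alpha>) * M"
        using a t alpha C(1) bounded_meas_nonneg[OF \<phi>]
        by (intro mult_right_mono mult_left_mono powr_mono2') (auto intro!: divide_nonpos_pos)
      finally show "\<bar>iter_deriv \<kappa> (S t \<phi>) x\<bar> \<le> C * a powr (- real (Suc n) / \<alpha>) * M" .
    qed
  qed
qed

text \<open>The source need not be Hoelder continuous up to time \<open>0\<close>: for \<open>s < a\<close> the semigroup acts for a
  time at least \<open>a\<close> and smooths bounded functions.\<close>

lemma duhamel_holder_le:
  assumes f: "source T M f" and T: "0 < T" "T \<le> Ts" and a: "0 < a"
    and \<sigma>: "0 \<le> \<sigma>" "\<sigma> \<le> 1"
    and hol: "\<And>s x h. 0 < \<sigma> \<Longrightarrow> a \<le> s \<Longrightarrow> s \<le> T \<Longrightarrow> \<bar>f s (x + h) - f s x\<bar> \<le> M' * norm h powr \<sigma>"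
    and n: "n \<ge> 1" "real n < \<alpha> + \<sigma>" and \<delta>: "0 \<le> \<delta>" "\<delta> < 1" "real n + \<delta> \<le> \<alpha> + \<sigma>"
  shows "\<exists>B. \<forall>t. 2 * a \<le> t \<longrightarrow> t \<le> T \<longrightarrow> holder_le n \<delta> B (duhamel f t)"
proof -
  obtain m where m: "n = Suc m" using n by (cases n) auto
  define L where "L = max M M'"
  have M: "M \<ge> 0" by (rule source_nonneg[OF f T(1)])
  have L: "L \<ge> 0" "M \<le> L" "M' \<le> L" using M by (auto simp: L_def)
  \<comment> \<open>For \<open>\<delta> > 0\<close> this is the exponent for which \<open>(t - s) powr (- e)\<close> and \<open>norm h * (t - s) powr (- e - 1 / \<alpha>)\<close>
    have integrals of equal order \<open>norm h powr \<delta>\<close> on either side of \<open>t - s = norm h powr \<alpha>\<close>.\<close>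
  define e where "e = (if \<delta> = 0 then (real n - \<sigma>) / \<alpha> else 1 - \<delta> / \<alpha>)"
  have e1: "e < 1" using alpha n \<delta> by (auto simp: e_def)
  \<comment> \<open>At the endpoint \<open>real n + \<delta> = \<alpha> + \<sigma>\<close> this is
    an equality, so nothing is lost there; otherwise enlarging the exponent is harmless because
    \<open>t - s\<close> is at most 1.\<close>
  have e2: "(real n - \<sigma>) / \<alpha> \<le> e"
  proof (cases "\<delta> = 0")
    case False
    have "(real n - \<sigma>) / \<alpha> \<le> (\<alpha> - \<delta>) / \<alpha>"
      using alpha \<delta> by (intro divide_right_mono) auto
    then show ?thesis using False alpha by (simp add: e_def diff_divide_distrib)
  qed (simp add: e_def)
  have "0 \<le> (real n - \<sigma>) / \<alpha>" using n \<sigma> alpha by simp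
  then have e0: "0 \<le> e" using e2 by linarith
  define e' where "e' = e + 1 / \<alpha>"
  have e'0: "0 \<le> e'" using e0 alpha by (simp add: e'_def)
  have e'2: "(real (Suc n) - \<sigma>) / \<alpha> \<le> e'"
    using e2 by (simp add: e'_def add_divide_distrib diff_divide_distrib)
  have neg_e: "- e \<le> - (real n - \<sigma>) / \<alpha>" "- e' \<le> - (real (Suc n) - \<sigma>) / \<alpha>"
    using e2 e'2 by (simp_all only: minus_divide_left[symmetric] neg_le_iff_le)
  obtain C0 where C0: "C0 \<ge> 0" "\<And>t \<phi> M \<kappa> x. 0 < t \<Longrightarrow> t \<le> Ts \<Longrightarrow> bounded_meas M \<phi> \<Longrightarrow> length \<kappa> \<le> Suc n \<Longrightarrow>
     \<bar>iter_deriv \<kappa> (S t \<phi>) x\<bar> \<le> C0 * t powr (- real (Suc n) / \<alpha>) * M" using S_iter_deriv_bound[of "Suc n"] by blast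
  obtain C1 where C1: "C1 \<ge> 0" "\<And>t \<phi> M \<kappa> x. 0 < t \<Longrightarrow> t \<le> Ts \<Longrightarrow> bounded_meas M \<phi> \<Longrightarrow> length \<kappa> \<le> n \<Longrightarrow>
     0 \<le> \<sigma> \<Longrightarrow> \<sigma> \<le> 1 \<Longrightarrow> (0 < \<sigma> \<longrightarrow> (\<forall>x h. \<bar>\<phi> (x + h) - \<phi> x\<bar> \<le> M * norm h powr \<sigma>)) \<Longrightarrow>
     \<bar>iter_deriv \<kappa> (S t \<phi>) x\<bar> \<le> C1 * t powr (- (real n - \<sigma>) / \<alpha>) * M"
    using S_iter_deriv_holder_bound[OF n(1), of \<sigma>] by blast
  obtain C2 where C2: "C2 \<ge> 0" "\<And>t \<phi> M \<kappa> x. 0 < t \<Longrightarrow> t \<le> Ts \<Longrightarrow> bounded_meas M \<phi> \<Longrightarrow> length \<kappa> \<le> Suc n \<Longrightarrow>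
     0 \<le> \<sigma> \<Longrightarrow> \<sigma> \<le> 1 \<Longrightarrow> (0 < \<sigma> \<longrightarrow> (\<forall>x h. \<bar>\<phi> (x + h) - \<phi> x\<bar> \<le> M * norm h powr \<sigma>)) \<Longrightarrow>
     \<bar>iter_deriv \<kappa> (S t \<phi>) x\<bar> \<le> C2 * t powr (- (real (Suc n) - \<sigma>) / \<alpha>) * M"
    using S_iter_deriv_holder_bound[of "Suc n" \<sigma>] by auto
  \<comment> \<open>The first entry bounds sources at times below \<open>a\<close>, smoothed for a
    time at least \<open>a\<close>; the other two are the smoothing constants for \<open>n\<close>
    and \<open>n + 1\<close> derivatives of Hoelder sources.\<close>
  define K where "K = max (C0 * a powr (- real (Suc n) / \<alpha>) * L) (max (C1 * L) (C2 * L))"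
  have K: "K \<ge> 0" "C0 * a powr (- real (Suc n) / \<alpha>) * L \<le> K" "C1 * L \<le> K" "C2 * L \<le> K"
    using C0(1) C1(1) C2(1) L by (auto simp: K_def le_max_iff_disj)
  define d where "d = real CARD('d)"
  have d: "d \<ge> 1" by (simp add: d_def Suc_le_eq)
  define B0 where "B0 = K / (1 - e)"
  define B1 where "B1 = 2 * d * K * (\<alpha> / \<delta> + \<alpha> / (1 - \<delta>))"
  have "holder_le n \<delta> (max B0 B1) (duhamel f t)" if t: "2 * a \<le> t" "t \<le> T" for t
  proof -
    have t0: "0 < t" and tT: "0 < t" "t \<le> T" "T \<le> Ts" using a t T by auto
    let ?A = "{0<..<t}"
    let ?g = "\<lambda>s. S (t - s) (f s)"
    have bm: "bounded_meas M (f s)" if "s \<in> ?A" for s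
      using that t by (intro sourceD[OF f]) auto
    have ts: "0 < t - s" "t - s \<le> Ts" "t - s \<le> 1" if "s \<in> ?A" for s
      using that t T Ts by auto
    have bound0: "\<bar>iter_deriv \<kappa> (?g s) x\<bar> \<le> K" if s: "s \<in> ?A" "s < a" and \<kappa>: "length \<kappa> \<le> Suc n" for s \<kappa> x
    proof -
      have "\<bar>iter_deriv \<kappa> (?g s) x\<bar> \<le> C0 * (t - s) powr (- real (Suc n) / \<alpha>) * M"
        by (rule C0(2)[OF ts(1,2)[OF s(1)] bm[OF s(1)] \<kappa>])
      also have "\<dots> \<le> C0 * a powr (- real (Suc n) / \<alpha>) * L"
        using a t s alpha C0(1) M L
        by (intro mult_mono mult_left_mono powr_mono2') (auto intro!: divide_nonpos_pos)
      finally show ?thesis using K(2) by linarith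
    qed
    have holL: "bounded_meas L (f s) \<and> (0 < \<sigma> \<longrightarrow> (\<forall>x h. \<bar>f s (x + h) - f s x\<bar> \<le> L * norm h powr \<sigma>))"
      if s: "s \<in> ?A" "a \<le> s" for s
    proof (intro conjI impI allI)
      show "bounded_meas L (f s)"
        using bm[OF s(1)] L(2) unfolding bounded_meas_def by (meson order_trans)
      fix x h assume "0 < \<sigma>"
      then have "\<bar>f s (x + h) - f s x\<bar> \<le> M' * norm h powr \<sigma>"
        using hol s t by simp
      also have "\<dots> \<le> L * norm h powr \<sigma>" using L(3) by (rule mult_right_mono) simp
      finally show "\<bar>f s (x + h) - f s x\<bar> \<le> L * norm h powr \<sigma>" .
    qed
    have bound1: "\<bar>iter_deriv \<kappa> (?g s) x\<bar> \<le> K * (t - s) powr (- e)" if s: "s \<in> ?A" and \<kappa>: "length \<kappa> \<le> n" for s \<kappa> x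
    proof (cases "s < a")
      case True
      have "K * 1 \<le> K * (t - s) powr (- e)"
        using ts[OF s] e0 K by (intro mult_left_mono one_le_powr_nonpos) auto
      then show ?thesis using bound0[OF s True, of \<kappa> x] \<kappa> by simp
    next
      case False
      have "\<bar>iter_deriv \<kappa> (?g s) x\<bar> \<le> C1 * (t - s) powr (- (real n - \<sigma>) / \<alpha>) * L"
        using holL[OF s] False by (intro C1(2)[OF ts(1,2)[OF s] _ \<kappa> \<sigma>]) auto
      also have "\<dots> \<le> C1 * (t - s) powr (- e) * L"
        using ts[OF s] neg_e C1(1) L by (intro mult_right_mono mult_left_mono powr_mono') auto
      also have "\<dots> \<le> K * (t - s) powr (- e)"
        using mult_right_mono[OF K(3), of "(t - s) powr (- e)"] by (simp add: mult_ac)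
      finally show ?thesis .
    qed
    have bound2: "\<bar>iter_deriv \<kappa> (?g s) x\<bar> \<le> K * (t - s) powr (- e')" if s: "s \<in> ?A" and \<kappa>: "length \<kappa> \<le> Suc n" for s \<kappa> x
    proof (cases "s < a")
      case True
      have "K * 1 \<le> K * (t - s) powr (- e')"
        using ts[OF s] e'0 K by (intro mult_left_mono one_le_powr_nonpos) auto
      then show ?thesis using bound0[OF s True \<kappa>, of x] by simp
    next
      case False
      have "\<bar>iter_deriv \<kappa> (?g s) x\<bar> \<le> C2 * (t - s) powr (- (real (Suc n) - \<sigma>) / \<alpha>) * L"
        using holL[OF s] False by (intro C2(2)[OF ts(1,2)[OF s] _ \<kappa> \<sigma>]) auto
      also have "\<dots> \<le> C2 * (t - s) powr (- e') * L"
        using ts[OF s] neg_e C2(1) L by (intro mult_right_mono mult_left_mono powr_mono') auto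
      also have "\<dots> \<le> K * (t - s) powr (- e')"
        using mult_right_mono[OF K(4), of "(t - s) powr (- e')"] by (simp add: mult_ac)
      finally show ?thesis .
    qed
    have A: "?A \<in> sets borel" by simp
    have cd: "cont_diff (Suc m) (?g s)" if "s \<in> ?A" for s
      by (rule S_cont_diff[OF ts(1,2)[OF that] bm[OF that]])
    have bmeas: "(\<lambda>s. K * (t - s) powr (- e)) \<in> borel_measurable borel" by measurable
    have nn: "(\<integral>\<^sup>+s\<in>?A. ennreal (K * (t - s) powr (- e)) \<partial>lborel) \<le> ennreal B0"
    proof -
      have "(\<integral>\<^sup>+s\<in>?A. ennreal (K * (t - s) powr (- e)) \<partial>lborel) = (\<integral>\<^sup>+s. ennreal K * (ennreal ((t - s) powr (- e)) * indicator ?A s) \<partial>lborel)"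
        using K by (intro nn_integral_cong) (simp add: ennreal_mult mult.assoc)
      also have "\<dots> = ennreal K * (\<integral>\<^sup>+s\<in>?A. ennreal ((t - s) powr (- e)) \<partial>lborel)"
        by (rule nn_integral_cmult) measurable
      also have "\<dots> \<le> ennreal K * ennreal ((t - 0) powr (1 - e) / (1 - e))"
        using e1 t0 by (intro mult_left_mono nn_integral_time_powr) auto
      also have "\<dots> \<le> ennreal K * ennreal (1 / (1 - e))"
        using e1 t0 tT Ts by (intro mult_left_mono ennreal_leI divide_right_mono) (auto intro!: powr_le1)
      also have "\<dots> = ennreal B0" using K e1 by (simp add: B0_def ennreal_mult[symmetric])
      finally show ?thesis .
    qed
    have B0: "B0 \<ge> 0" using K e1 by (simp add: B0_def)
    note prems = A cd S_source_measurable[OF f tT] bmeas bound1[unfolded m] nn B0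
    have I1: "cont_diff n (duhamel f t)"
      unfolding m duhamel_def[abs_def] using prems by (rule set_integral_cont_diff(1))
    have I2: "set_integrable lborel ?A (\<lambda>s. iter_deriv \<kappa> (?g s) x)" if "length \<kappa> \<le> n" for \<kappa> x
      using prems that unfolding m by (rule set_integral_cont_diff(2))
    have I3: "iter_deriv \<kappa> (duhamel f t) x = (LBINT s:?A. iter_deriv \<kappa> (?g s) x)" if "length \<kappa> \<le> n" for \<kappa> x
      using prems that unfolding m duhamel_def[abs_def] by (rule set_integral_cont_diff(3))
    have I4: "\<bar>iter_deriv \<kappa> (duhamel f t) x\<bar> \<le> B0" if "length \<kappa> \<le> n" for \<kappa> x
      using prems that unfolding m duhamel_def[abs_def] by (rule set_integral_cont_diff(4))
    show ?thesis
      unfolding holder_le_def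
    proof (intro conjI allI impI)
      show "cont_diff n (duhamel f t)" by (rule I1)
      show "\<bar>iter_deriv \<kappa> (duhamel f t) x\<bar> \<le> max B0 B1" if "length \<kappa> \<le> n" for \<kappa> x
        using I4[OF that] by (simp add: le_max_iff_disj)
      fix \<kappa> :: "'d list" and x h assume \<delta>0: "0 < \<delta>" and \<kappa>: "length \<kappa> = n"
      have ee: "e = 1 - \<delta> / \<alpha>" "e' = 1 - \<delta> / \<alpha> + 1 / \<alpha>" using \<delta>0 by (auto simp: e_def e'_def)
      show "\<bar>iter_deriv \<kappa> (duhamel f t) (x + h) - iter_deriv \<kappa> (duhamel f t) x\<bar> \<le> max B0 B1 * norm h powr \<delta>"
      proof (cases "h = 0")
        case False
        then have h: "norm h > 0" by simp
        have \<kappa>': "length \<kappa> \<le> n" using \<kappa> by simp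
        let ?D = "\<lambda>s. iter_deriv \<kappa> (?g s) (x + h) - iter_deriv \<kappa> (?g s) x"
        \<comment> \<open>The first term comes from bounding the two values of the derivative of
          order \<open>n\<close> separately, the second from the mean value inequality and order
          \<open>n + 1\<close>.\<close>
        let ?min = "\<lambda>s. min ((t - s) powr (- e)) (norm h * (t - s) powr (- e'))"
        have "iter_deriv \<kappa> (duhamel f t) (x + h) - iter_deriv \<kappa> (duhamel f t) x = (LBINT s:?A. ?D s)"
          unfolding I3[OF \<kappa>'] by (rule set_integral_diff(2)[symmetric, OF I2[OF \<kappa>'] I2[OF \<kappa>']])
        also have "\<bar>\<dots>\<bar> \<le> B1 * norm h powr \<delta>"
        proof (rule set_integral_abs_bound_nn(2)[OF A])
          show "set_borel_measurable lborel ?A ?D"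
            using set_integral_diff(1)[OF I2[OF \<kappa>', of "x + h"] I2[OF \<kappa>', of x]]
            unfolding set_integrable_def set_borel_measurable_def by (rule borel_measurable_integrable)
          show "\<bar>?D s\<bar> \<le> 2 * d * K * ?min s" if s: "s \<in> ?A" for s
          proof -
            have "\<bar>?D s\<bar> \<le> 2 * K * (t - s) powr (- e)"
              using bound1[OF s \<kappa>', of "x + h"] bound1[OF s \<kappa>', of x] by simp
            also have "\<dots> \<le> 2 * d * K * (t - s) powr (- e)"
              using d K by (intro mult_right_mono) auto
            finally have 1: "\<bar>?D s\<bar> \<le> 2 * d * K * (t - s) powr (- e)" .
            have "\<bar>?D s\<bar> \<le> d * (K * (t - s) powr (- e')) * norm h"
              unfolding d_def
            proof (rule lipschitz_of_partial_deriv_bound)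
              show "iter_deriv \<kappa> (?g s) differentiable (at x)" for x
                using cont_diff_iter_deriv_differentiable[OF S_cont_diff[OF ts(1,2)[OF s] bm[OF s], of "Suc n"]] \<kappa> by simp
              show "\<bar>partial_deriv i (iter_deriv \<kappa> (?g s)) x\<bar> \<le> K * (t - s) powr (- e')" for i x
                using bound2[OF s, of "i # \<kappa>" x] \<kappa> by simp
            qed
            also have "\<dots> = d * K * (norm h * (t - s) powr (- e'))" by (simp add: mult_ac)
            also have "\<dots> \<le> 2 * d * K * (norm h * (t - s) powr (- e'))"
              using d K by (intro mult_right_mono) auto
            finally have 2: "\<bar>?D s\<bar> \<le> 2 * d * K * (norm h * (t - s) powr (- e'))" .
            show ?thesis using 1 2 by (simp add: min_def)
          qed
          have dK: "2 * d * K \<ge> 0" using d K by simp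
          have "(\<integral>\<^sup>+s\<in>?A. ennreal (2 * d * K * ?min s) \<partial>lborel) = (\<integral>\<^sup>+s. ennreal (2 * d * K) * (ennreal (?min s) * indicator ?A s) \<partial>lborel)"
            using dK by (intro nn_integral_cong) (subst ennreal_mult, auto simp: mult.assoc)
          also have "\<dots> = ennreal (2 * d * K) * (\<integral>\<^sup>+s\<in>?A. ennreal (?min s) \<partial>lborel)"
            by (rule nn_integral_cmult) measurable
          also have "\<dots> \<le> ennreal (2 * d * K) * ennreal ((\<alpha> / \<delta> + \<alpha> / (1 - \<delta>)) * norm h powr \<delta>)"
            unfolding ee using alpha \<delta> \<delta>0 h by (intro mult_left_mono nn_integral_min_powr) auto
          also have "\<dots> = ennreal (B1 * norm h powr \<delta>)"
            using dK alpha \<delta> \<delta>0 by (subst ennreal_mult[symmetric]) (auto simp: B1_def mult_ac)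
          finally show "(\<integral>\<^sup>+s\<in>?A. ennreal (2 * d * K * ?min s) \<partial>lborel) \<le> ennreal (B1 * norm h powr \<delta>)" .
          show "0 \<le> B1 * norm h powr \<delta>"
            using d K alpha \<delta> \<delta>0 by (simp add: B1_def)
        qed
        also have "\<dots> \<le> max B0 B1 * norm h powr \<delta>" by (rule mult_right_mono) auto
        finally show ?thesis .
      qed simp
    qed
  qed
  then show ?thesis by blast
qed

end

section \<open>The space of bounded differentiable functions\<close>

lemma norm_grad_diff_le:
  fixes \<phi> \<psi> :: "real^'d \<Rightarrow> real"
  assumes "\<And>i. \<bar>partial_deriv i \<phi> x - partial_deriv i \<psi> y\<bar> \<le> B"
  shows "norm (grad \<phi> x - grad \<psi> y) \<le> real CARD('d) * B"
proof -
  have "norm (grad \<phi> x - grad \<psi> y) \<le> (\<Sum>i\<in>UNIV. \<bar>(grad \<phi> x - grad \<psi> y) $ i\<bar>)"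
    by (rule norm_le_l1_cart)
  also have "\<dots> \<le> (\<Sum>i\<in>(UNIV::'d set). B)"
    using assms by (intro sum_mono) (simp add: grad_def)
  finally show ?thesis by simp
qed

lemma norm_grad_le:
  fixes \<phi> :: "real^'d \<Rightarrow> real"
  assumes "\<And>i. \<bar>partial_deriv i \<phi> x\<bar> \<le> B"
  shows "norm (grad \<phi> x) \<le> real CARD('d) * B"
proof -
  have "norm (grad \<phi> x) \<le> (\<Sum>i\<in>UNIV. \<bar>grad \<phi> x $ i\<bar>)"
    by (rule norm_le_l1_cart)
  also have "\<dots> \<le> (\<Sum>i\<in>(UNIV::'d set). B)"
    using assms by (intro sum_mono) (simp add: grad_def)
  finally show ?thesis by simp
qed

lemma continuous_on_grad: "cont_diff (Suc 0) \<phi> \<Longrightarrow> continuous_on UNIV (grad \<phi>)"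
  unfolding grad_def[abs_def] by (intro continuous_on_vec_lambda cont_diff_1_partial_continuous)

text \<open>The exponent \<open>1 + \<sigma>\<close> is encoded by \<open>n = 1\<close>,
  \<open>\<delta> = \<sigma>\<close> if \<open>\<sigma> < 1\<close>, and by \<open>n = 2\<close>,
  \<open>\<delta> = 0\<close> if \<open>\<sigma> = 1\<close>. In the second case there is no
  seminorm, and the Lipschitz bound comes from the second derivatives.\<close>

lemma holder_le_1_partial:
  fixes \<phi> :: "real^'d \<Rightarrow> real"
  assumes \<phi>: "holder_le n \<delta> B \<phi>" and \<sigma>: "0 < \<sigma>" "\<sigma> \<le> 1" "real n + \<delta> = 1 + \<sigma>" "0 \<le> \<delta>" "\<delta> < 1"
  shows "\<bar>partial_deriv i \<phi> (x + h) - partial_deriv i \<phi> x\<bar> \<le> real CARD('d) * B * norm h powr \<sigma>"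
proof -
  have B: "B \<ge> 0" by (rule holder_le_nonneg[OF \<phi>])
  have d: "real CARD('d) \<ge> 1" by (simp add: Suc_le_eq)
  have "real n > 0" "real n < 3" using \<sigma> by linarith+
  then consider "n = 1" | "n = 2" by linarith
  then show ?thesis
  proof cases
    case 1
    then have \<delta>: "\<delta> = \<sigma>" using \<sigma> by simp
    have "\<bar>partial_deriv i \<phi> (x + h) - partial_deriv i \<phi> x\<bar> \<le> 1 * B * norm h powr \<sigma>"
      using holder_leD(3)[OF \<phi>, of "[i]" x h] 1 \<delta> \<sigma> by simp
    also have "\<dots> \<le> real CARD('d) * B * norm h powr \<sigma>"
      using d B by (intro mult_right_mono) auto
    finally show ?thesis .
  next
    case 2
    then have \<sigma>1: "\<sigma> = 1" using \<sigma> by simp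
    have "\<bar>partial_deriv i \<phi> (x + h) - partial_deriv i \<phi> x\<bar> \<le> real CARD('d) * B * norm h"
    proof (rule lipschitz_of_partial_deriv_bound)
      show "partial_deriv i \<phi> differentiable (at x)" for x
        using cont_diff_iter_deriv_differentiable[OF holder_leD(1)[OF \<phi>], of "[i]"] 2 by simp
      show "\<bar>partial_deriv j (partial_deriv i \<phi>) x\<bar> \<le> B" for j x
        using holder_leD(2)[OF \<phi>, of "[j, i]" x] 2 by simp
    qed
    then show ?thesis by (simp add: \<sigma>1)
  qed
qed

text \<open>Functions and partial derivatives are uniformly Cauchy, and the theorem on uniform
  limits identifies the limit of the derivatives. The geometric rate is kept in the limit, so that
  constants do not depend on the time at which this is applied.\<close>

lemma C1_complete:
  fixes w :: "nat \<Rightarrow> real^'d \<Rightarrow> real"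
  assumes w: "\<And>n. cont_diff (Suc 0) (w n)"
    and cauchy: "\<And>k n. k \<le> n \<Longrightarrow> C1_le (c * (1/2) ^ k) (\<lambda>x. w n x - w k x)"
  obtains v where "cont_diff (Suc 0) v" "\<And>k. C1_le (c * (1/2) ^ k) (\<lambda>x. v x - w k x)"
proof -
  have c: "c \<ge> 0" using holder_le_nonneg[OF cauchy[of 0 0]] by simp
  have D: "\<bar>w n x - w k x\<bar> \<le> c * (1/2) ^ k"
    "\<bar>partial_deriv i (w n) x - partial_deriv i (w k) x\<bar> \<le> c * (1/2) ^ k" if "k \<le> n" for n k i x
    using holder_le_1D(2,3)[OF cauchy[OF that]] partial_deriv_minus_fun[OF w[THEN cont_diff_1_differentiable] w[THEN cont_diff_1_differentiable]]
    by simp_all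
  have lim: "\<exists>l. f \<longlonglongrightarrow> l \<and> (\<forall>k. \<bar>l - f k\<bar> \<le> c * (1/2) ^ k)"
    if f: "\<And>k n. k \<le> n \<Longrightarrow> \<bar>f n - f k\<bar> \<le> c * (1/2) ^ k" for f :: "nat \<Rightarrow> real"
  proof -
    have "Cauchy f"
    proof (rule metric_CauchyI)
      fix e :: real assume e: "e > 0"
      have "(\<lambda>k. c * (1/2) ^ k) \<longlonglongrightarrow> c * 0" by (intro tendsto_mult_left LIMSEQ_realpow_zero) auto
      then have "\<forall>\<^sub>F k in sequentially. c * (1/2) ^ k < e / 2" using e by (intro order_tendstoD) auto
      then obtain k where k: "c * (1/2) ^ k < e / 2" using eventually_happens' sequentially_bot by blast
      show "\<exists>M. \<forall>m\<ge>M. \<forall>n\<ge>M. dist (f m) (f n) < e"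
      proof (intro exI[of _ k] allI impI)
        fix m n assume "k \<le> m" "k \<le> n"
        then show "dist (f m) (f n) < e" using f[of k m] f[of k n] k by (simp add: dist_real_def)
      qed
    qed
    then obtain l where l: "f \<longlonglongrightarrow> l" by (auto simp: Cauchy_convergent_iff convergent_def)
    have "\<bar>l - f k\<bar> \<le> c * (1/2) ^ k" for k
    proof (rule tendsto_upperbound)
      show "((\<lambda>n. \<bar>f n - f k\<bar>) \<longlongrightarrow> \<bar>l - f k\<bar>) sequentially" by (intro tendsto_intros l)
      show "\<forall>\<^sub>F n in sequentially. \<bar>f n - f k\<bar> \<le> c * (1/2) ^ k"
        using eventually_ge_at_top[of k] by eventually_elim (rule f)
    qed simp
    with l show ?thesis by blast
  qed
  have "\<forall>x. \<exists>l. (\<lambda>n. w n x) \<longlonglongrightarrow> l \<and> (\<forall>k. \<bar>l - w k x\<bar> \<le> c * (1/2) ^ k)"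
    using lim[of "\<lambda>n. w n _"] D(1) by blast
  then obtain v where v: "\<And>x. (\<lambda>n. w n x) \<longlonglongrightarrow> v x" "\<And>x k. \<bar>v x - w k x\<bar> \<le> c * (1/2) ^ k" by metis
  have "\<forall>i x. \<exists>l. (\<lambda>n. partial_deriv i (w n) x) \<longlonglongrightarrow> l \<and> (\<forall>k. \<bar>l - partial_deriv i (w k) x\<bar> \<le> c * (1/2) ^ k)"
    using lim[of "\<lambda>n. partial_deriv _ (w n) _"] D(2) by blast
  then obtain G where G: "\<And>i x k. \<bar>G i x - partial_deriv i (w k) x\<bar> \<le> c * (1/2) ^ k" by metis
  have unif: "uniform_limit (ball 0 R) (\<lambda>n. partial_deriv i (w n)) (G i) sequentially" for i R
  proof (rule uniform_limitI)
    fix e :: real assume e: "e > 0"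
    have "(\<lambda>k. c * (1/2) ^ k) \<longlonglongrightarrow> c * 0" by (intro tendsto_mult_left LIMSEQ_realpow_zero) auto
    then have "\<forall>\<^sub>F k in sequentially. c * (1/2) ^ k < e" using e by (intro order_tendstoD) auto
    then show "\<forall>\<^sub>F n in sequentially. \<forall>x\<in>ball 0 R. dist (partial_deriv i (w n) x) (G i x) < e"
      by eventually_elim (auto simp: dist_real_def abs_minus_commute intro: le_less_trans[OF G])
  qed
  have cdv: "cont_diff (Suc 0) v" and Pv: "\<And>i x. partial_deriv i v x = G i x"
    by (rule cont_diff_1_uniform_limit(1)[OF w v(1) unif], rule cont_diff_1_uniform_limit(2)[OF w v(1) unif])
  show ?thesis
  proof
    show "cont_diff (Suc 0) v" by (rule cdv)
    fix k
    have "partial_deriv i (\<lambda>x. v x - w k x) x = G i x - partial_deriv i (w k) x" for i x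
      using partial_deriv_minus_fun[OF cdv[THEN cont_diff_1_differentiable] w[THEN cont_diff_1_differentiable]] Pv by simp
    then show "C1_le (c * (1/2) ^ k) (\<lambda>x. v x - w k x)"
      using v(2) G by (intro holder_le_1I cont_diff_diff[OF cdv w]) auto
  qed
qed

text \<open>Continuity into C^1 at positive times, phrased without extended norms;
  \<open>C1_continuous_iff_Cb1\<close> is the link to \<open>continuous_Cb1\<close>.\<close>

definition C1_continuous :: "real \<Rightarrow> (real \<Rightarrow> real^'d \<Rightarrow> real) \<Rightarrow> bool" where
  "C1_continuous T u \<longleftrightarrow> (\<forall>t\<in>{0<..T}. \<forall>e>0. \<exists>d>0. \<forall>s\<in>{0<..T}. \<bar>s - t\<bar> < d \<longrightarrow>
     C1_le e (\<lambda>x. u s x - u t x))"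

definition C1_bounded :: "real \<Rightarrow> real \<Rightarrow> (real \<Rightarrow> real^'d \<Rightarrow> real) \<Rightarrow> bool" where
  "C1_bounded T m u \<longleftrightarrow> (\<forall>t\<in>{0<..T}. C1_le m (u t))"

lemma C1_continuousD:
  assumes "C1_continuous T u" "t \<in> {0<..T}" "e > 0"
  shows "\<exists>d>0. \<forall>s\<in>{0<..T}. \<bar>s - t\<bar> < d \<longrightarrow> C1_le e (\<lambda>x. u s x - u t x)"
  using assms by (simp add: C1_continuous_def)

lemma C1_boundedD: "C1_bounded T m u \<Longrightarrow> 0 < t \<Longrightarrow> t \<le> T \<Longrightarrow> C1_le m (u t)"
  by (simp add: C1_bounded_def)

lemma C1_continuous_add:
  assumes "C1_continuous T u" "C1_continuous T v"
  shows "C1_continuous T (\<lambda>t x. u t x + v t x)"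
  unfolding C1_continuous_def
proof (intro ballI allI impI)
  fix t and e :: real assume t: "t \<in> {0<..T}" and e: "e > 0"
  then have "e / 2 > 0" by simp
  from C1_continuousD[OF assms(1) t this] C1_continuousD[OF assms(2) t this]
  obtain d d' where d: "d > 0" "\<And>s. s \<in> {0<..T} \<Longrightarrow> \<bar>s - t\<bar> < d \<Longrightarrow> C1_le (e/2) (\<lambda>x. u s x - u t x)"
    and d': "d' > 0" "\<And>s. s \<in> {0<..T} \<Longrightarrow> \<bar>s - t\<bar> < d' \<Longrightarrow> C1_le (e/2) (\<lambda>x. v s x - v t x)"
    by blast
  have "C1_le e (\<lambda>x. u s x + v s x - (u t x + v t x))"
    if "s \<in> {0<..T}" "\<bar>s - t\<bar> < min d d'" for s
  proof -
    have "C1_le (e/2 + e/2) (\<lambda>x. (u s x - u t x) + (v s x - v t x))"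
      using that by (intro holder_le_add d(2) d'(2)) auto
    then show ?thesis by (simp add: algebra_simps)
  qed
  then show "\<exists>d>0. \<forall>s\<in>{0<..T}. \<bar>s - t\<bar> < d \<longrightarrow> C1_le e (\<lambda>x. u s x + v s x - (u t x + v t x))"
    using d(1) d'(1) by (intro exI[of _ "min d d'"]) auto
qed

text \<open>A bound \<open>C1_le e\<close> gives norm at most \<open>3 * e\<close>, which explains
  \<open>e / 3\<close>; conversely a norm below \<open>e\<close> gives
  \<open>C1_le e\<close>.\<close>

lemma C1_continuous_iff_Cb1:
  assumes u: "\<And>t. t \<in> {0<..T} \<Longrightarrow> cont_diff (Suc 0) (u t)"
  shows "C1_continuous T u \<longleftrightarrow>
    (\<forall>t\<in>{0<..T}. ((\<lambda>s. Cb_norm 1 (\<lambda>x. u s x - u t x)) \<longlongrightarrow> 0) (at t within {0<..T}))"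
proof (intro iffI ballI)
  fix t assume C: "C1_continuous T u" and t: "t \<in> {0<..T}"
  show "((\<lambda>s. Cb_norm 1 (\<lambda>x. u s x - u t x)) \<longlongrightarrow> 0) (at t within {0<..T})"
  proof (rule order_tendstoI)
    fix a :: ennreal assume "0 < a"
    then obtain e :: real where e: "e > 0" "ennreal e < a"
      by (metis ennreal_0 ennreal_less_zero_iff dense ennreal_cases less_top order_less_trans top.not_eq_extremum)
    obtain d where d: "d > 0" "\<And>s. s \<in> {0<..T} \<Longrightarrow> \<bar>s - t\<bar> < d \<Longrightarrow> C1_le (e/3) (\<lambda>x. u s x - u t x)"
      using C1_continuousD[OF C t, of "e/3"] e(1) by auto
    show "\<forall>\<^sub>F s in at t within {0<..T}. Cb_norm 1 (\<lambda>x. u s x - u t x) < a"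
      unfolding eventually_at
    proof (intro exI[of _ d] conjI ballI impI)
      show "0 < d" by fact
      fix s assume "s \<in> {0<..T}" "s \<noteq> t \<and> dist s t < d"
      then have "Cb_norm 1 (\<lambda>x. u s x - u t x) \<le> ennreal (3 * (e/3))"
        by (intro holder_le_1_imp_Cb d) (auto simp: dist_real_def)
      then show "Cb_norm 1 (\<lambda>x. u s x - u t x) < a" using e by simp
    qed
  qed simp
next
  assume L: "\<forall>t\<in>{0<..T}. ((\<lambda>s. Cb_norm 1 (\<lambda>x. u s x - u t x)) \<longlongrightarrow> 0) (at t within {0<..T})"
  show "C1_continuous T u"
    unfolding C1_continuous_def
  proof (intro ballI allI impI)
    fix t and e :: real assume t: "t \<in> {0<..T}" and e: "e > 0"
    have "\<forall>\<^sub>F s in at t within {0<..T}. Cb_norm 1 (\<lambda>x. u s x - u t x) < ennreal e"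
      using L t e by (intro order_tendstoD) auto
    then obtain d where d: "d > 0" "\<And>s. s \<in> {0<..T} \<Longrightarrow> s \<noteq> t \<Longrightarrow> dist s t < d \<Longrightarrow> Cb_norm 1 (\<lambda>x. u s x - u t x) < ennreal e"
      unfolding eventually_at by blast
    have "C1_le e (\<lambda>x. u s x - u t x)" if s: "s \<in> {0<..T}" "\<bar>s - t\<bar> < d" for s
    proof (cases "s = t")
      case True
      then show ?thesis using e by (intro holder_le_1I) (auto simp: cont_diff_const partial_deriv_def)
    next
      case False
      have le: "Cb_norm 1 (\<lambda>x. u s x - u t x) < ennreal e"
        using d(2)[OF s(1) False] s(2) by (simp add: dist_real_def)
      have "cont_diff (Suc 0) (\<lambda>x. u s x - u t x)" by (intro cont_diff_diff u s t)
      moreover have "Cb_norm 1 (\<lambda>x. u s x - u t x) < \<infinity>"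
        using le by (simp add: less_trans[OF _ ennreal_less_top])
      ultimately have "(\<lambda>x. u s x - u t x) \<in> Cb 1" by (simp add: Cb_def)
      then show ?thesis using le e by (intro Cb_1_imp_holder_le) auto
    qed
    then show "\<exists>d>0. \<forall>s\<in>{0<..T}. \<bar>s - t\<bar> < d \<longrightarrow> C1_le e (\<lambda>x. u s x - u t x)"
      using d(1) by blast
  qed
qed

context heat_semigroup
begin

text \<open>Near a positive \<open>t\<close> all times exceed \<open>t / 2\<close>, where continuity
  in time is uniform.\<close>

lemma C1_continuous_S:
  assumes \<phi>: "bounded_meas M \<phi>" and T: "T \<le> Ts"
  shows "C1_continuous T (\<lambda>t. S t \<phi>)"
  unfolding C1_continuous_def
proof (intro ballI allI impI)
  fix t and e :: real assume t: "t \<in> {0<..T}" and e: "e > 0"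
  have M: "M \<ge> 0" by (rule bounded_meas_nonneg[OF \<phi>])
  have t2: "t / 2 > 0" "t / 2 \<le> Ts" and e': "e / (M + 1) > 0" using t T e M by auto
  obtain h0 where h0: "h0 > 0" "\<And>s s' \<phi> M' x i. t/2 \<le> s \<Longrightarrow> s \<le> Ts \<Longrightarrow> t/2 \<le> s' \<Longrightarrow> s' \<le> Ts \<Longrightarrow> \<bar>s - s'\<bar> \<le> h0 \<Longrightarrow> bounded_meas M' \<phi> \<Longrightarrow>
       \<bar>S s \<phi> x - S s' \<phi> x\<bar> \<le> e / (M + 1) * M' \<and> \<bar>partial_deriv i (S s \<phi>) x - partial_deriv i (S s' \<phi>) x\<bar> \<le> e / (M + 1) * M'"
    using S_C1_time_continuous[OF t2 e'] by blast
  have eM: "e / (M + 1) * M \<le> e" using e M by (simp add: field_simps)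
  show "\<exists>d>0. \<forall>s\<in>{0<..T}. \<bar>s - t\<bar> < d \<longrightarrow> C1_le e (\<lambda>x. S s \<phi> x - S t \<phi> x)"
  proof (intro exI[of _ "min (t/2) h0"] conjI ballI impI)
    show "min (t/2) h0 > 0" using t2 h0 by simp
    fix s assume s: "s \<in> {0<..T}" "\<bar>s - t\<bar> < min (t/2) h0"
    have cd: "cont_diff (Suc 0) (S s \<phi>)" "cont_diff (Suc 0) (S t \<phi>)"
      using s t T by (auto intro!: S_cont_diff_1[OF _ _ \<phi>])
    have b: "\<bar>S s \<phi> x - S t \<phi> x\<bar> \<le> e / (M + 1) * M \<and> \<bar>partial_deriv i (S s \<phi>) x - partial_deriv i (S t \<phi>) x\<bar> \<le> e / (M + 1) * M" for i x
      using s t T by (intro h0(2)[OF _ _ _ _ _ \<phi>]) (auto simp: abs_if split: if_splits)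
    show "C1_le e (\<lambda>x. S s \<phi> x - S t \<phi> x)"
      using b eM by (intro holder_le_1I cont_diff_diff[OF cd])
        (auto simp: partial_deriv_minus_fun[OF cd[THEN cont_diff_1_differentiable]] intro: order_trans)
  qed
qed

lemma duhamel_C1_bounded:
  assumes f: "source T M f" and t: "0 < t" "t \<le> T" "T \<le> Ts"
  shows "C1_le ((1 + c0) * M * T powr kap / kap) (duhamel f t)"
proof -
  have M: "M \<ge> 0" using source_nonneg[OF f] t by simp
  have fb: "\<bar>f s y\<bar> \<le> M" if "0 < s" "s < t" for s y
    using that t by (intro bounded_meas_bound sourceD[OF f]) auto
  note D = duhamel_C1[OF f t order_refl t(1) M _ fb, simplified]
  have "(1 + c0) * M * t powr kap / kap \<le> (1 + c0) * M * T powr kap / kap"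
    using t kap_pos c0 M by (intro divide_right_mono mult_left_mono powr_mono2) auto
  then show ?thesis
    by (intro holder_le_1I D(2) order_trans[OF D(3)] order_trans[OF D(4)])
qed

lemma C1_continuous_duhamel:
  assumes f: "source T M f" and T: "0 < T" "T \<le> Ts"
  shows "C1_continuous T (duhamel f)"
  unfolding C1_continuous_def
proof (intro ballI allI impI)
  fix t and e :: real assume t: "t \<in> {0<..T}" and e: "e > 0"
  obtain h0 where h0: "h0 > 0" "\<And>r r' x i. 0 < r \<Longrightarrow> r < r' \<Longrightarrow> r' \<le> T \<Longrightarrow> r' - r \<le> h0 \<Longrightarrow>
      \<bar>duhamel f r' x - duhamel f r x\<bar> \<le> e \<and>
      \<bar>partial_deriv i (duhamel f r') x - partial_deriv i (duhamel f r) x\<bar> \<le> e"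
    using duhamel_time_continuous[OF f T e] by blast
  show "\<exists>d>0. \<forall>s\<in>{0<..T}. \<bar>s - t\<bar> < d \<longrightarrow> C1_le e (\<lambda>x. duhamel f s x - duhamel f t x)"
  proof (intro exI[of _ h0] conjI ballI impI)
    fix s assume s: "s \<in> {0<..T}" "\<bar>s - t\<bar> < h0"
    have cd: "cont_diff (Suc 0) (duhamel f s)" "cont_diff (Suc 0) (duhamel f t)"
      using s t T holder_le_1D(1)[OF duhamel_C1_bounded[OF f]] by auto
    have b: "\<bar>duhamel f s x - duhamel f t x\<bar> \<le> e \<and> \<bar>partial_deriv i (duhamel f s) x - partial_deriv i (duhamel f t) x\<bar> \<le> e" for i x
    proof (rule linorder_cases[of s t])
      assume "s < t" then show ?thesis
        using h0(2)[of s t x i] s t by (simp add: abs_minus_commute)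
    next
      assume "s = t" then show ?thesis using e by simp
    next
      assume "s > t" then show ?thesis
        using h0(2)[of t s x i] s t by simp
    qed
    then show "C1_le e (\<lambda>x. duhamel f s x - duhamel f t x)"
      by (intro holder_le_1I cont_diff_diff[OF cd])
        (auto simp: partial_deriv_minus_fun[OF cd[THEN cont_diff_1_differentiable]])
  qed (rule h0(1))
qed

text \<open>The semigroup preserves Lipschitz constants, so the gradient stays below
  \<open>L\<close> down to time 0, whereas the smoothing bound would blow up. Boundedness of the
  iteration in C^1 rests on this.\<close>

lemma S_lipschitz_C1_bounded:
  assumes t: "0 < t" "t \<le> Ts" and \<phi>: "\<And>x. \<bar>\<phi> x\<bar> \<le> B" and lip: "\<And>x h. \<bar>\<phi> (x + h) - \<phi> x\<bar> \<le> L * norm h"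
  shows "C1_le (max B L) (S t \<phi>)" and "bounded_meas B \<phi>"
proof -
  have c: "continuous_on UNIV \<phi>"
    using holder_continuous_on[of \<phi> L 1] lip by simp
  then have bo: "\<phi> \<in> borel_measurable borel" by (rule borel_measurable_continuous_onI)
  show bm: "bounded_meas B \<phi>" using c \<phi> by (rule bounded_measI_continuous)
  have "\<bar>partial_deriv i (S t \<phi>) x\<bar> \<le> L" for i x
    by (rule partial_deriv_le_lipschitz[OF cont_diff_1_differentiable[OF S_cont_diff_1[OF t bm]]
          S_oscillation(1)[OF t(1) bo bm lip]])
  then show "C1_le (max B L) (S t \<phi>)"
    using S_bound[OF t(1) bm] by (intro holder_le_1I S_cont_diff_1[OF t bm]) (auto simp: le_max_iff_disj)
qed

end

section \<open>The fixed point equation\<close>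

text \<open>A quantity depending on \<open>u s\<close> in a Lipschitz way for the C^1 norm is
  continuous in time. It serves for the gradient and for \<open>Q\<close>, both evaluated at a fixed
  point.\<close>

lemma continuous_on_of_C1_continuous:
  fixes g :: "real \<Rightarrow> 'b::metric_space"
  assumes u: "C1_continuous T u" and c: "c \<ge> 0"
    and g: "\<And>s t e. s \<in> {0<..T} \<Longrightarrow> t \<in> {0<..T} \<Longrightarrow> C1_le e (\<lambda>x. u s x - u t x) \<Longrightarrow> dist (g s) (g t) \<le> c * e"
  shows "continuous_on {0<..T} g"
  unfolding continuous_on_iff
proof (intro ballI allI impI)
  fix t and e :: real assume t: "t \<in> {0<..T}" and e: "e > 0"
  have e': "e / (c + 1) > 0" using e c by simp
  obtain r where r: "r > 0" "\<And>s. s \<in> {0<..T} \<Longrightarrow> \<bar>s - t\<bar> < r \<Longrightarrow> C1_le (e / (c + 1)) (\<lambda>x. u s x - u t x)"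
    using C1_continuousD[OF u t e'] by blast
  show "\<exists>r>0. \<forall>s\<in>{0<..T}. dist s t < r \<longrightarrow> dist (g s) (g t) < e"
  proof (intro exI[of _ r] conjI ballI impI)
    fix s assume s: "s \<in> {0<..T}" "dist s t < r"
    then have "dist (g s) (g t) \<le> c * (e / (c + 1))"
      by (intro g t r) (auto simp: dist_real_def)
    also have "\<dots> < e" using e c by (simp add: field_simps)
    finally show "dist (g s) (g t) < e" .
  qed (rule r(1))
qed

locale mild_problem = heat_semigroup p \<psi> \<alpha> c0 Ts
  for p :: "real \<Rightarrow> real^'d \<Rightarrow> real" and \<psi> \<alpha> c0 Ts +
  fixes H :: "real \<Rightarrow> real^'d \<Rightarrow> real^'d \<Rightarrow> real \<Rightarrow> real"
    and Q :: "(real^'d \<Rightarrow> real) \<Rightarrow> real^'d \<Rightarrow> real"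
    and u0 :: "real^'d \<Rightarrow> real" and \<beta> b0 L0 :: real
  assumes beta: "0 \<le> \<beta>" "\<beta> \<le> 1" and alpha_beta: "\<alpha> + \<beta> \<notin> \<nat>"
    and u0_bound: "\<And>x. \<bar>u0 x\<bar> \<le> b0" and u0_lip: "\<And>x h. \<bar>u0 (x + h) - u0 x\<bar> \<le> L0 * norm h"
    and H_cont: "continuous_on ({0..Ts} \<times> UNIV \<times> UNIV \<times> UNIV) (\<lambda>(t, x, p, q). H t x p q)"
    and H_zero: "\<exists>C>0. \<forall>t\<in>{0..Ts}. \<forall>x. \<bar>H t x 0 0\<bar> \<le> C"
    and H_lipschitz: "\<forall>R>0. \<exists>C>0. \<forall>t\<in>{0..Ts}. \<forall>x x'.
        \<forall>p\<in>ball 0 R. \<forall>p'\<in>ball 0 R. \<forall>q\<in>ball 0 R. \<forall>q'\<in>ball 0 R.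
          \<bar>H t x' p' q' - H t x p q\<bar>
            \<le> C * (min (norm (x - x') powr \<beta>) 1 + norm (p - p') + \<bar>q - q'\<bar>)"
    and Q_linear: "linear_on_Cb1 Q"
    and Q_measurable: "\<forall>\<phi>\<in>Cb 1. Q \<phi> \<in> borel_measurable lebesgue"
    and Q_bounded: "\<exists>C>0.
        (\<forall>\<phi>\<in>Cb 1. sup_norm (Q \<phi>) \<le> ennreal C * Cb_norm 1 \<phi>) \<and>
        (\<forall>\<sigma>\<in>{0<..\<beta>}. \<forall>\<phi>\<in>Cb (1 + \<sigma>).
           holder_seminorm \<sigma> (Q \<phi>) \<le> ennreal C * Cb_norm (1 + \<sigma>) \<phi>)"
begin

text \<open>Turns the extended norm bounds into pointwise ones. The exponent
  \<open>1 + \<sigma>\<close> is at most 2, so the passage from \<open>holder_le\<close> to the norm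
  costs at most the factor 4, and one constant covers both claims.\<close>

lemma Q_estimate:
  obtains q where "q \<ge> 0" "\<And>m \<phi> x. C1_le m \<phi> \<Longrightarrow> \<bar>Q \<phi> x\<bar> \<le> q * m"
    "\<And>m \<phi> x h n \<delta> \<sigma>. holder_le n \<delta> m \<phi> \<Longrightarrow> 0 < \<sigma> \<Longrightarrow> \<sigma> \<le> \<beta> \<Longrightarrow> real n + \<delta> = 1 + \<sigma> \<Longrightarrow> 0 \<le> \<delta> \<Longrightarrow> \<delta> < 1 \<Longrightarrow>
       \<bar>Q \<phi> (x + h) - Q \<phi> x\<bar> \<le> q * m * norm h powr \<sigma>"
proof -
  obtain C where C: "C > 0" "\<And>\<phi>. \<phi> \<in> Cb 1 \<Longrightarrow> sup_norm (Q \<phi>) \<le> ennreal C * Cb_norm 1 \<phi>"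
    "\<And>\<sigma> \<phi>. \<sigma> \<in> {0<..\<beta>} \<Longrightarrow> \<phi> \<in> Cb (1 + \<sigma>) \<Longrightarrow> holder_seminorm \<sigma> (Q \<phi>) \<le> ennreal C * Cb_norm (1 + \<sigma>) \<phi>"
    using Q_bounded by blast
  show ?thesis
  proof
    show "4 * C \<ge> 0" using C(1) by simp
    fix m :: real and \<phi> :: "real^'d \<Rightarrow> real" and x assume \<phi>: "C1_le m \<phi>"
    have m: "m \<ge> 0" by (rule holder_le_nonneg[OF \<phi>])
    have "sup_norm (Q \<phi>) \<le> ennreal C * ennreal (3 * m)"
      using C(2)[OF holder_le_1_imp_Cb(1)[OF \<phi>]] mult_left_mono[OF holder_le_1_imp_Cb(2)[OF \<phi>], of "ennreal C"]
      by (meson order_trans zero_le)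
    then have "sup_norm (Q \<phi>) \<le> ennreal (C * (3 * m))"
      using C(1) m by (simp add: ennreal_mult)
    then have "\<bar>Q \<phi> x\<bar> \<le> C * (3 * m)"
      using sup_norm_le_iff[of "C * (3 * m)" "Q \<phi>"] C(1) m by simp
    also have "\<dots> \<le> 4 * C * m" using C(1) m by simp
    finally show "\<bar>Q \<phi> x\<bar> \<le> 4 * C * m" .
  next
    fix m \<delta> \<sigma> :: real and \<phi> :: "real^'d \<Rightarrow> real" and x h and n :: nat
    assume \<phi>: "holder_le n \<delta> m \<phi>" and \<sigma>: "0 < \<sigma>" "\<sigma> \<le> \<beta>" and n: "real n + \<delta> = 1 + \<sigma>" and \<delta>: "0 \<le> \<delta>" "\<delta> < 1"
    have m: "m \<ge> 0" by (rule holder_le_nonneg[OF \<phi>])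
    note Cb = holder_le_imp_Cb[OF \<phi> \<delta>, unfolded n]
    have "real n \<le> 2" using n \<delta> \<sigma> beta by linarith
    then have n4: "(real n + 2) * m \<le> 4 * m" using m by (intro mult_right_mono) auto
    have "holder_seminorm \<sigma> (Q \<phi>) \<le> ennreal C * Cb_norm (1 + \<sigma>) \<phi>"
      using C(3)[OF _ Cb(1)] \<sigma> by simp
    also have "\<dots> \<le> ennreal C * ennreal ((real n + 2) * m)"
      by (intro mult_left_mono Cb(2)) simp
    also have "\<dots> \<le> ennreal C * ennreal (4 * m)"
      by (intro mult_left_mono ennreal_leI n4) simp
    also have "\<dots> = ennreal (4 * C * m)"
      using C(1) m by (simp add: ennreal_mult[symmetric] mult_ac)
    finally show "\<bar>Q \<phi> (x + h) - Q \<phi> x\<bar> \<le> 4 * C * m * norm h powr \<sigma>"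
      using holder_seminorm_le_iff[OF _ \<sigma>(1), of "4 * C * m" "Q \<phi>"] C(1) m by simp
  qed
qed

lemma Q_diff:
  assumes "C1_le m \<phi>" "C1_le m' \<psi>'"
  shows "Q (\<lambda>x. \<phi> x - \<psi>' x) x = Q \<phi> x - Q \<psi>' x"
proof -
  have "Q (\<lambda>y. 1 * \<phi> y + (-1) * \<psi>' y) x = 1 * Q \<phi> x + (-1) * Q \<psi>' x"
    using Q_linear holder_le_1_imp_Cb(1)[OF assms(1)] holder_le_1_imp_Cb(1)[OF assms(2)]
    unfolding linear_on_Cb1_def by blast
  then show ?thesis by simp
qed

section \<open>The nonlinearity along curves in C^1\<close>

definition nonlin :: "(real \<Rightarrow> real^'d \<Rightarrow> real) \<Rightarrow> real \<Rightarrow> real^'d \<Rightarrow> real" where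
  "nonlin u s y = H s y (grad (u s) y) (Q (u s) y)"

text \<open>Closed bounds replace the open balls of the hypothesis, to match the non-strict
  estimates available for gradients and for \<open>Q\<close>. They are obtained from balls of radius
  larger by 1.\<close>

definition H_lip :: "real \<Rightarrow> real \<Rightarrow> bool" where
  "H_lip R C \<longleftrightarrow> C > 0 \<and> (\<forall>t x x' p p' q q'. t \<in> {0..Ts} \<longrightarrow> norm p \<le> R \<longrightarrow> norm p' \<le> R \<longrightarrow> \<bar>q\<bar> \<le> R \<longrightarrow> \<bar>q'\<bar> \<le> R \<longrightarrow>
     \<bar>H t x' p' q' - H t x p q\<bar> \<le> C * (min (norm (x - x') powr \<beta>) 1 + norm (p - p') + \<bar>q - q'\<bar>))"

lemma H_lipD:
  assumes "H_lip R C"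
  shows "C > 0" and "t \<in> {0..Ts} \<Longrightarrow> norm a \<le> R \<Longrightarrow> norm a' \<le> R \<Longrightarrow> \<bar>b\<bar> \<le> R \<Longrightarrow> \<bar>b'\<bar> \<le> R \<Longrightarrow>
       \<bar>H t x' a' b' - H t x a b\<bar> \<le> C * (min (norm (x - x') powr \<beta>) 1 + norm (a - a') + \<bar>b - b'\<bar>)"
  using assms unfolding H_lip_def by blast+

lemma H_local:
  assumes "0 \<le> m"
  shows "\<exists>C. H_lip m C"
proof -
  have m: "m + 1 > 0" using assms by simp
  obtain C where C: "C > 0" "\<forall>t\<in>{0..Ts}. \<forall>x x'.
        \<forall>p\<in>ball 0 (m+1). \<forall>p'\<in>ball 0 (m+1). \<forall>q\<in>ball 0 (m+1). \<forall>q'\<in>ball 0 (m+1).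
          \<bar>H t x' p' q' - H t x p q\<bar> \<le> C * (min (norm (x - x') powr \<beta>) 1 + norm (p - p') + \<bar>q - q'\<bar>)"
    using H_lipschitz m by blast
  show ?thesis
    unfolding H_lip_def using C by (intro exI[of _ C]) auto
qed

text \<open>\<open>K\<close> is uniform in \<open>s\<close>, \<open>u\<close> and \<open>v\<close>
  and tied to the common bound \<open>m\<close> alone; contraction times therefore depend only on
  \<open>m\<close>.\<close>

definition nonlin_lip :: "real \<Rightarrow> real \<Rightarrow> bool" where
  "nonlin_lip m K \<longleftrightarrow> K \<ge> 0 \<and> (\<forall>s u v \<delta> y. s \<in> {0..Ts} \<longrightarrow> C1_le m (u s) \<longrightarrow>
     C1_le m (v s) \<longrightarrow> C1_le \<delta> (\<lambda>x. u s x - v s x) \<longrightarrow>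
     \<bar>nonlin u s y - nonlin v s y\<bar> \<le> K * \<delta>)"

lemma nonlin_lipD:
  assumes "nonlin_lip m K"
  shows "K \<ge> 0" and "s \<in> {0..Ts} \<Longrightarrow> C1_le m (u s) \<Longrightarrow> C1_le m (v s) \<Longrightarrow>
       C1_le \<delta> (\<lambda>x. u s x - v s x) \<Longrightarrow> \<bar>nonlin u s y - nonlin v s y\<bar> \<le> K * \<delta>"
  using assms unfolding nonlin_lip_def by blast+

lemma nonlin_lipschitz:
  assumes m: "m \<ge> 0"
  shows "\<exists>K. nonlin_lip m K"
proof -
  obtain q where q: "q \<ge> 0" "\<And>m \<phi> x. C1_le m \<phi> \<Longrightarrow> \<bar>Q \<phi> x\<bar> \<le> q * m"
    using Q_estimate by metis
  define R where "R = max (real CARD('d) * m) (q * m)"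
  have R: "R \<ge> 0" "real CARD('d) * m \<le> R" "q * m \<le> R" using m by (auto simp: R_def le_max_iff_disj)
  obtain C where "H_lip R C" using H_local[OF R(1)] ..
  note C = H_lipD[OF this]
  show ?thesis
    unfolding nonlin_lip_def
  proof (intro exI[of _ "C * (real CARD('d) + q)"] conjI allI impI)
    show "C * (real CARD('d) + q) \<ge> 0" using C(1) q(1) by simp
    fix s \<delta> :: real and u v :: "real \<Rightarrow> real^'d \<Rightarrow> real" and y
    assume s: "s \<in> {0..Ts}" and u: "C1_le m (u s)" and v: "C1_le m (v s)"
      and uv: "C1_le \<delta> (\<lambda>x. u s x - v s x)"
    have g: "norm (grad (u s) y) \<le> R" "norm (grad (v s) y) \<le> R"
      using norm_grad_le[OF holder_le_1D(3)[OF u]] norm_grad_le[OF holder_le_1D(3)[OF v]] R(2) by (meson order_trans)+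
    have Qb: "\<bar>Q (u s) y\<bar> \<le> R" "\<bar>Q (v s) y\<bar> \<le> R"
      using q(2)[OF u] q(2)[OF v] R(3) by (meson order_trans)+
    have gd: "norm (grad (v s) y - grad (u s) y) \<le> real CARD('d) * \<delta>"
    proof (rule norm_grad_diff_le)
      fix i
      have "partial_deriv i (\<lambda>x. u s x - v s x) y = partial_deriv i (u s) y - partial_deriv i (v s) y"
        by (intro partial_deriv_minus_fun cont_diff_1_differentiable holder_le_1D(1)[OF u] holder_le_1D(1)[OF v])
      then show "\<bar>partial_deriv i (v s) y - partial_deriv i (u s) y\<bar> \<le> \<delta>"
        using holder_le_1D(3)[OF uv, of i y] by (simp add: abs_minus_commute)
    qed
    have Qd: "\<bar>Q (v s) y - Q (u s) y\<bar> \<le> q * \<delta>"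
      using q(2)[OF uv, of y] Q_diff[OF u v, of y] by (simp add: abs_minus_commute)
    \<comment> \<open>Both values of \<open>H\<close> are taken at the same point, so the spatial
      term is \<open>0 powr \<beta> = 0\<close>, also for \<open>\<beta> = 0\<close>.\<close>
    have "\<bar>nonlin u s y - nonlin v s y\<bar> \<le> C * (min (norm (y - y) powr \<beta>) 1 + norm (grad (v s) y - grad (u s) y) + \<bar>Q (v s) y - Q (u s) y\<bar>)"
      unfolding nonlin_def by (rule C(2)[OF s g(2,1) Qb(2,1)])
    also have "\<dots> \<le> C * (real CARD('d) * \<delta> + q * \<delta>)"
      using gd Qd C(1) by (intro mult_left_mono) auto
    finally show "\<bar>nonlin u s y - nonlin v s y\<bar> \<le> C * (real CARD('d) + q) * \<delta>"
      by (simp add: algebra_simps)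
  qed
qed

definition nonlin_bound :: "real \<Rightarrow> real \<Rightarrow> bool" where
  "nonlin_bound m M \<longleftrightarrow> M \<ge> 0 \<and> (\<forall>s u y. s \<in> {0..Ts} \<longrightarrow> C1_le m (u s) \<longrightarrow> \<bar>nonlin u s y\<bar> \<le> M)"

lemma nonlin_boundD:
  assumes "nonlin_bound m M"
  shows "M \<ge> 0" and "s \<in> {0..Ts} \<Longrightarrow> C1_le m (u s) \<Longrightarrow> \<bar>nonlin u s y\<bar> \<le> M"
  using assms unfolding nonlin_bound_def by blast+

text \<open>Compare with the value at vanishing gradient and vanishing \<open>Q\<close>-argument, at
  the same point, which \<open>H_zero\<close> bounds.\<close>

lemma nonlin_bounded:
  assumes m: "m \<ge> 0"
  shows "\<exists>M. nonlin_bound m M"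
proof -
  obtain q where q: "q \<ge> 0" "\<And>m \<phi> x. C1_le m \<phi> \<Longrightarrow> \<bar>Q \<phi> x\<bar> \<le> q * m"
    using Q_estimate by metis
  define R where "R = max (real CARD('d) * m) (q * m)"
  have R: "R \<ge> 0" "real CARD('d) * m \<le> R" "q * m \<le> R" using m by (auto simp: R_def le_max_iff_disj)
  obtain C where "H_lip R C" using H_local[OF R(1)] ..
  note C = H_lipD[OF this]
  obtain C0 where C0: "C0 > 0" "\<And>t x. t \<in> {0..Ts} \<Longrightarrow> \<bar>H t x 0 0\<bar> \<le> C0" using H_zero by blast
  show ?thesis
    unfolding nonlin_bound_def
  proof (intro exI[of _ "C0 + C * (R + R)"] conjI allI impI)
    show "C0 + C * (R + R) \<ge> 0" using C0 C R by simp
    fix s :: real and u :: "real \<Rightarrow> real^'d \<Rightarrow> real" and y assume s: "s \<in> {0..Ts}" and u: "C1_le m (u s)"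
    have g: "norm (grad (u s) y) \<le> R" using norm_grad_le[OF holder_le_1D(3)[OF u]] R(2) by (rule order_trans)
    have Qb: "\<bar>Q (u s) y\<bar> \<le> R" using q(2)[OF u] R(3) by (rule order_trans)
    have "\<bar>nonlin u s y - H s y 0 0\<bar> \<le> C * (min (norm (y - y) powr \<beta>) 1 + norm (0 - grad (u s) y) + \<bar>0 - Q (u s) y\<bar>)"
      unfolding nonlin_def using R by (intro C(2)[OF s _ g _ Qb]) auto
    also have "\<dots> \<le> C * (R + R)"
      using g Qb C(1) by (intro mult_left_mono) auto
    finally show "\<bar>nonlin u s y\<bar> \<le> C0 + C * (R + R)"
      using C0(2)[OF s, of y] by linarith
  qed
qed

text \<open>The Borel map \<open>H s\<close> is applied after a Lebesgue measurable one; in this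
  order the composition is Lebesgue measurable.\<close>

lemma nonlin_measurable:
  assumes s: "s \<in> {0..Ts}" and u: "C1_le m (u s)"
  shows "nonlin u s \<in> borel_measurable lebesgue"
proof -
  have c: "continuous_on UNIV (\<lambda>(x, p, q). H s x p q)"
  proof -
    have "continuous_on UNIV ((\<lambda>(t, x, p, q). H t x p q) \<circ> (\<lambda>z. (s, z)))"
      using s by (intro continuous_on_compose continuous_on_subset[OF H_cont] continuous_intros) auto
    then show ?thesis by (simp add: o_def)
  qed
  have m1: "grad (u s) \<in> borel_measurable lebesgue"
    using continuous_on_grad[OF holder_le_1D(1)[OF u]]
    by (intro measurable_completion) (auto intro: borel_measurable_continuous_onI)
  have m2: "Q (u s) \<in> borel_measurable lebesgue"
    using Q_measurable holder_le_1_imp_Cb(1)[OF u] by blast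
  have m3: "(\<lambda>y. y) \<in> borel_measurable (lebesgue :: (real^'d) measure)"
    by (intro measurable_completion) simp
  have "(\<lambda>y. (y, grad (u s) y, Q (u s) y)) \<in> borel_measurable lebesgue"
    by (intro borel_measurable_Pair m1 m2 m3)
  from measurable_compose[OF this borel_measurable_continuous_onI[OF c]]
  show ?thesis by (simp add: nonlin_def[abs_def])
qed

lemma nonlin_source:
  assumes u: "C1_continuous T u" "C1_bounded T m u" and T: "T \<le> Ts"
    and M: "\<And>s y. s \<in> {0<..T} \<Longrightarrow> \<bar>nonlin u s y\<bar> \<le> M"
  shows "source T M (nonlin u)"
  unfolding source_def
proof (intro conjI ballI allI)
  fix s assume s: "s \<in> {0<..T}"
  then show "bounded_meas M (nonlin u s)"
    unfolding bounded_meas_def using M nonlin_measurable[of s m u] C1_boundedD[OF u(2)] T by auto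
next
  obtain q where q: "q \<ge> 0" "\<And>m \<phi> x. C1_le m \<phi> \<Longrightarrow> \<bar>Q \<phi> x\<bar> \<le> q * m"
    using Q_estimate by metis
  fix y
  have cg: "continuous_on {0<..T} (\<lambda>s. grad (u s) y)"
  proof (rule continuous_on_of_C1_continuous[OF u(1), where c="real CARD('d)"])
    fix s t e assume st: "s \<in> {0<..T}" "t \<in> {0<..T}" and e: "C1_le e (\<lambda>x. u s x - u t x)"
    have cd: "cont_diff (Suc 0) (u s)" "cont_diff (Suc 0) (u t)"
      using st C1_boundedD[OF u(2)] by (auto intro: holder_le_1D(1))
    have "partial_deriv i (\<lambda>x. u s x - u t x) y = partial_deriv i (u s) y - partial_deriv i (u t) y" for i
      by (intro partial_deriv_minus_fun cd[THEN cont_diff_1_differentiable])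
    then have "norm (grad (u s) y - grad (u t) y) \<le> real CARD('d) * e"
      using holder_le_1D(3)[OF e] by (intro norm_grad_diff_le) metis
    then show "dist (grad (u s) y) (grad (u t) y) \<le> real CARD('d) * e" by (simp add: dist_norm)
  qed simp
  have cQ: "continuous_on {0<..T} (\<lambda>s. Q (u s) y)"
  proof (rule continuous_on_of_C1_continuous[OF u(1) q(1)])
    fix s t e assume st: "s \<in> {0<..T}" "t \<in> {0<..T}" and e: "C1_le e (\<lambda>x. u s x - u t x)"
    have b: "C1_le m (u s)" "C1_le m (u t)"
      using st C1_boundedD[OF u(2)] by auto
    show "dist (Q (u s) y) (Q (u t) y) \<le> q * e"
      using q(2)[OF e, of y] Q_diff[OF b, of y] by (simp add: dist_real_def)
  qed
  have "continuous_on {0<..T} ((\<lambda>(t, x, p, q). H t x p q) \<circ> (\<lambda>s. (s, y, grad (u s) y, Q (u s) y)))"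
    using T by (intro continuous_on_compose continuous_on_subset[OF H_cont] continuous_on_Pair continuous_on_id continuous_on_const cg cQ) auto
  then show "continuous_on {0<..T} (\<lambda>s. nonlin u s y)"
    by (simp add: o_def nonlin_def)
qed

section \<open>The fixed point map\<close>

definition picard :: "(real \<Rightarrow> real^'d \<Rightarrow> real) \<Rightarrow> real \<Rightarrow> real^'d \<Rightarrow> real" where
  "picard u t x = S t u0 x + duhamel (nonlin u) t x"

lemma nonlin_source':
  assumes u: "C1_continuous T u" "C1_bounded T m u" and T: "0 < T" "T \<le> Ts"
  obtains M where "source T M (nonlin u)"
proof -
  have m: "m \<ge> 0" using holder_le_nonneg[OF C1_boundedD[OF u(2)]] T by blast
  obtain M where M: "nonlin_bound m M" using nonlin_bounded[OF m] ..
  have "source T M (nonlin u)"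
    using C1_boundedD[OF u(2)] T by (intro nonlin_source[OF u T(2)] nonlin_boundD(2)[OF M]) auto
  then show ?thesis using that by blast
qed

lemma u0_meas: "bounded_meas b0 u0"
  by (rule S_lipschitz_C1_bounded(2)[OF Ts(1) order_refl u0_bound u0_lip])

lemma S_u0_C1: "0 < t \<Longrightarrow> t \<le> Ts \<Longrightarrow> C1_le (max b0 L0) (S t u0)"
  by (rule S_lipschitz_C1_bounded(1)[OF _ _ u0_bound u0_lip])

lemma picard_C1_continuous:
  assumes "source T M (nonlin u)" "0 < T" "T \<le> Ts"
  shows "C1_continuous T (picard u)"
  unfolding picard_def[abs_def]
  by (rule C1_continuous_add[OF C1_continuous_S[OF u0_meas assms(3)] C1_continuous_duhamel[OF assms]])

lemma picard_C1_bounded: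
  assumes "source T M (nonlin u)" "T \<le> Ts"
  shows "C1_bounded T (max b0 L0 + (1 + c0) * M * T powr kap / kap) (picard u)"
  unfolding C1_bounded_def picard_def
  using assms by (auto intro!: holder_le_add S_u0_C1 duhamel_C1_bounded)

text \<open>The initial data cancel, leaving the Duhamel integral of a source that vanishes up to
  time \<open>a\<close> and is at most \<open>K * \<delta>\<close> afterwards. The factor depends on
  \<open>t - a\<close>, so it is small on every short step, not only near time 0.\<close>

lemma picard_diff:
  assumes u: "C1_continuous T u" "C1_bounded T m u" and v: "C1_continuous T v" "C1_bounded T m v"
    and T: "T \<le> Ts" and K: "nonlin_lip m K"
    and a: "0 \<le> a" "a < t" "t \<le> T" and \<delta>: "\<delta> \<ge> 0"
    and eq: "\<And>s. 0 < s \<Longrightarrow> s \<le> a \<Longrightarrow> u s = v s"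
    and near: "\<And>s. a < s \<Longrightarrow> s < t \<Longrightarrow> C1_le \<delta> (\<lambda>x. u s x - v s x)"
  shows "C1_le ((1 + c0) * K * (t - a) powr kap / kap * \<delta>) (\<lambda>x. picard u t x - picard v t x)"
proof -
  have t: "0 < t" "t \<le> T" "T \<le> Ts" and T0: "0 < T" using a T by auto
  obtain M where M: "source T M (nonlin u)" using nonlin_source'[OF u T0 T] .
  obtain M' where M': "source T M' (nonlin v)" using nonlin_source'[OF v T0 T] .
  let ?f = "\<lambda>s y. nonlin u s y - nonlin v s y"
  have f0: "?f s = (\<lambda>_. 0)" if "0 < s" "s \<le> a" for s
    using eq[OF that] by (simp add: nonlin_def)
  have f1: "\<bar>?f s y\<bar> \<le> K * \<delta>" if "a < s" "s < t" for s y
    using that a T by (intro nonlin_lipD(2)[OF K] near C1_boundedD[OF u(2)] C1_boundedD[OF v(2)]) auto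
  have K\<delta>: "K * \<delta> \<ge> 0" using nonlin_lipD(1)[OF K] \<delta> by simp
  note D = duhamel_C1(2-4)[OF source_diff[OF M M'] t a(1,2) K\<delta> f0 f1]
  have "C1_le ((1 + c0) * (K * \<delta>) * (t - a) powr kap / kap) (duhamel ?f t)"
    using D by (intro holder_le_1I) auto
  moreover have "(\<lambda>x. picard u t x - picard v t x) = duhamel ?f t"
    by (simp add: fun_eq_iff picard_def duhamel_diff[OF M M' t])
  ultimately show ?thesis by (simp add: mult_ac)
qed

text \<open>\<open>r\<close> solves \<open>A * r powr kap = e\<close>, capped at \<open>Ts\<close>;
  the summand 1 keeps \<open>A\<close> positive if \<open>K = 0\<close>.\<close>

lemma small_time:
  assumes "K \<ge> 0" "e > 0"
  obtains r where "0 < r" "r \<le> Ts" "\<And>t. 0 \<le> t \<Longrightarrow> t \<le> r \<Longrightarrow> (1 + c0) * K * t powr kap / kap \<le> e"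
proof -
  define A where "A = (1 + c0) * K / kap + 1"
  have A: "A > 0" using assms c0 kap_pos by (simp add: A_def add_nonneg_pos)
  define r where "r = min Ts ((e / A) powr (1 / kap))"
  show ?thesis
  proof
    show "0 < r" "r \<le> Ts" using Ts A assms by (auto simp: r_def)
    fix t assume t: "0 \<le> t" "t \<le> r"
    have "t powr kap \<le> ((e / A) powr (1 / kap)) powr kap"
      using t kap_pos by (intro powr_mono2) (auto simp: r_def)
    also have "\<dots> = e / A" using kap_pos A assms by (simp add: powr_powr)
    finally have "A * t powr kap \<le> e" using A by (simp add: field_simps)
    moreover have "(1 + c0) * K * t powr kap / kap \<le> A * t powr kap"
      by (simp add: A_def algebra_simps add_divide_distrib)
    ultimately show "(1 + c0) * K * t powr kap / kap \<le> e" by linarith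
  qed
qed

text \<open>The step length \<open>r\<close> depends only on the common bound \<open>m\<close>, so
  finitely many steps reach any \<open>T\<close> up to \<open>Ts\<close>. Within a step, once
  agreement up to its start is known, each use of the contraction halves a distance that begins at
  most \<open>2 * m\<close>; repeating this forces it to be 0.\<close>

lemma picard_unique:
  assumes u: "C1_continuous T u" "C1_bounded T m u" and v: "C1_continuous T v" "C1_bounded T m v"
    and T: "0 < T" "T \<le> Ts"
    and fu: "\<And>t. t \<in> {0<..T} \<Longrightarrow> u t = picard u t" and fv: "\<And>t. t \<in> {0<..T} \<Longrightarrow> v t = picard v t"
    and t: "t \<in> {0<..T}"
  shows "u t = v t"
proof -
  have m: "m \<ge> 0" using holder_le_nonneg[OF C1_boundedD[OF u(2)]] T by blast
  obtain K where K: "nonlin_lip m K" using nonlin_lipschitz[OF m] ..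
  obtain r where r: "0 < r" "\<And>t. 0 \<le> t \<Longrightarrow> t \<le> r \<Longrightarrow> (1 + c0) * K * t powr kap / kap \<le> 1/2"
    by (rule small_time[OF nonlin_lipD(1)[OF K], of "1/2"]) auto
  have step: "\<forall>t\<in>{0<..T}. t \<le> real k * r \<longrightarrow> u t = v t" for k
  proof (induction k)
    case 0
    then show ?case by auto
  next
    case (Suc k)
    define a where "a = real k * r"
    have a0: "a \<ge> 0" using r by (simp add: a_def)
    have close: "\<forall>t. a < t \<longrightarrow> t \<le> T \<longrightarrow> t \<le> real (Suc k) * r \<longrightarrow> C1_le (2 * m * (1/2) ^ j) (\<lambda>x. u t x - v t x)" for j
    proof (induction j)
      case 0
      have "C1_le (m + m) (\<lambda>x. u t x - v t x)" if "a < t" "t \<le> T" for t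
        using that a0 by (intro holder_le_diff C1_boundedD[OF u(2)] C1_boundedD[OF v(2)]) auto
      then show ?case by simp
    next
      case (Suc j)
      show ?case
      proof (intro allI impI)
        fix t assume t: "a < t" "t \<le> T" "t \<le> real (Suc k) * r"
        have eq: "u s = v s" if "0 < s" "s \<le> a" for s
          using \<open>\<forall>t\<in>{0<..T}. t \<le> real k * r \<longrightarrow> u t = v t\<close> that t by (simp add: a_def)
        have near: "C1_le (2 * m * (1/2) ^ j) (\<lambda>x. u s x - v s x)" if "a < s" "s < t" for s
          using Suc that t by simp
        have "C1_le ((1 + c0) * K * (t - a) powr kap / kap * (2 * m * (1/2) ^ j)) (\<lambda>x. picard u t x - picard v t x)"
          using m by (intro picard_diff[OF u v T(2) K a0 t(1,2) _ eq near]) auto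
        moreover have "(1 + c0) * K * (t - a) powr kap / kap * (2 * m * (1/2) ^ j) \<le> 1/2 * (2 * m * (1/2) ^ j)"
          using t m by (intro mult_right_mono r(2)) (auto simp: a_def algebra_simps)
        ultimately have "C1_le (1/2 * (2 * m * (1/2) ^ j)) (\<lambda>x. picard u t x - picard v t x)"
          by (rule holder_le_mono)
        moreover have "u t = picard u t" "v t = picard v t" using t a0 by (auto intro!: fu fv)
        ultimately show "C1_le (2 * m * (1/2) ^ Suc j) (\<lambda>x. u t x - v t x)"
          by (simp add: mult_ac)
      qed
    qed
    show ?case
    proof (intro ballI impI)
      fix t assume t: "t \<in> {0<..T}" "t \<le> real (Suc k) * r"
      show "u t = v t"
      proof (cases "t \<le> a")
        case True
        then show ?thesis using Suc t by (simp add: a_def)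
      next
        case False
        show ?thesis
        proof
          fix x
          have "\<bar>u t x - v t x\<bar> \<le> 2 * m * (1/2) ^ j" for j
            using holder_le_1D(2)[of _ "\<lambda>x. u t x - v t x" x] close[of j] False t by auto
          moreover have "(\<lambda>j. 2 * m * (1/2) ^ j) \<longlonglongrightarrow> 2 * m * 0"
            by (intro tendsto_mult_left LIMSEQ_realpow_zero) auto
          ultimately have "\<bar>u t x - v t x\<bar> \<le> 2 * m * 0"
            by (intro tendsto_lowerbound[where F=sequentially]) auto
          then show "u t x = v t x" by simp
        qed
      qed
    qed
  qed
  obtain k where "real k > t / r" using reals_Archimedean2 by blast
  then have "t \<le> real k * r" using r by (simp add: divide_less_eq)
  then show ?thesis using step t by blast
qed

end

section \<open>Existence and regularity\<close>

lemma geometric_half_bound: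
  fixes a c :: real
  assumes "\<And>k. a \<le> c * (1/2) ^ k"
  shows "a \<le> 0"
proof (rule tendsto_lowerbound[where F=sequentially])
  have "(\<lambda>k. c * (1/2) ^ k) \<longlonglongrightarrow> c * 0" by (intro tendsto_mult_left LIMSEQ_realpow_zero) auto
  then show "(\<lambda>k. c * (1/2) ^ k) \<longlonglongrightarrow> 0" by simp
qed (use assms in auto)

lemma geometric_half_small:
  fixes c e :: real
  assumes "e > 0"
  obtains k :: nat where "c * (1/2) ^ k \<le> e"
proof (rule ccontr)
  assume "\<not> thesis"
  then have "\<And>k. e \<le> c * (1/2) ^ k" using that by (meson linear)
  then have "e \<le> 0" by (rule geometric_half_bound)
  with assms show False by simp
qed

lemma Cb_1_obtain_holder_le:
  assumes "\<phi> \<in> Cb 1"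
  obtains B where "C1_le B \<phi>"
proof -
  have "Cb_norm 1 \<phi> < \<infinity>" using assms by (simp add: Cb_def)
  then have "Cb_norm 1 \<phi> \<le> ennreal (enn2real (Cb_norm 1 \<phi>))" by simp
  then show ?thesis
    using that Cb_1_imp_holder_le[OF assms] enn2real_nonneg by blast
qed

context mild_problem
begin

text \<open>The radius \<open>m\<close> exceeds the bound \<open>m1\<close> of the linear part by 1.
  Times up to \<open>r1\<close> keep the Duhamel term below 1, so all iterates started at
  \<open>S t u0\<close> obey the bound \<open>m\<close>; times up to \<open>r2\<close> make the map
  contract by 1/2. Both thresholds depend on \<open>m\<close> only, so every \<open>T\<close> up to
  their minimum is admissible.\<close>

lemma picard_fixed_point_exists:
  obtains T0 where "0 < T0" "T0 \<le> Ts"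
    "\<And>T. 0 < T \<Longrightarrow> T \<le> T0 \<Longrightarrow> \<exists>u m. C1_continuous T u \<and> C1_bounded T m u \<and> (\<forall>t\<in>{0<..T}. u t = picard u t)"
proof -
  define m1 where "m1 = max b0 L0"
  have m1: "m1 \<ge> 0" using holder_le_nonneg[OF S_u0_C1[OF Ts(1) order_refl]] by (simp add: m1_def)
  define m where "m = m1 + 1"
  have m: "m \<ge> 0" using m1 by (simp add: m_def)
  obtain M where M: "nonlin_bound m M" using nonlin_bounded[OF m] ..
  obtain K where K: "nonlin_lip m K" using nonlin_lipschitz[OF m] ..
  obtain r1 where r1: "0 < r1" "r1 \<le> Ts" "\<And>t. 0 \<le> t \<Longrightarrow> t \<le> r1 \<Longrightarrow> (1 + c0) * M * t powr kap / kap \<le> 1"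
    using small_time[OF nonlin_boundD(1)[OF M] zero_less_one] by blast
  obtain r2 where r2: "0 < r2" "r2 \<le> Ts" "\<And>t. 0 \<le> t \<Longrightarrow> t \<le> r2 \<Longrightarrow> (1 + c0) * K * t powr kap / kap \<le> 1/2"
    using small_time[OF nonlin_lipD(1)[OF K], of "1/2"] by auto
  have ex: "\<exists>u m. C1_continuous T u \<and> C1_bounded T m u \<and> (\<forall>t\<in>{0<..T}. u t = picard u t)"
    if T: "0 < T" "T \<le> min r1 r2" for T
  proof -
    have TTs: "T \<le> Ts" using T r1 by simp
    define U where "U n = (picard ^^ n) (\<lambda>t. S t u0)" for n
    have U_Suc: "U (Suc n) = picard (U n)" for n by (simp add: U_def)
    have inv: "C1_continuous T (U n) \<and> C1_bounded T m (U n)" for n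
    proof (induction n)
      case 0
      have "C1_bounded T m (\<lambda>t. S t u0)"
        unfolding C1_bounded_def using TTs by (auto intro!: holder_le_mono[OF S_u0_C1] simp: m_def m1_def)
      then show ?case using C1_continuous_S[OF u0_meas TTs] by (simp add: U_def)
    next
      case (Suc n)
      have src: "source T M (nonlin (U n))"
        using Suc TTs C1_boundedD[of T m "U n"]
        by (intro nonlin_source[of T _ m] nonlin_boundD(2)[OF M]) auto
      have "m1 + (1 + c0) * M * T powr kap / kap \<le> m"
        using r1(3)[of T] T by (simp add: m_def)
      then have "C1_bounded T m (picard (U n))"
        using picard_C1_bounded[OF src TTs] unfolding C1_bounded_def m1_def by (blast intro: holder_le_mono)
      then show ?case
        using picard_C1_continuous[OF src T(1) TTs] by (simp add: U_Suc)
    qed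
    then have Uc: "C1_continuous T (U n)" and Ub: "C1_bounded T m (U n)" for n by auto
    define c where "c = 2 * m"
    have c: "c \<ge> 0" using m by (simp add: c_def)
    have diff: "\<forall>t\<in>{0<..T}. C1_le (c * (1/2) ^ n) (\<lambda>x. U (Suc n) t x - U n t x)" for n
    proof (induction n)
      case 0
      show ?case
      proof
        fix t assume "t \<in> {0<..T}"
        then have "C1_le (m + m) (\<lambda>x. U (Suc 0) t x - U 0 t x)"
          by (intro holder_le_diff C1_boundedD[OF Ub]) auto
        then show "C1_le (c * (1/2) ^ 0) (\<lambda>x. U (Suc 0) t x - U 0 t x)"
          by (simp add: c_def)
      qed
    next
      case (Suc n)
      show ?case
      proof
        fix t assume t: "t \<in> {0<..T}"
        have "C1_le ((1 + c0) * K * (t - 0) powr kap / kap * (c * (1/2) ^ n)) (\<lambda>x. picard (U (Suc n)) t x - picard (U n) t x)"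
          using t c Suc by (intro picard_diff[OF Uc Ub Uc Ub TTs K order_refl]) auto
        moreover have "(1 + c0) * K * (t - 0) powr kap / kap * (c * (1/2) ^ n) \<le> 1/2 * (c * (1/2) ^ n)"
          using t T c by (intro mult_right_mono r2(3)) auto
        ultimately have "C1_le (1/2 * (c * (1/2) ^ n)) (\<lambda>x. picard (U (Suc n)) t x - picard (U n) t x)"
          by (rule holder_le_mono)
        then show "C1_le (c * (1/2) ^ Suc n) (\<lambda>x. U (Suc (Suc n)) t x - U (Suc n) t x)"
          by (simp add: U_Suc mult_ac)
      qed
    qed
    have cauchy: "C1_le (2 * c * (1/2) ^ k) (\<lambda>x. U n t x - U k t x)"
      if t: "t \<in> {0<..T}" and kn: "k \<le> n" for t k n
    proof -
      \<comment> \<open>The geometric sum is carried exactly so that the induction closes; the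
        negative term is dropped afterwards.\<close>
      have "C1_le (2 * c * ((1/2) ^ k - (1/2) ^ n)) (\<lambda>x. U n t x - U k t x)"
        using kn
      proof (induction rule: dec_induct)
        case base
        show ?case by (simp add: holder_le_1I cont_diff_const partial_deriv_def)
      next
        case (step n)
        have "C1_le (c * (1/2) ^ n + 2 * c * ((1/2) ^ k - (1/2) ^ n)) (\<lambda>x. (U (Suc n) t x - U n t x) + (U n t x - U k t x))"
          using diff t step.IH by (intro holder_le_add) auto
        then show ?case by (simp add: algebra_simps)
      qed
      moreover have "2 * c * ((1/2) ^ k - (1/2) ^ n) \<le> 2 * c * (1/2) ^ k"
        using c by (intro mult_left_mono) auto
      ultimately show ?thesis by (rule holder_le_mono)
    qed
    have "\<exists>v. \<forall>k. C1_le (2 * c * (1/2) ^ k) (\<lambda>x. v x - U k t x)" if t: "t \<in> {0<..T}" for t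
    proof -
      have cd: "cont_diff (Suc 0) (U n t)" for n
        using C1_boundedD[OF Ub] t by (auto intro: holder_le_1D(1))
      show ?thesis
        by (rule C1_complete[OF cd cauchy[OF t]]) blast+
    qed
    then obtain u where u: "\<And>t k. t \<in> {0<..T} \<Longrightarrow> C1_le (2 * c * (1/2) ^ k) (\<lambda>x. u t x - U k t x)"
      by metis
    \<comment> \<open>Distance of the limit from the first iterate plus the bound of that
      iterate.\<close>
    define m' where "m' = 2 * c + m"
    have m': "m \<le> m'" "m' \<ge> 0" using c m by (auto simp: m'_def)
    have ub: "C1_bounded T m' u"
      unfolding C1_bounded_def
    proof
      fix t assume t: "t \<in> {0<..T}"
      have "C1_le (2 * c * (1/2) ^ 0 + m) (\<lambda>x. (u t x - U 0 t x) + U 0 t x)"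
        using t by (intro holder_le_add u C1_boundedD[OF Ub]) auto
      then show "C1_le m' (u t)" by (simp add: m'_def)
    qed
    have uc: "C1_continuous T u"
      unfolding C1_continuous_def
    proof (intro ballI allI impI)
      fix t and e :: real assume t: "t \<in> {0<..T}" and e: "e > 0"
      obtain k where k: "2 * c * (1/2) ^ k \<le> e / 3" using geometric_half_small[of "e/3" "2 * c"] e by auto
      obtain r where r: "r > 0" "\<And>s. s \<in> {0<..T} \<Longrightarrow> \<bar>s - t\<bar> < r \<Longrightarrow> C1_le (e/3) (\<lambda>x. U k s x - U k t x)"
        using C1_continuousD[OF Uc[of k] t divide_pos_pos[OF e, of 3]] by auto
      have close: "C1_le (e/3) (\<lambda>x. u s x - U k s x)" if "s \<in> {0<..T}" for s
        using u[OF that] k by (rule holder_le_mono)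
      have "C1_le e (\<lambda>x. u s x - u t x)" if s: "s \<in> {0<..T}" "\<bar>s - t\<bar> < r" for s
      proof -
        have "C1_le ((e/3 + e/3) + e/3) (\<lambda>x. ((u s x - U k s x) + (U k s x - U k t x)) - (u t x - U k t x))"
          by (intro holder_le_diff holder_le_add close r s t)
        then show ?thesis by simp
      qed
      then show "\<exists>r>0. \<forall>s\<in>{0<..T}. \<bar>s - t\<bar> < r \<longrightarrow> C1_le e (\<lambda>x. u s x - u t x)"
        using r(1) by blast
    qed
    \<comment> \<open>A new Lipschitz constant for the larger radius. It only multiplies
      \<open>(1/2) ^ k\<close>, so its size does not matter in the limit and \<open>T\<close> need
      not shrink again.\<close>
    obtain K' where K': "nonlin_lip m' K'" using nonlin_lipschitz[OF m'(2)] ..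
    have Ub': "C1_bounded T m' (U k)" for k
      using Ub[of k] m'(1) unfolding C1_bounded_def by (blast intro: holder_le_mono)
    have "u t = picard u t" if t: "t \<in> {0<..T}" for t
    proof
      fix x
      define A where "A = (1 + c0) * K' * (t - 0) powr kap / kap"
      have A: "A \<ge> 0" using c0 kap_pos nonlin_lipD(1)[OF K'] by (simp add: A_def)
      have "\<bar>u t x - picard u t x\<bar> \<le> ((1 + A) * (2 * c)) * (1/2) ^ k" for k
      proof -
        have "\<bar>u t x - U (Suc k) t x\<bar> \<le> 2 * c * (1/2) ^ Suc k"
          using holder_le_1D(2)[OF u[OF t]] .
        also have "\<dots> \<le> 2 * c * (1/2) ^ k" using c by simp
        finally have 1: "\<bar>u t x - U (Suc k) t x\<bar> \<le> 2 * c * (1/2) ^ k" .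
        have "C1_le (A * (2 * c * (1/2) ^ k)) (\<lambda>x. picard u t x - picard (U k) t x)"
          unfolding A_def using t c u by (intro picard_diff[OF uc ub Uc Ub' TTs K' order_refl]) auto
        then have "\<bar>picard u t x - U (Suc k) t x\<bar> \<le> A * (2 * c * (1/2) ^ k)"
          unfolding U_Suc by (rule holder_le_1D(2))
        with 1 have "\<bar>u t x - picard u t x\<bar> \<le> 2 * c * (1/2) ^ k + A * (2 * c * (1/2) ^ k)" by linarith
        then show ?thesis by (simp add: algebra_simps)
      qed
      then have "\<bar>u t x - picard u t x\<bar> \<le> 0" by (rule geometric_half_bound)
      then show "u t x = picard u t x" by simp
    qed
    then show ?thesis using uc ub by blast
  qed
  show ?thesis
    by (rule that[of "min r1 r2"]) (use r1 r2 ex in auto)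
qed

text \<open>If \<open>u s\<close> has exponent \<open>1 + \<sigma>\<close>, its gradient and
  \<open>Q (u s)\<close> are \<sigma>-Hoelder with constants proportional to \<open>B\<close>. The
  spatial term \<open>min (norm h powr \<beta>) 1\<close> is at most
  \<open>norm h powr \<sigma>\<close> because \<open>\<sigma> \<le> \<beta>\<close>, by the first
  entry if \<open>norm h \<le> 1\<close> and by the second otherwise.\<close>

lemma nonlin_holder:
  assumes u: "C1_bounded T m u" and T: "T \<le> Ts" and B0: "B \<ge> 0"
    and \<sigma>: "0 < \<sigma>" "\<sigma> \<le> \<beta>" "real n + \<delta> = 1 + \<sigma>" "0 \<le> \<delta>" "\<delta> < 1"
  shows "\<exists>M'. \<forall>s x h. 0 < s \<longrightarrow> s \<le> T \<longrightarrow> holder_le n \<delta> B (u s) \<longrightarrow>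
    \<bar>nonlin u s (x + h) - nonlin u s x\<bar> \<le> M' * norm h powr \<sigma>"
proof (cases "T > 0")
  case True
  have m: "m \<ge> 0" using holder_le_nonneg[OF C1_boundedD[OF u True order_refl]] .
  obtain q where q: "q \<ge> 0" "\<And>m \<phi> x. C1_le m \<phi> \<Longrightarrow> \<bar>Q \<phi> x\<bar> \<le> q * m"
    "\<And>m \<phi> x h n \<delta> \<sigma>. holder_le n \<delta> m \<phi> \<Longrightarrow> 0 < \<sigma> \<Longrightarrow> \<sigma> \<le> \<beta> \<Longrightarrow> real n + \<delta> = 1 + \<sigma> \<Longrightarrow> 0 \<le> \<delta> \<Longrightarrow> \<delta> < 1 \<Longrightarrow>
       \<bar>Q \<phi> (x + h) - Q \<phi> x\<bar> \<le> q * m * norm h powr \<sigma>"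
    using Q_estimate by metis
  define R where "R = max (real CARD('d) * m) (q * m)"
  have R: "R \<ge> 0" "real CARD('d) * m \<le> R" "q * m \<le> R" using m by (auto simp: R_def le_max_iff_disj)
  obtain C where "H_lip R C" using H_local[OF R(1)] ..
  note C = H_lipD[OF this]
  show ?thesis
  proof (intro exI[of _ "C * (1 + real CARD('d) * (real CARD('d) * B) + q * B)"] allI impI)
    fix s x h assume s: "0 < s" "s \<le> T" and us: "holder_le n \<delta> B (u s)"
    have um: "C1_le m (u s)" using C1_boundedD[OF u s] .
    have sT: "s \<in> {0..Ts}" using s T by simp
    have g: "norm (grad (u s) y) \<le> R" for y
      using norm_grad_le[OF holder_le_1D(3)[OF um]] R(2) by (rule order_trans)
    have Qb: "\<bar>Q (u s) y\<bar> \<le> R" for y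
      using q(2)[OF um] R(3) by (rule order_trans)
    have gd: "norm (grad (u s) x - grad (u s) (x + h)) \<le> real CARD('d) * (real CARD('d) * B * norm h powr \<sigma>)"
      using holder_le_1_partial[OF us \<sigma>(1) _ \<sigma>(3-5), of _ x h] \<sigma> beta
      by (intro norm_grad_diff_le) (simp add: abs_minus_commute)
    have Qd: "\<bar>Q (u s) x - Q (u s) (x + h)\<bar> \<le> q * B * norm h powr \<sigma>"
      using q(3)[OF us \<sigma>] by (simp add: abs_minus_commute)
    have hb: "min (norm h powr \<beta>) 1 \<le> norm h powr \<sigma>"
    proof (cases "norm h \<le> 1")
      case True
      then have "norm h powr \<beta> \<le> norm h powr \<sigma>" using \<sigma> by (intro powr_mono') auto
      then show ?thesis by simp
    next
      case False
      then have "1 \<le> norm h powr \<sigma>" using \<sigma> by (intro ge_one_powr_ge_zero) auto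
      then show ?thesis by simp
    qed
    have "\<bar>nonlin u s (x + h) - nonlin u s x\<bar> \<le> C * (min (norm (x - (x + h)) powr \<beta>) 1
        + norm (grad (u s) x - grad (u s) (x + h)) + \<bar>Q (u s) x - Q (u s) (x + h)\<bar>)"
      unfolding nonlin_def by (rule C(2)[OF sT g g Qb Qb])
    also have "\<dots> \<le> C * (norm h powr \<sigma> + real CARD('d) * (real CARD('d) * B * norm h powr \<sigma>) + q * B * norm h powr \<sigma>)"
      using C(1) gd Qd hb by (intro mult_left_mono add_mono) auto
    finally show "\<bar>nonlin u s (x + h) - nonlin u s x\<bar> \<le> C * (1 + real CARD('d) * (real CARD('d) * B) + q * B) * norm h powr \<sigma>"
      by (simp add: algebra_simps)
  qed
qed auto

text \<open>One regularity step: Hoelder control of the nonlinearity from time \<open>a / 2\<close>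
  on gives control of the solution from time \<open>a\<close> on.\<close>

lemma picard_regular:
  assumes u: "C1_continuous T u" "C1_bounded T m u" and T: "0 < T" "T \<le> Ts"
    and fix_u: "\<And>t. t \<in> {0<..T} \<Longrightarrow> u t = picard u t" and a: "0 < a"
    and \<sigma>: "0 \<le> \<sigma>" "\<sigma> \<le> 1"
    and hol: "\<exists>M'. \<forall>s x h. 0 < \<sigma> \<longrightarrow> a / 2 \<le> s \<longrightarrow> s \<le> T \<longrightarrow> \<bar>nonlin u s (x + h) - nonlin u s x\<bar> \<le> M' * norm h powr \<sigma>"
    and n: "n \<ge> 1" "real n < \<alpha> + \<sigma>" and \<delta>: "0 \<le> \<delta>" "\<delta> < 1" "real n + \<delta> \<le> \<alpha> + \<sigma>"
  shows "\<exists>B. \<forall>t. a \<le> t \<longrightarrow> t \<le> T \<longrightarrow> holder_le n \<delta> B (u t)"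
proof -
  obtain M where src: "source T M (nonlin u)" using nonlin_source'[OF u T] .
  obtain M' where M': "\<And>s x h. 0 < \<sigma> \<Longrightarrow> a / 2 \<le> s \<Longrightarrow> s \<le> T \<Longrightarrow> \<bar>nonlin u s (x + h) - nonlin u s x\<bar> \<le> M' * norm h powr \<sigma>"
    using hol by blast
  have a2: "0 < a / 2" using a by simp
  obtain B1 where B1: "\<And>t. 2 * (a / 2) \<le> t \<Longrightarrow> t \<le> T \<Longrightarrow> holder_le n \<delta> B1 (duhamel (nonlin u) t)"
    using duhamel_holder_le[OF src T a2 \<sigma> M' n \<delta>] by blast
  obtain B2 where B2: "\<And>t. a \<le> t \<Longrightarrow> t \<le> Ts \<Longrightarrow> holder_le n \<delta> B2 (S t u0)"
    using S_holder_le[OF a \<delta>(1) less_imp_le[OF \<delta>(2)] u0_meas] by blast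
  show ?thesis
  proof (intro exI allI impI)
    fix t assume t: "a \<le> t" "t \<le> T"
    have "holder_le n \<delta> (B2 + B1) (picard u t)"
      unfolding picard_def using t T by (intro holder_le_add B1 B2) auto
    then show "holder_le n \<delta> (B2 + B1) (u t)"
      using fix_u[of t] t a by simp
  qed
qed

text \<open>Exponent \<sigma> for the nonlinearity gives exponents of \<open>u\<close> up to
  \<open>\<alpha> + \<sigma>\<close>, and exponent \<open>1 + \<sigma>'\<close> of \<open>u\<close>
  returns \<sigma>' for the nonlinearity, so each round can gain \<open>\<alpha> - 1\<close>. Taking
  half of that gain keeps the inequalities strict, and finitely many rounds reach \<beta>. The claim
  is carried for all \<open>a > 0\<close> because each round halves the starting time.\<close>

lemma mild_regular:
  assumes u: "C1_continuous T u" "C1_bounded T m u" and T: "0 < T" "T \<le> Ts"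
    and fix_u: "\<And>t. t \<in> {0<..T} \<Longrightarrow> u t = picard u t" and t: "t \<in> {0<..T}"
  shows "u t \<in> Cb (\<alpha> + \<beta>)"
proof -
  define \<theta> where "\<theta> = (\<alpha> - 1) / 2"
  have \<theta>: "\<theta> > 0" "\<theta> < \<alpha> - 1" using alpha by (auto simp: \<theta>_def)
  define \<sigma> where "\<sigma> k = min \<beta> (real k * \<theta>)" for k
  have \<sigma>: "0 \<le> \<sigma> k" "\<sigma> k \<le> \<beta>" "\<sigma> k \<le> 1" "\<sigma> (Suc k) \<le> \<sigma> k + \<theta>" for k
    using beta \<theta> by (auto simp: \<sigma>_def algebra_simps)
  have key: "\<forall>a>0. \<exists>M'. \<forall>s x h. 0 < \<sigma> k \<longrightarrow> a \<le> s \<longrightarrow> s \<le> T \<longrightarrow>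
      \<bar>nonlin u s (x + h) - nonlin u s x\<bar> \<le> M' * norm h powr \<sigma> k" for k
  proof (induction k)
    case 0
    then show ?case using beta by (simp add: \<sigma>_def)
  next
    case (Suc k)
    show ?case
    proof (intro allI impI)
      fix a :: real assume a: "a > 0"
      show "\<exists>M'. \<forall>s x h. 0 < \<sigma> (Suc k) \<longrightarrow> a \<le> s \<longrightarrow> s \<le> T \<longrightarrow>
          \<bar>nonlin u s (x + h) - nonlin u s x\<bar> \<le> M' * norm h powr \<sigma> (Suc k)"
      proof (cases "0 < \<sigma> (Suc k)")
        case True
        \<comment> \<open>The exponent \<open>1 + \<sigma> (Suc k)\<close> may be the integer \<open>2\<close>.\<close>
        define n :: nat where "n = (if \<sigma> (Suc k) < 1 then 1 else 2)"
        define \<delta> where "\<delta> = (if \<sigma> (Suc k) < 1 then \<sigma> (Suc k) else 0)"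
        have n\<delta>: "real n + \<delta> = 1 + \<sigma> (Suc k)" "0 \<le> \<delta>" "\<delta> < 1" "n \<ge> 1"
          using \<sigma>(3)[of "Suc k"] True by (auto simp: n_def \<delta>_def)
        \<comment> \<open>Strictness matters when the exponent is the integer 2, which is reached
          only from below.\<close>
        have lt: "real n + \<delta> < \<alpha> + \<sigma> k" using n\<delta>(1) \<sigma>(4)[of k] \<theta> by linarith
        have hol: "\<exists>M'. \<forall>s x h. 0 < \<sigma> k \<longrightarrow> a / 2 \<le> s \<longrightarrow> s \<le> T \<longrightarrow> \<bar>nonlin u s (x + h) - nonlin u s x\<bar> \<le> M' * norm h powr \<sigma> k"
          using Suc half_gt_zero[OF a] by blast
        obtain B where B: "\<And>t. a \<le> t \<Longrightarrow> t \<le> T \<Longrightarrow> holder_le n \<delta> B (u t)"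
          using picard_regular[OF u T fix_u a \<sigma>(1,3) hol n\<delta>(4) _ n\<delta>(2,3)] lt n\<delta>(2) by fastforce
        show ?thesis
        proof (cases "a \<le> T")
          case True
          have B0: "B \<ge> 0" using holder_le_nonneg[OF B[OF True order_refl]] .
          obtain M' where M': "\<And>s x h. 0 < s \<Longrightarrow> s \<le> T \<Longrightarrow> holder_le n \<delta> B (u s) \<Longrightarrow>
              \<bar>nonlin u s (x + h) - nonlin u s x\<bar> \<le> M' * norm h powr \<sigma> (Suc k)"
            using nonlin_holder[OF u(2) T(2) B0 \<open>0 < \<sigma> (Suc k)\<close> \<sigma>(2) n\<delta>(1-3)] by blast
          show ?thesis
            using a by (intro exI[of _ M'] allI impI M' B) auto
        qed auto
      qed simp
    qed
  qed
  obtain k where k: "real k > \<beta> / \<theta>" using reals_Archimedean2 by blast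
  have \<sigma>k: "\<sigma> k = \<beta>" using k \<theta> by (simp add: \<sigma>_def divide_less_eq)
  define n where "n = nat \<lfloor>\<alpha> + \<beta>\<rfloor>"
  define \<delta> where "\<delta> = frac (\<alpha> + \<beta>)"
  have fl: "\<lfloor>\<alpha> + \<beta>\<rfloor> \<ge> 1" using alpha beta by linarith
  have "nat 1 \<le> n" unfolding n_def using fl by (rule nat_mono)
  moreover have "real n = of_int \<lfloor>\<alpha> + \<beta>\<rfloor>"
    unfolding n_def using order_trans[OF zero_le_one fl] by (rule of_nat_nat)
  ultimately have n: "n \<ge> 1" "real n = of_int \<lfloor>\<alpha> + \<beta>\<rfloor>" by simp_all
  have n\<delta>: "real n + \<delta> = \<alpha> + \<beta>" "0 \<le> \<delta>" "\<delta> < 1"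
    by (auto simp: n \<delta>_def frac_def frac_lt_1[unfolded frac_def])
  \<comment> \<open>Non-integrality of \<open>\<alpha> + \<beta>\<close>: with a positive fractional
    part the order \<open>n\<close> stays strictly below \<open>\<alpha> + \<beta>\<close>, as the
    endpoint estimate requires.\<close>
  have "\<delta> \<noteq> 0"
  proof
    assume "\<delta> = 0"
    then have "\<alpha> + \<beta> = real n" using n\<delta>(1) by simp
    then show False using alpha_beta by simp
  qed
  then have lt: "real n < \<alpha> + \<sigma> k" using n\<delta> \<sigma>k by simp
  have ta: "0 < t" using t by simp
  have "\<exists>B. \<forall>s. t \<le> s \<longrightarrow> s \<le> T \<longrightarrow> holder_le n \<delta> B (u s)"
  proof (rule picard_regular[OF u T fix_u ta \<sigma>(1,3)[of k] _ n(1) lt n\<delta>(2,3)])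
    show "\<exists>M'. \<forall>s x h. 0 < \<sigma> k \<longrightarrow> t / 2 \<le> s \<longrightarrow> s \<le> T \<longrightarrow> \<bar>nonlin u s (x + h) - nonlin u s x\<bar> \<le> M' * norm h powr \<sigma> k"
      using key[of k] half_gt_zero[OF ta] by blast
    show "real n + \<delta> \<le> \<alpha> + \<sigma> k" using n\<delta>(1) \<sigma>k by simp
  qed
  then obtain B where "holder_le n \<delta> B (u t)" using t by auto
  from holder_le_imp_Cb(1)[OF this n\<delta>(2,3)] show ?thesis by (simp add: n\<delta>(1))
qed

section \<open>Passage between fixed points and mild solutions\<close>

lemma mild_solutionI:
  assumes u: "C1_continuous T u" "C1_bounded T m u" and T: "0 < T" "T \<le> Ts"
    and fix_u: "\<And>t. t \<in> {0<..T} \<Longrightarrow> u t = picard u t"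
  shows "mild_solution p H Q u0 T u" and "bounded_Cb1 T u"
proof -
  obtain M where src: "source T M (nonlin u)" using nonlin_source'[OF u T] .
  have ub: "C1_le m (u t)" if "t \<in> {0<..T}" for t
    using C1_boundedD[OF u(2)] that by simp
  have cd: "cont_diff (Suc 0) (u t)" if "t \<in> {0<..T}" for t
    by (rule holder_le_1D(1)[OF ub[OF that]])
  have eta: "(\<lambda>y. H s y (grad (u s) y) (Q (u s) y)) = nonlin u s" for s
    by (simp add: nonlin_def fun_eq_iff)
  show "bounded_Cb1 T u"
    unfolding bounded_Cb1_def using holder_le_1_imp_Cb(2)[OF ub] by blast
  show "mild_solution p H Q u0 T u"
    unfolding mild_solution_def continuous_Cb1_def eta
  proof (intro conjI ballI allI)
    fix t x assume t: "t \<in> {0<..T}"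
    show "u t \<in> Cb 1" by (rule holder_le_1_imp_Cb(1)[OF ub[OF t]])
    show "((\<lambda>s. Cb_norm 1 (\<lambda>x. u s x - u t x)) \<longlongrightarrow> 0) (at t within {0<..T})"
      using C1_continuous_iff_Cb1[of T u, OF cd] u(1) t by blast
    show "set_integrable lborel {0<..<t} (\<lambda>s. S (t - s) (nonlin u s) x)"
      using duhamel_integrable[OF src] t T by simp
    show "u t x = S t u0 x + (LBINT s:{0<..<t}. S (t - s) (nonlin u s) x)"
      using fix_u[OF t] by (simp add: picard_def duhamel_def)
  qed
qed

lemma mild_solutionD:
  assumes v: "mild_solution p H Q u0 T v" "bounded_Cb1 T v" and T: "0 < T"
  obtains m where "C1_continuous T v" "C1_bounded T m v" "\<And>t. t \<in> {0<..T} \<Longrightarrow> v t = picard v t"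
proof -
  have eta: "(\<lambda>y. H s y (grad (v s) y) (Q (v s) y)) = nonlin v s" for s
    by (simp add: nonlin_def fun_eq_iff)
  have cont: "continuous_Cb1 T v" and eq: "\<And>t x. t \<in> {0<..T} \<Longrightarrow> v t x = S t u0 x + (LBINT s:{0<..<t}. S (t - s) (nonlin v s) x)"
    using v(1) unfolding mild_solution_def eta by auto
  have Cb: "v t \<in> Cb 1" if "t \<in> {0<..T}" for t
    using cont that by (simp add: continuous_Cb1_def)
  obtain M where M: "\<And>t. t \<in> {0<..T} \<Longrightarrow> Cb_norm 1 (v t) \<le> ennreal M"
    using v(2) unfolding bounded_Cb1_def by blast
  \<comment> \<open>\<open>M\<close> may be negative, since \<open>ennreal\<close> sends negative
    numbers to 0.\<close>
  have vb: "C1_le (max 0 M) (v t)" if "t \<in> {0<..T}" for t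
    by (intro Cb_1_imp_holder_le[OF Cb[OF that]] order_trans[OF M[OF that] ennreal_leI]) auto
  have cd: "cont_diff (Suc 0) (v t)" if "t \<in> {0<..T}" for t
    by (rule holder_le_1D(1)[OF vb[OF that]])
  show ?thesis
  proof
    show "C1_continuous T v"
      using C1_continuous_iff_Cb1[of T v, OF cd] cont unfolding continuous_Cb1_def by blast
    show "C1_bounded T (max 0 M) v" using vb by (simp add: C1_bounded_def)
    show "v t = picard v t" if "t \<in> {0<..T}" for t
      using eq[OF that] by (simp add: picard_def duhamel_def fun_eq_iff)
  qed
qed

lemma mild_solution_wellposed:
  "\<exists>T0\<in>{0<..Ts}. \<forall>T\<in>{0<..T0}. \<exists>u.
      mild_solution p H Q u0 T u \<and> bounded_Cb1 T u \<and>
      (\<forall>v. mild_solution p H Q u0 T v \<and> bounded_Cb1 T v \<longrightarrow> (\<forall>t\<in>{0<..T}. v t = u t)) \<and>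
      (\<forall>t\<in>{0<..T}. u t \<in> Cb (\<alpha> + \<beta>))"
proof -
  obtain T0 where T0: "0 < T0" "T0 \<le> Ts"
    "\<And>T. 0 < T \<Longrightarrow> T \<le> T0 \<Longrightarrow> \<exists>u m. C1_continuous T u \<and> C1_bounded T m u \<and> (\<forall>t\<in>{0<..T}. u t = picard u t)"
    using picard_fixed_point_exists by blast
  show ?thesis
  proof (intro bexI[of _ T0] ballI)
    fix T assume "T \<in> {0<..T0}"
    then have T: "0 < T" "T \<le> T0" "T \<le> Ts" using T0(2) by auto
    obtain u m where u: "C1_continuous T u" "C1_bounded T m u" and fu: "\<And>t. t \<in> {0<..T} \<Longrightarrow> u t = picard u t"
      using T0(3)[OF T(1,2)] by blast
    show "\<exists>u. mild_solution p H Q u0 T u \<and> bounded_Cb1 T u \<and>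
      (\<forall>v. mild_solution p H Q u0 T v \<and> bounded_Cb1 T v \<longrightarrow> (\<forall>t\<in>{0<..T}. v t = u t)) \<and>
      (\<forall>t\<in>{0<..T}. u t \<in> Cb (\<alpha> + \<beta>))"
    proof (intro exI[of _ u] conjI allI impI ballI)
      show "mild_solution p H Q u0 T u"
        by (rule mild_solutionI(1)[OF u T(1,3) fu])
      show "bounded_Cb1 T u"
        by (rule mild_solutionI(2)[OF u T(1,3) fu])
      show "u t \<in> Cb (\<alpha> + \<beta>)" if "t \<in> {0<..T}" for t
        by (rule mild_regular[OF u T(1,3) fu that])
      fix v t assume v: "mild_solution p H Q u0 T v \<and> bounded_Cb1 T v" and t: "t \<in> {0<..T}"
      obtain m' where v': "C1_continuous T v" "C1_bounded T m' v" and fv: "\<And>t. t \<in> {0<..T} \<Longrightarrow> v t = picard v t"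
        using mild_solutionD[OF conjunct1[OF v] conjunct2[OF v] T(1)] by blast
      \<comment> \<open>Uniqueness is proved under one common bound; the competitor \<open>v\<close>
        may have a larger one than \<open>u\<close>.\<close>
      have b: "C1_bounded T (max m m') u" "C1_bounded T (max m m') v"
        using u(2) v'(2) unfolding C1_bounded_def by (auto intro: holder_le_mono)
      show "v t = u t"
        by (rule picard_unique[OF v'(1) b(2) u(1) b(1) T(1,3) fv fu t])
    qed
  qed (use T0 in auto)
qed

end

theorem theorem6p2:
  fixes A :: "real^'d^'d" and \<mu> :: "(real^'d) measure"
    and p :: "real \<Rightarrow> real^'d \<Rightarrow> real"
    and H :: "real \<Rightarrow> real^'d \<Rightarrow> real^'d \<Rightarrow> real \<Rightarrow> real"
    and Q :: "(real^'d \<Rightarrow> real) \<Rightarrow> real^'d \<Rightarrow> real"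
    and u0 :: "real^'d \<Rightarrow> real"
    and Tstar \<alpha> \<beta> c0 :: real
  assumes Tstar: "Tstar > 0" and beta: "\<beta> \<in> {0..1}"
    and levy: "levy_triplet A \<mu>" and kernel: "heat_kernel A \<mu> p"
    and kernel_smooth: "\<forall>t>0. p t \<in> Cb_infinity"
    and alpha: "\<alpha> \<in> {1<..2}" and c0: "c0 > 0"
    and kernel_grad: "\<forall>t\<in>{0<..Tstar}.
        (\<integral>\<^sup>+ y. ennreal (norm (grad (p t) y)) \<partial>lborel) \<le> ennreal (c0 * t powr (- 1 / \<alpha>))"
    and alpha_beta: "\<alpha> + \<beta> \<notin> \<nat>"
    and u0_bounded: "bounded (range u0)" and u0_lipschitz: "\<exists>L. L-lipschitz_on UNIV u0"
    and H_cont: "continuous_on ({0..Tstar} \<times> UNIV \<times> UNIV \<times> UNIV) (\<lambda>(t, x, p, q). H t x p q)"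
    and H_zero: "\<exists>C>0. \<forall>t\<in>{0..Tstar}. \<forall>x. \<bar>H t x 0 0\<bar> \<le> C"
    \<comment> \<open>Since \<open>0 powr 0 = 0\<close>, for \<open>\<beta> = 0\<close> the term in \<open>x\<close> and \<open>x'\<close> vanishes when \<open>x = x'\<close>,
      so \<open>H\<close> is locally Lipschitz in \<open>(p, q)\<close> for that \<open>\<beta>\<close> as well.\<close>
    and H_lipschitz: "\<forall>R>0. \<exists>C>0. \<forall>t\<in>{0..Tstar}. \<forall>x x'.
        \<forall>p\<in>ball 0 R. \<forall>p'\<in>ball 0 R. \<forall>q\<in>ball 0 R. \<forall>q'\<in>ball 0 R.
          \<bar>H t x' p' q' - H t x p q\<bar>
            \<le> C * (min (norm (x - x') powr \<beta>) 1 + norm (p - p') + \<bar>q - q'\<bar>)"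
    and Q_linear: "linear_on_Cb1 Q"
    and Q_measurable: "\<forall>\<phi>\<in>Cb 1. Q \<phi> \<in> borel_measurable lebesgue"
    and Q_bounded: "\<exists>C>0.
        (\<forall>\<phi>\<in>Cb 1. sup_norm (Q \<phi>) \<le> ennreal C * Cb_norm 1 \<phi>) \<and>
        (\<forall>\<sigma>\<in>{0<..\<beta>}. \<forall>\<phi>\<in>Cb (1 + \<sigma>).
           holder_seminorm \<sigma> (Q \<phi>) \<le> ennreal C * Cb_norm (1 + \<sigma>) \<phi>)"
  shows "\<exists>T0\<in>{0<..Tstar}. \<forall>T\<in>{0<..T0}. \<exists>u.
      mild_solution p H Q u0 T u \<and> bounded_Cb1 T u \<and>
      (\<forall>v. mild_solution p H Q u0 T v \<and> bounded_Cb1 T v \<longrightarrow> (\<forall>t\<in>{0<..T}. v t = u t)) \<and>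
      (\<forall>t\<in>{0<..T}. u t \<in> Cb (\<alpha> + \<beta>))"
proof -
  \<comment> \<open>Shrinking the final time is harmless for a claim about small times and provides
    \<open>Ts \<le> 1\<close>.\<close>
  define Ts where "Ts = min 1 Tstar"
  have Ts: "0 < Ts" "Ts \<le> 1" "Ts \<le> Tstar" using Tstar by (auto simp: Ts_def)
  note Ts_le = Ts(3)
  have K: "p t \<in> borel_measurable borel" "0 \<le> p t x" "prob_space (density lborel (\<lambda>x. ennreal (p t x)))"
    "(\<integral>x. exp (- (\<i> * of_real (\<xi> \<bullet> x))) \<partial>density lborel (\<lambda>x. ennreal (p t x))) = exp (- (of_real t * levy_symbol A \<mu> \<xi>))"
    if "t > 0" for t x \<xi>
    using kernel that unfolding heat_kernel_def by blast+
  have p1: "\<exists>B. C1_le B (p t)" if "t > 0" for t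
  proof -
    have "p t \<in> Cb (real 1)" using kernel_smooth that unfolding Cb_infinity_def by blast
    then have "p t \<in> Cb 1" by simp
    then show ?thesis by (rule Cb_1_obtain_holder_le) blast
  qed
  obtain b0 where b0: "\<And>x. \<bar>u0 x\<bar> \<le> b0"
    using u0_bounded by (auto simp: bounded_iff)
  obtain L0 where "L0-lipschitz_on UNIV u0" using u0_lipschitz ..
  then have L0: "\<bar>u0 (x + h) - u0 x\<bar> \<le> L0 * norm h" for x h
    using lipschitz_onD[of L0 UNIV u0 "x + h" x] by (simp add: dist_norm)
  interpret mild_problem p "levy_symbol A \<mu>" \<alpha> c0 Ts H Q u0 \<beta> b0 L0
  proof (intro mild_problem.intro heat_semigroup.intro mild_problem_axioms.intro)
    fix t :: real assume t: "t > 0"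
    show "p t \<in> borel_measurable borel" "prob_space (density lborel (\<lambda>x. ennreal (p t x)))"
      by (rule K(1)[OF t], rule K(3)[OF t])
    show "0 \<le> p t x" for x by (rule K(2)[OF t])
    show "(\<integral>x. exp (- (\<i> * of_real (\<xi> \<bullet> x))) \<partial>density lborel (\<lambda>x. ennreal (p t x))) = exp (- (of_real t * levy_symbol A \<mu> \<xi>))" for \<xi>
      by (rule K(4)[OF t])
    obtain B where B: "C1_le B (p t)" using p1[OF t] ..
    show "cont_diff (Suc 0) (p t)" by (rule holder_le_1D(1)[OF B])
    show "\<exists>B. \<forall>x. \<bar>p t x\<bar> \<le> B \<and> (\<forall>i. \<bar>partial_deriv i (p t) x\<bar> \<le> B)"
      using holder_le_1D(2,3)[OF B] by blast
    fix i assume "t \<le> Ts"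
    have "(\<integral>\<^sup>+ y. ennreal \<bar>partial_deriv i (p t) y\<bar> \<partial>lborel) \<le> (\<integral>\<^sup>+ y. ennreal (norm (grad (p t) y)) \<partial>lborel)"
      using component_le_norm_cart[of "grad (p t) _" i] by (intro nn_integral_mono ennreal_leI) (simp add: grad_def)
    also have "\<dots> \<le> ennreal (c0 * t powr (- 1 / \<alpha>))"
      using kernel_grad t \<open>t \<le> Ts\<close> Ts by auto
    finally show "(\<integral>\<^sup>+ y. ennreal \<bar>partial_deriv i (p t) y\<bar> \<partial>lborel) \<le> ennreal (c0 * t powr (- 1 / \<alpha>))" .
  next
    show "1 < \<alpha>" "\<alpha> \<le> 2" "c0 > 0" "0 < Ts" "Ts \<le> 1" "0 \<le> \<beta>" "\<beta> \<le> 1" "\<alpha> + \<beta> \<notin> \<nat>"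
      using alpha c0 Ts beta alpha_beta by auto
    show "\<bar>u0 x\<bar> \<le> b0" "\<bar>u0 (x + h) - u0 x\<bar> \<le> L0 * norm h" for x h by (rule b0, rule L0)
    show "continuous_on ({0..Ts} \<times> UNIV \<times> UNIV \<times> UNIV) (\<lambda>(t, x, p, q). H t x p q)"
      using Ts by (intro continuous_on_subset[OF H_cont]) auto
    have sub: "{0..Ts} \<subseteq> {0..Tstar}" using Ts by auto
    show "\<exists>C>0. \<forall>t\<in>{0..Ts}. \<forall>x. \<bar>H t x 0 0\<bar> \<le> C"
      using H_zero sub by (meson subsetD)
    show "\<forall>R>0. \<exists>C>0. \<forall>t\<in>{0..Ts}. \<forall>x x'.
        \<forall>p\<in>ball 0 R. \<forall>p'\<in>ball 0 R. \<forall>q\<in>ball 0 R. \<forall>q'\<in>ball 0 R.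
          \<bar>H t x' p' q' - H t x p q\<bar> \<le> C * (min (norm (x - x') powr \<beta>) 1 + norm (p - p') + \<bar>q - q'\<bar>)"
    proof (intro allI impI)
      fix R :: real assume "R > 0"
      then obtain C where "C > 0" "\<forall>t\<in>{0..Tstar}. \<forall>x x'.
        \<forall>p\<in>ball 0 R. \<forall>p'\<in>ball 0 R. \<forall>q\<in>ball 0 R. \<forall>q'\<in>ball 0 R.
          \<bar>H t x' p' q' - H t x p q\<bar> \<le> C * (min (norm (x - x') powr \<beta>) 1 + norm (p - p') + \<bar>q - q'\<bar>)"
        using H_lipschitz by blast
      then show "\<exists>C>0. \<forall>t\<in>{0..Ts}. \<forall>x x'.
        \<forall>p\<in>ball 0 R. \<forall>p'\<in>ball 0 R. \<forall>q\<in>ball 0 R. \<forall>q'\<in>ball 0 R.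
          \<bar>H t x' p' q' - H t x p q\<bar> \<le> C * (min (norm (x - x') powr \<beta>) 1 + norm (p - p') + \<bar>q - q'\<bar>)"
        using sub by (intro exI[of _ C] conjI) (auto dest: subsetD)
    qed
    show "linear_on_Cb1 Q" by (rule Q_linear)
    show "\<forall>\<phi>\<in>Cb 1. Q \<phi> \<in> borel_measurable lebesgue" by (rule Q_measurable)
    show "\<exists>C>0. (\<forall>\<phi>\<in>Cb 1. sup_norm (Q \<phi>) \<le> ennreal C * Cb_norm 1 \<phi>) \<and>
        (\<forall>\<sigma>\<in>{0<..\<beta>}. \<forall>\<phi>\<in>Cb (1 + \<sigma>). holder_seminorm \<sigma> (Q \<phi>) \<le> ennreal C * Cb_norm (1 + \<sigma>) \<phi>)"
      by (rule Q_bounded)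
  qed
  from mild_solution_wellposed obtain T0 where "T0 \<in> {0<..Ts}" and T0: "\<forall>T\<in>{0<..T0}. \<exists>u.
      mild_solution p H Q u0 T u \<and> bounded_Cb1 T u \<and>
      (\<forall>v. mild_solution p H Q u0 T v \<and> bounded_Cb1 T v \<longrightarrow> (\<forall>t\<in>{0<..T}. v t = u t)) \<and>
      (\<forall>t\<in>{0<..T}. u t \<in> Cb (\<alpha> + \<beta>))" by blast
  from \<open>T0 \<in> {0<..Ts}\<close> have "T0 \<in> {0<..Tstar}" using Ts_le by simp
  with T0 show ?thesis by blast
qed

end
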